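(* Let $d\ge 3$ be an integer and consider loop percolation on the $d$-regular tree $\mathbb{T}_d$, with percolation probability $\theta(\alpha,\kappa)$ and critical value $\alpha_c(\kappa)$. For all $\kappa>-1$, $$\theta(\alpha_c(\kappa),\kappa)=0.$$
   Context: $\mathbb{T}_d$ is the infinite $d$-regular tree with a fixed vertex $0$ (the root). A based loop is a nearest-neighbor path $\dot\ell=(v_1,\dots,v_n)$ on $\mathbb{T}_d$ ($n\ge 2$, consecutive vertices adjacent) with $v_n$ a neighbor of $v_1$. Loops are equivalence classes of based loops modulo cyclic shifts. For $\kappa>-1$, $\dot\mu_\kappa$ is the measure on based loops with $\dot\mu_\kappa(\dot\ell)=\frac1n\big(\frac1{1+\kappa}\big)^n\big(\frac1d\big)^n$ for $\dot\ell=(v_1,\dots,v_n)$, and $\mu_\kappa$ is its pushforward to loops. $\mathcal{L}_{\alpha,\kappa}$ is the Poisson point process of loops with intensity $\alpha\mu_\kappa$, $\alpha\ge 0$, with law $\mathbb{P}_{\alpha,\kappa}$. A loop is open if it occurs at least once in $\mathcal{L}_{\alpha,\kappa}$. Vertices $u,v$ are loop-connected if there are open loops $\ell_1,\dots,\ell_k$ with $u\in\ell_1$, $v\in\ell_k$ and each consecutive pair $\ell_{i-1},\ell_i$ sharing a vertex (a vertex is always loop-connected to itself). $\mathcal{C}(u)$ is the set of vertices loop-connected to $u$. $\theta(\alpha,\kappa)=\mathbb{P}_{\alpha,\kappa}(|\mathcal{C}(0)|=\infty)$ and $\alpha_c(\kappa)=\inf\{\alpha\ge 0:\theta(\alpha,\kappa)>0\}$.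 *)

theory Defs
  imports "HOL-Probability.Probability"
begin

text \<open>Graphs are given by an adjacency relation on a vertex type.\<close>

definition based_loop :: "('v \<Rightarrow> 'v \<Rightarrow> bool) \<Rightarrow> 'v list \<Rightarrow> bool" where
  "based_loop adj vs \<longleftrightarrow> length vs \<ge> 2 \<and> successively adj vs \<and> adj (last vs) (hd vs)"

text \<open>
  A \<open>d\<close>-regular tree: a simple connected graph, all of whose vertices have degree \<open>d\<close>, without
  cycles (closed walks of length at least 3 with distinct vertices). For \<open>d \<ge> 2\<close> such a tree
  is automatically infinite, and it is unique up to isomorphism.
\<close>

definition regular_tree :: "nat \<Rightarrow> ('v \<Rightarrow> 'v \<Rightarrow> bool) \<Rightarrow> bool" where
  "regular_tree d adj \<longleftrightarrow>
     symp adj \<and> irreflp adj \<and>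
     (\<forall>v. finite {w. adj v w} \<and> card {w. adj v w} = d) \<and>
     (\<forall>u v. adj\<^sup>*\<^sup>* u v) \<and>
     \<not> (\<exists>vs. based_loop adj vs \<and> length vs \<ge> 3 \<and> distinct vs)"

definition cyclic_shift_rel :: "('v \<Rightarrow> 'v \<Rightarrow> bool) \<Rightarrow> ('v list \<times> 'v list) set" where
  "cyclic_shift_rel adj =
     {(vs, ws). based_loop adj vs \<and> based_loop adj ws \<and> (\<exists>k. ws = rotate k vs)}"

definition loops :: "('v \<Rightarrow> 'v \<Rightarrow> bool) \<Rightarrow> 'v list set set" where
  "loops adj = {vs. based_loop adj vs} // cyclic_shift_rel adj"

definition loop_vertices :: "'v list set \<Rightarrow> 'v set" where
  "loop_vertices l = (\<Union>vs\<in>l. set vs)"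

definition based_loop_measure :: "nat \<Rightarrow> ('v \<Rightarrow> 'v \<Rightarrow> bool) \<Rightarrow> real \<Rightarrow> 'v list measure" where
  "based_loop_measure d adj \<kappa> = point_measure {vs. based_loop adj vs}
     (\<lambda>vs. ennreal (1 / real (length vs) * (1 / (1 + \<kappa>)) ^ length vs * (1 / real d) ^ length vs))"

definition loop_measure :: "nat \<Rightarrow> ('v \<Rightarrow> 'v \<Rightarrow> bool) \<Rightarrow> real \<Rightarrow> 'v list set measure" where
  "loop_measure d adj \<kappa> =
     distr (based_loop_measure d adj \<kappa>) (count_space (loops adj)) (\<lambda>vs. cyclic_shift_rel adj `` {vs})"

text \<open>The library's \<open>poisson_pmf\<close> is specified for positive rates only; rate 0 is the point mass at 0.\<close>

definition poisson_law :: "real \<Rightarrow> nat pmf" where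
  "poisson_law r = (if r = 0 then return_pmf 0 else poisson_pmf r)"

text \<open>
  The law of the Poisson point process with intensity measure \<open>\<alpha> \<nu>\<close>, for a measure \<open>\<nu>\<close> on a
  countable discrete space that is finite on points. A point configuration is represented by its
  multiplicity function \<open>\<omega>\<close>, where \<open>\<omega> x\<close> is the number of occurrences of \<open>x\<close>. On a countable
  discrete space the process amounts to independent multiplicities, Poisson distributed with
  parameters \<open>\<alpha> \<nu> {x}\<close>. The total mass of \<open>\<nu>\<close> may be infinite.
\<close>

definition poisson_point_process :: "real \<Rightarrow> 'a measure \<Rightarrow> ('a \<Rightarrow> nat) measure" where
  "poisson_point_process \<alpha> \<nu> =
     (\<Pi>\<^sub>M x\<in>space \<nu>. measure_pmf (poisson_law (\<alpha> * measure \<nu> {x})))"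

definition loop_soup :: "nat \<Rightarrow> ('v \<Rightarrow> 'v \<Rightarrow> bool) \<Rightarrow> real \<Rightarrow> real \<Rightarrow> ('v list set \<Rightarrow> nat) measure" where
  "loop_soup d adj \<alpha> \<kappa> = poisson_point_process \<alpha> (loop_measure d adj \<kappa>)"

definition open_loops :: "('v \<Rightarrow> 'v \<Rightarrow> bool) \<Rightarrow> ('v list set \<Rightarrow> nat) \<Rightarrow> 'v list set set" where
  "open_loops adj \<omega> = {l \<in> loops adj. \<omega> l \<ge> 1}"

definition loop_connected ::
    "('v \<Rightarrow> 'v \<Rightarrow> bool) \<Rightarrow> ('v list set \<Rightarrow> nat) \<Rightarrow> 'v \<Rightarrow> 'v \<Rightarrow> bool" where
  "loop_connected adj \<omega> u v \<longleftrightarrow> u = v \<or>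
     (\<exists>ls. ls \<noteq> [] \<and> set ls \<subseteq> open_loops adj \<omega> \<and>
        u \<in> loop_vertices (hd ls) \<and> v \<in> loop_vertices (last ls) \<and>
        successively (\<lambda>l l'. loop_vertices l \<inter> loop_vertices l' \<noteq> {}) ls)"

definition cluster :: "('v \<Rightarrow> 'v \<Rightarrow> bool) \<Rightarrow> ('v list set \<Rightarrow> nat) \<Rightarrow> 'v \<Rightarrow> 'v set" where
  "cluster adj \<omega> u = {v. loop_connected adj \<omega> u v}"

text \<open>
  On a regular tree there are countably many loops, so the event below is measurable (and not
  assigned probability 0 by the convention for non-measurable sets).
\<close>

definition percolation_prob ::
    "nat \<Rightarrow> ('v \<Rightarrow> 'v \<Rightarrow> bool) \<Rightarrow> 'v \<Rightarrow> real \<Rightarrow> real \<Rightarrow> real" where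
  "percolation_prob d adj r0 \<alpha> \<kappa> =
     measure (loop_soup d adj \<alpha> \<kappa>)
       {\<omega> \<in> space (loop_soup d adj \<alpha> \<kappa>). infinite (cluster adj \<omega> r0)}"

text \<open>
  For \<open>d \<ge> 3\<close> the set is nonempty, because the loops of length 2 alone percolate for large
  \<open>\<alpha>\<close>; hence the infimum can be taken in the reals.
\<close>

definition critical_value :: "nat \<Rightarrow> ('v \<Rightarrow> 'v \<Rightarrow> bool) \<Rightarrow> 'v \<Rightarrow> real \<Rightarrow> real" where
  "critical_value d adj r0 \<kappa> = Inf {\<alpha>. \<alpha> \<ge> 0 \<and> percolation_prob d adj r0 \<alpha> \<kappa> > 0}"

end

theory Submission
  imports Defs
begin

text \<open>
  Orient the tree towards an end, so that every vertex has \<open>b = d - 1\<close> children and every loop has a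
  unique highest vertex, its top. Loops with different tops are independent, and a vertex \<open>v\<close> is
  connected to its \<open>n\<close>-th ancestor by loops below that ancestor with a probability \<open>t n\<close> depending only
  on \<open>n\<close>. Splitting at the lowest uncovered edge of the path shows that \<open>t\<close> solves the renewal
  equation with increments \<open>h k = u (k - 1) - u k\<close>, where \<open>u k\<close> is the probability that an edge is not
  traversed by any loop whose top is at most \<open>k\<close> levels higher.

  If \<open>\<Sum>k. b ^ k * h k > 1\<close>, then \<open>b ^ n * t n > 1\<close> for some \<open>n\<close>, and a supercritical branching
  process embedded in the cluster survives. If the sum is at most 1, then \<open>b ^ n * t n \<le> 1\<close> for all
  \<open>n\<close>; the renewal equation also bounds the mean number of vertices below level \<open>n\<close> reached by loops
  with tops above level \<open>n\<close>, so that the cluster has a chance bounded from below to end at each level,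
  and clusters are finite. Hence percolation occurs if and only if the sum exceeds 1. Since \<open>u k\<close>
  at intensity \<open>\<alpha>\<close> is the \<open>\<alpha>\<close>-th power of \<open>u k\<close> at intensity 1, this condition is open from the left
  in \<open>\<alpha> > 0\<close>, and it fails at \<open>\<alpha> = 0\<close>; so it fails at the critical value.
\<close>

section \<open>The renewal equation\<close>

text \<open>Loops are arbitrarily long, so the levels of a cluster are not the generations of a
  branching process. What remains is the independence of loops with different tops, and this gives
  covered paths their renewal structure. At criticality \<open>b ^ n * t n\<close> is bounded by 1
  but need not decay, and no finite mean of the increments is at hand. The substitute is the age
  identity of renewal theory: its total mass is exactly 1 whatever the tail of the increments, so
  the bound on the vertices reached across level \<open>n\<close> is uniform in \<open>n\<close>.
  The choice of an end has a price: the cluster may also climb along the ancestors of the root. The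
  renewal equation shows that almost surely some ancestral edge is traversed by no loop at all, and
  then the whole cluster lies below that edge. For \<kappa> close to -1 the loops across an edge
  have infinite mass. Everything is therefore phrased by void probabilities, which vanish in that
  case for \<alpha> > 0; the critical value is then 0, where no loop is present.\<close>

text \<open>Here \<open>u k\<close> stands for the probability that an edge is not covered by loops whose top lies
  at most \<open>k\<close> levels above it; \<open>conn_prob u n\<close> is then the probability that a path of \<open>n\<close> edges
  is covered by loops inside the subtree of its highest vertex.\<close>

fun conn_prob :: "(nat \<Rightarrow> real) \<Rightarrow> nat \<Rightarrow> real" where
  "conn_prob u n = 1 - (\<Sum>j<n. u (n - j) * conn_prob u j)"

declare conn_prob.simps [simp del]

lemma conn_prob_0 [simp]: "conn_prob u 0 = 1"
  by (subst conn_prob.simps) simp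

text \<open>For decreasing \<open>u\<close> the terms are nonnegative, so this says that the full
  series, possibly divergent, exceeds 1. Each partial sum involves only finitely many
  \<open>u k\<close>, so the condition survives small changes of a positive intensity.\<close>

definition supercritical :: "nat \<Rightarrow> (nat \<Rightarrow> real) \<Rightarrow> bool" where
  "supercritical b u \<longleftrightarrow> (\<exists>K. (\<Sum>k<K. real b ^ Suc k * (u k - u (Suc k))) > 1)"

text \<open>The recursion says that \<open>u (n - j) * conn_prob u j\<close> sums to 1 over
  \<open>j \<le> n\<close>, for every \<open>n\<close>. Subtracting these identities for two
  consecutive values of \<open>n\<close> leaves the increments of \<open>u\<close>.\<close>

lemma conn_prob_renewal:
  assumes "u 0 = 1"
  shows "conn_prob u (Suc n) = (\<Sum>i\<le>n. (u i - u (Suc i)) * conn_prob u (n - i))"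
proof -
  have 1: "conn_prob u n + (\<Sum>j<n. u (n - j) * conn_prob u j) = 1" for n
    by (subst conn_prob.simps) simp
  have "(\<Sum>j\<le>n. u (n - j) * conn_prob u j) = 1"
    using 1[of n] assms by (simp add: lessThan_Suc_atMost[symmetric])
  then have "conn_prob u (Suc n) =
      (\<Sum>j\<le>n. u (n - j) * conn_prob u j) - (\<Sum>j\<le>n. u (Suc n - j) * conn_prob u j)"
    using 1[of "Suc n"] by (simp add: lessThan_Suc_atMost del: sum.lessThan_Suc)
  also have "\<dots> = (\<Sum>j\<le>n. (u (n - j) - u (Suc n - j)) * conn_prob u j)"
    by (simp add: sum_subtractf left_diff_distrib)
  also have "\<dots> = (\<Sum>i\<le>n. (u i - u (Suc i)) * conn_prob u (n - i))"
    by (rule sum.reindex_bij_witness[of _ "\<lambda>i. n - i" "\<lambda>i. n - i"]) (auto simp: Suc_diff_le)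
  finally show ?thesis .
qed

locale renewal =
  fixes u :: "nat \<Rightarrow> real" and b :: nat
  assumes u0: "u 0 = 1" and u_dec: "decseq u" and b2: "b \<ge> 2" and u_nonneg: "\<And>n. u n \<ge> 0"
begin

text \<open>The factor \<open>b ^ n\<close> counts descendants: with \<open>conn_prob\<close> as a
  connection probability, \<open>level_mean n\<close> is the mean number of descendants at level
  \<open>n\<close> connected to their ancestor. The factor splits along the renewal equation, which
  persists with the increments \<open>weight\<close>.\<close>

definition weight :: "nat \<Rightarrow> real" where "weight k = real b ^ Suc k * (u k - u (Suc k))"
definition level_mean :: "nat \<Rightarrow> real" where "level_mean n = real b ^ n * conn_prob u n"

lemma weight_nonneg: "weight k \<ge> 0"
  using u_dec by (simp add: weight_def decseq_SucD)

lemma level_mean_Suc: "level_mean (Suc n) = (\<Sum>i\<le>n. weight i * level_mean (n - i))"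
  unfolding level_mean_def weight_def conn_prob_renewal[of u n, OF u0] sum_distrib_left
proof (rule sum.cong)
  fix i assume "i \<in> {..n}"
  then have "real b ^ Suc n = real b ^ Suc i * real b ^ (n - i)"
    by (simp flip: power_add)
  then show "real b ^ Suc n * ((u i - u (Suc i)) * conn_prob u (n - i)) =
      real b ^ Suc i * (u i - u (Suc i)) * (real b ^ (n - i) * conn_prob u (n - i))"
    by (simp add: mult_ac del: power_Suc)
qed simp

lemma level_mean_0 [simp]: "level_mean 0 = 1" by (simp add: level_mean_def)

lemma level_mean_nonneg: "level_mean n \<ge> 0"
proof (induction n rule: less_induct)
  case (less n)
  show ?case
  proof (cases n)
    case (Suc k)
    then show ?thesis
      using less by (auto simp: level_mean_Suc intro!: sum_nonneg mult_nonneg_nonneg weight_nonneg)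
  qed simp
qed

lemma conn_prob_nonneg: "conn_prob u n \<ge> 0"
proof -
  have "real b ^ n > 0" using b2 by simp
  then show ?thesis using level_mean_nonneg[of n] by (metis level_mean_def linorder_not_less zero_le_mult_iff)
qed

text \<open>Otherwise the partial sums \<open>S N\<close> of \<open>level_mean\<close> grow at most
  linearly, while increments of mass \<open>?\<gamma> > 1\<close> on \<open>{..<K}\<close> force
  \<open>?\<gamma> * S N \<le> S (N + K)\<close>, that is, exponential growth.\<close>

lemma supercritical_imp_level_mean_gt_1:
  assumes "supercritical b u"
  shows "\<exists>n. level_mean n > 1"
proof (rule ccontr)
  assume "\<not> (\<exists>n. level_mean n > 1)"
  then have le: "level_mean n \<le> 1" for n by (simp add: not_less)
  from assms obtain K where K: "(\<Sum>k<K. weight k) > 1" (is "?\<gamma> > 1")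
    by (auto simp: supercritical_def weight_def)
  define S where "S N = (\<Sum>n<N. level_mean n)" for N
  have S_mono: "S N \<le> S N'" if "N \<le> N'" for N N'
    unfolding S_def using that level_mean_nonneg by (intro sum_mono2) auto
  have S_nonneg: "S N \<ge> 0" for N unfolding S_def by (intro sum_nonneg level_mean_nonneg)
  have step: "?\<gamma> * S N \<le> S (N + K)" for N
  proof -
    have "?\<gamma> * S N = (\<Sum>(k, i)\<in>{..<K} \<times> {..<N}. weight k * level_mean i)"
      by (simp add: S_def sum_product sum.cartesian_product)
    \<comment> \<open>Each product \<open>weight k * level_mean i\<close> is a term of the renewal
      sum for level \<open>Suc (k + i)\<close>; the triangle on the right adds only nonnegative
      terms.\<close>
    also have "\<dots> \<le> (\<Sum>(n, k)\<in>(SIGMA n:{..<N + K - 1}. {..n}). weight k * level_mean (n - k))"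
    proof -
      let ?f = "\<lambda>(k, i). (k + i, k) :: nat \<times> nat"
      have "(\<Sum>(k, i)\<in>{..<K} \<times> {..<N}. weight k * level_mean i) =
          (\<Sum>(n, k)\<in>?f ` ({..<K} \<times> {..<N}). weight k * level_mean (n - k))"
        by (subst sum.reindex) (auto simp: inj_on_def intro!: sum.cong)
      also have "\<dots> \<le> (\<Sum>(n, k)\<in>(SIGMA n:{..<N + K - 1}. {..n}). weight k * level_mean (n - k))"
        by (rule sum_mono2) (auto intro!: mult_nonneg_nonneg weight_nonneg level_mean_nonneg)
      finally show ?thesis .
    qed
    also have "\<dots> = (\<Sum>n<N + K - 1. level_mean (Suc n))"
      by (simp add: level_mean_Suc sum.Sigma)
    also have "\<dots> \<le> S (N + K)"
    proof (cases "N + K")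
      case (Suc l)
      then show ?thesis unfolding S_def by (simp only: sum.lessThan_Suc_shift) simp
    qed (use S_nonneg[of 0] in \<open>simp add: S_def\<close>)
    finally show ?thesis .
  qed
  have pow: "?\<gamma> ^ j \<le> S (Suc (j * K))" for j
  proof (induction j)
    case (Suc j)
    have "?\<gamma> ^ Suc j \<le> ?\<gamma> * S (Suc (j * K))" using Suc K by simp
    also have "\<dots> \<le> S (Suc (j * K) + K)" by (rule step)
    finally show ?case by (simp add: algebra_simps)
  qed (simp add: S_def)
  have "S N \<le> N" for N unfolding S_def using sum_mono[of "{..<N}" level_mean "\<lambda>_. 1"] le by simp
  then have bound: "?\<gamma> ^ j \<le> 1 + real j * real K" for j
    using pow[of j] by (rule_tac order_trans[OF pow]) (smt (verit) of_nat_Suc of_nat_mult)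
  have "(\<lambda>j. (1 + real j * real K) / ?\<gamma> ^ j) \<longlonglongrightarrow> 0"
  proof -
    have "(\<lambda>j. (1 / ?\<gamma>) ^ j + real K * (real j * (1 / ?\<gamma>) ^ j)) \<longlonglongrightarrow> 0 + real K * 0"
      using K by (intro tendsto_add tendsto_mult tendsto_const LIMSEQ_power_zero powser_times_n_limit_0) auto
    then show ?thesis by (simp add: power_divide add_divide_distrib mult.commute mult.left_commute)
  qed
  then have "eventually (\<lambda>j. (1 + real j * real K) / ?\<gamma> ^ j < 1) sequentially"
    by (rule order_tendstoD) simp
  then obtain j where "(1 + real j * real K) / ?\<gamma> ^ j < 1"
    by (auto simp: eventually_sequentially)
  with bound[of j] K show False by (simp add: divide_simps split: if_splits)
qed

context
  assumes sub: "\<not> supercritical b u"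
begin

lemma sum_weight_le: "(\<Sum>k<K. weight k) \<le> 1"
  using sub by (auto simp: supercritical_def weight_def not_less)

lemma level_mean_le_1: "level_mean n \<le> 1"
proof (induction n rule: less_induct)
  case (less n)
  show ?case
  proof (cases n)
    case (Suc k)
    have "level_mean n \<le> (\<Sum>i\<le>k. weight i * 1)"
      unfolding Suc level_mean_Suc using less Suc by (intro sum_mono mult_left_mono weight_nonneg) auto
    also have "\<dots> \<le> 1" using sum_weight_le[of "Suc k"] by (simp add: lessThan_Suc_atMost)
    finally show ?thesis .
  qed simp
qed

lemma conn_prob_le: "conn_prob u n \<le> (1 / 2) ^ n"
proof -
  have "2 ^ n * conn_prob u n \<le> real b ^ n * conn_prob u n"
  proof (rule mult_right_mono)
    show "(2::real) ^ n \<le> real b ^ n" using b2 by (intro power_mono) auto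
  qed (rule conn_prob_nonneg)
  also have "\<dots> \<le> 1" using level_mean_le_1[of n] by (simp add: level_mean_def)
  finally show ?thesis by (simp add: field_simps power_divide)
qed

text \<open>Every weight carries at least one factor \<open>b\<close>, so the total drop
  \<open>1 - u n\<close> is at most \<open>1 / b\<close>. This keeps the cost of dividing by
  \<open>u\<close> at a factor 2 and makes \<open>u 1\<close> positive.\<close>

lemma u_ge_half: "u n \<ge> 1 / 2"
proof -
  have "real b * (1 - u n) = (\<Sum>k<n. real b * (u k - u (Suc k)))"
    by (simp add: sum_lessThan_telescope' u0 flip: sum_distrib_left)
  also have "\<dots> \<le> (\<Sum>k<n. weight k)"
    unfolding weight_def
  proof (intro sum_mono mult_right_mono)
    fix k show "real b \<le> real b ^ Suc k" using b2 self_le_power[of "real b" "Suc k"] by simp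
    show "0 \<le> u k - u (Suc k)" using u_dec by (simp add: decseq_SucD)
  qed
  also have "\<dots> \<le> 1" by (rule sum_weight_le)
  finally have "1 - u n \<le> 1 / real b" using b2 by (simp add: field_simps)
  also have "\<dots> \<le> 1 / 2" using b2 by (simp add: field_simps)
  finally show ?thesis by simp
qed

text \<open>The left-hand side is the total age distribution of a (possibly defective) renewal process with
  increments distributed as \<open>weight\<close>.\<close>

lemma age_sum: "(\<Sum>i<Suc n. level_mean (n - i) * (1 - (\<Sum>k<i. weight k))) = 1"
proof (induction n)
  case (Suc n)
  let ?r = "\<lambda>i. 1 - (\<Sum>k<i. weight k)"
  have "(\<Sum>i<Suc (Suc n). level_mean (Suc n - i) * ?r i) = level_mean (Suc n) + (\<Sum>i<Suc n. level_mean (n - i) * ?r (Suc i))"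
    by (subst sum.lessThan_Suc_shift) simp
  also have "(\<Sum>i<Suc n. level_mean (n - i) * ?r (Suc i)) =
      (\<Sum>i<Suc n. level_mean (n - i) * ?r i) - (\<Sum>i<Suc n. weight i * level_mean (n - i))"
    by (simp only: sum_subtractf[symmetric]) (simp add: algebra_simps sum_subtractf)
  also have "(\<Sum>i<Suc n. weight i * level_mean (n - i)) = level_mean (Suc n)"
    by (simp add: level_mean_Suc lessThan_Suc_atMost del: sum.lessThan_Suc)
  finally show ?case using Suc by simp
qed simp

text \<open>A jump from level \<open>n - Suc i\<close> to level \<open>n + j\<close> has length
  \<open>i + j + 1\<close>, hence weight index \<open>i + j\<close>. Summing over the landing level
  leaves at most the tail of the weights from \<open>i\<close> on, and \<open>age_sum\<close> adds
  these tails up to 1, uniformly in \<open>n\<close> and \<open>J\<close>.\<close>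

lemma age_bound: "(\<Sum>j<J. \<Sum>i<n. weight (i + j) * level_mean (n - Suc i)) \<le> 1"
proof (cases n)
  case (Suc n')
  have "(\<Sum>j<J. \<Sum>i<n. weight (i + j) * level_mean (n - Suc i)) = (\<Sum>i<n. \<Sum>j<J. weight (i + j) * level_mean (n - Suc i))"
    by (rule sum.swap)
  also have "\<dots> = (\<Sum>i<n. level_mean (n - Suc i) * (\<Sum>j<J. weight (i + j)))"
    by (intro sum.cong refl) (simp only: sum_distrib_right[symmetric] mult.commute)
  also have "\<dots> \<le> (\<Sum>i<n. level_mean (n - Suc i) * (1 - (\<Sum>k<i. weight k)))"
  proof (intro sum_mono mult_left_mono level_mean_nonneg)
    fix i
    have "(\<Sum>k<i. weight k) + (\<Sum>j<J. weight (i + j)) = (\<Sum>k<i + J. weight k)"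
      by (induction J) (simp_all add: algebra_simps)
    also have "\<dots> \<le> 1" by (rule sum_weight_le)
    finally show "(\<Sum>j<J. weight (i + j)) \<le> 1 - (\<Sum>k<i. weight k)" by simp
  qed
  also have "\<dots> = 1" using age_sum[of n'] unfolding Suc by simp
  finally show ?thesis .
qed simp

text \<open>Dominated convergence in the identity that \<open>u (N - j) * conn_prob u j\<close> sums
  to 1 over \<open>j \<le> N\<close>: the factor \<open>u (N - j)\<close> tends to \<open>c\<close>,
  and the summable \<open>conn_prob u\<close> dominates.\<close>

lemma conn_prob_sum_tendsto:
  assumes "u \<longlonglongrightarrow> c"
  shows "(\<lambda>n. c * (\<Sum>j<n. conn_prob u j)) \<longlonglongrightarrow> 1"
proof -
  let ?t = "conn_prob u"
  note t0 = conn_prob_nonneg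
  have sm: "summable ?t"
    by (rule summable_comparison_test'[of "\<lambda>n. (1/2)^n" 0]) (use conn_prob_le t0 in auto)
  have one: "(\<Sum>j\<le>N. u (N - j) * ?t j) = 1" for N
    using u0 conn_prob.simps[of u N] by (simp add: lessThan_Suc_atMost[symmetric])
  have u1: "u n \<le> 1" for n using u_dec u0 by (metis decseqD le0)
  have "(\<lambda>N. \<Sum>j. if j \<le> N then u (N - j) * ?t j else 0) \<longlonglongrightarrow> (\<Sum>j. c * ?t j)"
  proof (rule tannerys_theorem[of _ _ _ ?t, THEN conjunct2, THEN conjunct2])
    show "((\<lambda>N. if j \<le> N then u (N - j) * ?t j else 0) \<longlonglongrightarrow> c * ?t j)" for j
    proof (rule Lim_transform_eventually)
      have "(\<lambda>N. u (N - j)) \<longlonglongrightarrow> c"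
        by (rule LIMSEQ_offset[of _ j]) (use assms in simp)
      then show "(\<lambda>N. u (N - j) * ?t j) \<longlonglongrightarrow> c * ?t j"
        by (intro tendsto_mult tendsto_const)
      show "\<forall>\<^sub>F N in sequentially. u (N - j) * ?t j = (if j \<le> N then u (N - j) * ?t j else 0)"
        using eventually_ge_at_top[of j] by eventually_elim simp
    qed
    show "\<forall>\<^sub>F (k, N) in at_top \<times>\<^sub>F sequentially. norm (if k \<le> N then u (N - k) * ?t k else 0) \<le> ?t k"
    proof (intro always_eventually allI, clarify)
      fix k N :: nat
      show "norm (if k \<le> N then u (N - k) * ?t k else 0) \<le> ?t k"
        using u1[of "N - k"] u_nonneg[of "N - k"] t0[of k] by (auto simp: abs_mult intro: mult_left_le_one_le)
    qed
  qed (use sm in auto)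
  moreover have "(\<Sum>j. if j \<le> N then u (N - j) * ?t j else 0) = 1" for N
    using one[of N] suminf_finite[of "{..N}" "\<lambda>j. if j \<le> N then u (N - j) * ?t j else 0"] by simp
  ultimately have "(\<Sum>j. c * ?t j) = 1" by (simp add: LIMSEQ_const_iff)
  then have "c * suminf ?t = 1" using sm by (simp add: suminf_mult)
  moreover have "(\<lambda>n. c * (\<Sum>j<n. ?t j)) \<longlonglongrightarrow> c * suminf ?t"
    by (intro tendsto_mult tendsto_const summable_LIMSEQ sm)
  ultimately show ?thesis by simp
qed

end
end

section \<open>Auxiliary facts on probability spaces\<close>

lemma (in prob_space) indep_events_sigma_sets:
  assumes "indep_events A I" "J \<subseteq> I" "K \<subseteq> I" "J \<inter> K = {}"
    and "E \<in> sigma_sets (space M) (A ` J)" "F \<in> sigma_sets (space M) (A ` K)"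
  shows "prob (E \<inter> F) = prob E * prob F"
proof -
  let ?J = "\<lambda>c. if c then J else K"
  have "indep_sets (\<lambda>j. sigma_sets (space M) (\<Union>i\<in>?J j. {A i})) (UNIV :: bool set)"
  proof (rule indep_sets_collect_sigma)
    show "indep_sets (\<lambda>i. {A i}) (\<Union>j\<in>UNIV. ?J j)"
      by (rule indep_sets_mono_index[of _ I]) (use assms in \<open>auto simp: indep_events_def_alt split: if_splits\<close>)
    show "disjoint_family_on ?J UNIV"
      using assms(4) by (auto simp: disjoint_family_on_def)
  qed (auto simp: Int_stable_def)
  from indep_setsD[OF this, of UNIV "\<lambda>c. if c then E else F"] assms(5,6)
  show ?thesis by (simp add: UNIV_bool Int_commute mult.commute UNION_singleton_eq_range if_distrib cong: if_cong)
qed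

text \<open>Positive correlation of absence events: shrinking \<open>K\<close> to
  \<open>K - J\<close> only enlarges the second event, and after that the two are
  independent.\<close>

lemma (in prob_space) void_Un_ge:
  assumes "indep_events A I" "countable I" "J \<subseteq> I" "K \<subseteq> I"
  shows "prob {\<omega>\<in>space M. \<forall>l\<in>J. \<omega> \<notin> A l} * prob {\<omega>\<in>space M. \<forall>l\<in>K. \<omega> \<notin> A l} \<le>
    prob {\<omega>\<in>space M. \<forall>l\<in>J \<union> K. \<omega> \<notin> A l}"
proof -
  define D where "D J = {\<omega>\<in>space M. \<forall>l\<in>J. \<omega> \<notin> A l}" for J
  have A: "A l \<in> events" if "l \<in> I" for l using assms(1) that by (auto simp: indep_events_def)
  have D: "D J \<in> sigma_sets (space M) (A ` J)" if "J \<subseteq> I" for J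
  proof -
    have "D J = space M - (\<Union>l\<in>J. A l)" by (auto simp: D_def)
    also have "\<dots> \<in> sigma_sets (space M) (A ` J)"
      using countable_subset[OF that assms(2)]
      by (intro sigma_sets.Compl sigma_sets_UNION) (auto intro: sigma_sets.Basic)
    finally show ?thesis .
  qed
  have ev: "D J \<in> events" if "J \<subseteq> I" for J
    using sets.sigma_sets_subset[of "A ` J" M] A D[OF that] that by auto
  have "prob (D J) * prob (D K) \<le> prob (D J) * prob (D (K - J))"
    using assms(4) by (intro mult_left_mono finite_measure_mono ev) (auto simp: D_def)
  also have "\<dots> = prob (D J \<inter> D (K - J))"
    by (rule indep_events_sigma_sets[OF assms(1), of J "K - J", symmetric]) (use assms D[of J] D[of "K - J"] in auto)
  also have "D J \<inter> D (K - J) = D (J \<union> K)" by (auto simp: D_def)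
  finally show ?thesis by (simp only: D_def)
qed

text \<open>Bernoulli's inequality bounds \<open>1 + k * \<epsilon>\<close> by
  \<open>(1 + \<epsilon>) ^ k\<close>, and
  \<open>(1 - \<epsilon>) * (1 + \<epsilon>) \<le> 1\<close>. The bound is nearly linear in
  \<open>k\<close>, so that it can be averaged over a random number \<open>k\<close> of independent
  trials.\<close>

lemma one_minus_power_le:
  fixes \<epsilon> :: real
  assumes "0 \<le> \<epsilon>" "\<epsilon> \<le> 1"
  shows "real k * \<epsilon> / (1 + real k * \<epsilon>) \<le> 1 - (1 - \<epsilon>) ^ k"
proof -
  have "(1 - \<epsilon>) ^ k * (1 + real k * \<epsilon>) \<le> (1 - \<epsilon>) ^ k * (1 + \<epsilon>) ^ k"
    using assms Bernoulli_inequality[of \<epsilon> k] by (intro mult_left_mono) auto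
  also have "\<dots> = (1 - \<epsilon>\<^sup>2) ^ k"
    by (simp flip: power_mult_distrib add: algebra_simps power2_eq_square)
  also have "\<dots> \<le> 1" using assms by (intro power_le_one) (auto simp: power_le_one)
  finally have "(1 - \<epsilon>) ^ k \<le> 1 / (1 + real k * \<epsilon>)"
    using assms by (simp add: pos_le_divide_eq add_pos_nonneg)
  moreover have "real k * \<epsilon> / (1 + real k * \<epsilon>) = 1 - 1 / (1 + real k * \<epsilon>)"
    using assms by (simp add: divide_simps add_nonneg_eq_0_iff)
  ultimately show ?thesis by simp
qed

lemma (in prob_space) prob_partition:
  assumes "finite J" "\<And>j. j \<in> J \<Longrightarrow> E j \<in> events" "disjoint_family_on E J" "S \<in> events"
    and "S \<subseteq> (\<Union>j\<in>J. E j)"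
  shows "prob S = (\<Sum>j\<in>J. prob (S \<inter> E j))"
proof -
  have "S = (\<Union>j\<in>J. S \<inter> E j)" using assms(5) by auto
  also have "prob \<dots> = (\<Sum>j\<in>J. prob (S \<inter> E j))"
    using assms(1-4) by (intro finite_measure_finite_Union) (auto simp: disjoint_family_on_def)
  finally show ?thesis .
qed

text \<open>Markov's inequality for the number of \<open>v\<close> with \<open>Q v\<close>; a count
  exceeding \<open>K\<close> is at least \<open>K + 1\<close>, whence the denominator.\<close>

lemma (in prob_space) prob_many_le:
  assumes "finite F" "\<And>v. v \<in> F \<Longrightarrow> {\<omega>\<in>space M. Q v \<omega>} \<in> events"
    and "(\<Sum>v\<in>F. prob {\<omega>\<in>space M. Q v \<omega>}) \<le> c"
  shows "{\<omega>\<in>space M. K < card {v\<in>F. Q v \<omega>}} \<in> events"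
    and "prob {\<omega>\<in>space M. K < card {v\<in>F. Q v \<omega>}} \<le> c / (real K + 1)"
proof -
  define E where "E v = {\<omega>\<in>space M. Q v \<omega>}" for v
  have E: "E v \<in> events" if "v \<in> F" for v using assms(2)[OF that] by (simp only: E_def)
  define f where "f \<omega> = (\<Sum>v\<in>F. indicator (E v) \<omega> :: real)" for \<omega>
  have card: "f \<omega> = card {v\<in>F. Q v \<omega>}" if "\<omega> \<in> space M" for \<omega>
  proof -
    have "f \<omega> = (\<Sum>v\<in>F. if Q v \<omega> then 1 else 0)"
      unfolding f_def by (rule sum.cong) (use that in \<open>auto simp: E_def\<close>)
    also have "\<dots> = card {v\<in>F. Q v \<omega>}"
      using assms(1) by (simp flip: sum.inter_filter)
    finally show ?thesis .
  qed
  have int1: "integrable M (indicator (E v) :: _ \<Rightarrow> real)" if "v \<in> F" for v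
    by (rule integrable_real_indicator[OF E[OF that]]) (simp add: emeasure_eq_measure)
  have int: "integrable M f"
    unfolding f_def[abs_def] by (rule Bochner_Integration.integrable_sum[OF int1])
  then have meas: "f \<in> borel_measurable M" by (rule borel_measurable_integrable)
  have "expectation f = (\<Sum>v\<in>F. expectation (indicator (E v)))"
    unfolding f_def by (rule Bochner_Integration.integral_sum[OF int1])
  also have "\<dots> = (\<Sum>v\<in>F. prob (E v))"
  proof (rule sum.cong[OF refl])
    fix v
    have "E v \<inter> space M = E v" unfolding E_def by blast
    then show "expectation (indicator (E v)) = prob (E v)" by simp
  qed
  finally have ex: "expectation f \<le> c" using assms(3) by (simp only: E_def)
  have eq: "{\<omega>\<in>space M. K < card {v\<in>F. Q v \<omega>}} = {\<omega>\<in>space M. f \<omega> \<ge> real K + 1}"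
    by (rule Collect_cong) (auto simp: card)
  show "{\<omega>\<in>space M. K < card {v\<in>F. Q v \<omega>}} \<in> events"
    unfolding eq by (rule borel_measurable_le[OF borel_measurable_const meas])
  have "prob {\<omega>\<in>space M. f \<omega> \<ge> real K + 1} \<le> expectation f / (real K + 1)"
    by (rule integral_Markov_inequality_measure[OF int, where A = "{}"])
      (auto simp: f_def intro!: sum_nonneg)
  also have "\<dots> \<le> c / (real K + 1)" using ex by (intro divide_right_mono) auto
  finally show "prob {\<omega>\<in>space M. K < card {v\<in>F. Q v \<omega>}} \<le> c / (real K + 1)" unfolding eq .
qed

text \<open>A conditional lower bound \<open>c\<close> on each piece of a countable partition
  carries over to the union. It serves to condition on the value of a random set.\<close>

lemma (in prob_space) prob_UN_ge:
  assumes "countable \<R>" "disjoint_family_on E \<R>"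
    and "\<And>R. R \<in> \<R> \<Longrightarrow> E R \<in> events" "\<And>R. R \<in> \<R> \<Longrightarrow> F R \<in> events"
    and "\<And>R. R \<in> \<R> \<Longrightarrow> F R \<subseteq> E R" "\<And>R. R \<in> \<R> \<Longrightarrow> c * prob (E R) \<le> prob (F R)" "0 \<le> c"
  shows "c * prob (\<Union>R\<in>\<R>. E R) \<le> prob (\<Union>R\<in>\<R>. F R)"
proof -
  have "ennreal c * emeasure M (\<Union>R\<in>\<R>. E R) = ennreal c * (\<integral>\<^sup>+R. emeasure M (E R) \<partial>count_space \<R>)"
    by (subst emeasure_UN_countable) (use assms in auto)
  also have "\<dots> = (\<integral>\<^sup>+R. ennreal c * emeasure M (E R) \<partial>count_space \<R>)"
    by (rule nn_integral_cmult[symmetric]) simp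
  also have "\<dots> \<le> (\<integral>\<^sup>+R. emeasure M (F R) \<partial>count_space \<R>)"
  proof (rule nn_integral_mono)
    fix R assume "R \<in> space (count_space \<R>)"
    then show "ennreal c * emeasure M (E R) \<le> emeasure M (F R)"
      using assms(6,7) by (simp add: emeasure_eq_measure flip: ennreal_mult')
  qed
  also have "\<dots> = emeasure M (\<Union>R\<in>\<R>. F R)"
  proof (rule emeasure_UN_countable[symmetric, OF _ assms(1)])
    show "disjoint_family_on F \<R>" using assms(2,5) unfolding disjoint_family_on_def by blast
  qed (rule assms(4))
  finally show ?thesis using assms(7) by (simp add: emeasure_eq_measure flip: ennreal_mult')
qed

section \<open>Random loops in a tree oriented towards an end\<close>

text \<open>Since \<open>par\<close> is total, ancestors go on forever, and this direction is the
  end. Different ancestral lines need not meet here; that they do is added in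
  \<open>oriented_tree\<close>.\<close>

locale end_tree =
  fixes par :: "'v \<Rightarrow> 'v" and b :: nat
  assumes b2: "b \<ge> 2"
    and par_acyclic: "(par ^^ k) v = v \<Longrightarrow> k = 0"
    and finite_children: "finite {y. par y = v}"
    and card_children: "card {y. par y = v} = b"
begin

definition desc :: "nat \<Rightarrow> 'v \<Rightarrow> 'v set" where "desc k w = {v. (par ^^ k) v = w}"

lemma par_pow_inj: "(par ^^ i) v = (par ^^ j) v \<Longrightarrow> i = j"
proof (induction i j rule: linorder_wlog)
  case (le i j)
  then have "(par ^^ (j - i)) ((par ^^ i) v) = (par ^^ i) v"
    by (metis comp_apply funpow_add le_add_diff_inverse2)
  from par_acyclic[OF this] le show ?case by simp
qed simp

lemma par_pow_add: "(par ^^ i) ((par ^^ j) v) = (par ^^ (i + j)) v"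
  by (simp add: funpow_add)

lemma desc_disjoint: "v \<in> desc i w \<Longrightarrow> v \<in> desc j w \<Longrightarrow> i = j"
  unfolding desc_def by (metis mem_Collect_eq par_pow_inj)

lemma desc_0 [simp]: "desc 0 w = {w}" by (auto simp: desc_def)

lemma desc_Suc: "desc (Suc k) w = (\<Union>y\<in>desc k w. {v. par v = y})"
  by (auto simp: desc_def funpow_swap1)

lemma desc_Suc': "desc (Suc k) w = (\<Union>y\<in>{v. par v = w}. desc k y)"
  by (auto simp: desc_def)

lemma finite_desc [simp, intro]: "finite (desc k w)"
  by (induction k) (auto simp: desc_Suc finite_children)

lemma card_desc: "card (desc k w) = b ^ k"
proof (induction k)
  case (Suc k)
  have "card (desc (Suc k) w) = (\<Sum>y\<in>desc k w. card {v. par v = y})"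
    unfolding desc_Suc by (rule card_UN_disjoint) (auto simp: finite_children)
  then show ?case using Suc by (simp add: card_children)
qed simp

lemma desc_par_pow: "v \<in> desc (i + k) w \<Longrightarrow> (par ^^ k) v \<in> desc i w"
  by (simp add: desc_def par_pow_add)

end

text \<open>\<open>A l\<close> is the event that the loop \<open>l\<close> occurs, \<open>tp l\<close> is its top and \<open>V l\<close> its set of vertices.
  Isomorphisms between subtrees enter only through the assumption \<open>void_prob\<close>, whose right-hand side
  does not depend on \<open>v\<close>.\<close>

locale loop_cover = end_tree par b + prob_space M
  for par :: "'v \<Rightarrow> 'v" and b :: nat and M :: "'w measure" +
  fixes I :: "'i set" and A :: "'i \<Rightarrow> 'w set" and tp :: "'i \<Rightarrow> 'v" and V :: "'i \<Rightarrow> 'v set"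
    and u :: "nat \<Rightarrow> real"
  assumes countable_I: "countable I"
    and indep_A: "indep_events A I"
    and V_path: "l \<in> I \<Longrightarrow> v \<in> V l \<Longrightarrow> \<exists>k. (par ^^ k) v = tp l \<and> (\<forall>i\<le>k. (par ^^ i) v \<in> V l)"
    and V_child: "l \<in> I \<Longrightarrow> \<exists>c\<in>V l. par c = tp l"
    and void_prob: "prob {\<omega>\<in>space M. \<forall>l\<in>{l\<in>I. v \<in> V l \<and> (\<exists>i\<in>{1..k}. tp l = (par ^^ i) v)}. \<omega> \<notin> A l} = u k"
begin

text \<open>An edge is represented by its lower endpoint: a loop with vertex \<open>v\<close> and top strictly above \<open>v\<close>
  traverses the edge between \<open>v\<close> and its parent.\<close>

definition L :: "nat \<Rightarrow> 'v \<Rightarrow> 'i set" where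
  "L k v = {l\<in>I. v \<in> V l \<and> (\<exists>i\<in>{1..k}. tp l = (par ^^ i) v)}"

definition cov :: "'v set \<Rightarrow> nat \<Rightarrow> 'v \<Rightarrow> 'w \<Rightarrow> bool" where
  "cov X k v \<omega> \<longleftrightarrow> (\<exists>l\<in>L k v. tp l \<in> X \<and> \<omega> \<in> A l)"

text \<open>The bound \<open>k - j\<close> shrinks along the path so that no loop in use has its top
  above the \<open>k\<close>-th ancestor of \<open>v\<close>: the connection stays in the subtree of
  that ancestor. The set \<open>X\<close> restricts the tops further.\<close>

definition conn_via :: "'v set \<Rightarrow> nat \<Rightarrow> 'v \<Rightarrow> 'w \<Rightarrow> bool" where
  "conn_via X k v \<omega> \<longleftrightarrow> (\<forall>j<k. cov X (k - j) ((par ^^ j) v) \<omega>)"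

abbreviation "conn \<equiv> conn_via UNIV"

definition subcluster :: "'v \<Rightarrow> 'w \<Rightarrow> 'v set" where
  "subcluster w \<omega> = {v. \<exists>k. v \<in> desc k w \<and> conn k v \<omega>}"

text \<open>The information carried by the loops with top in \<open>X\<close>. Disjoint sets of tops
  give independent sigma-algebras, so an independence claim amounts to finding the tops on which two
  events depend.\<close>

definition N :: "'v set \<Rightarrow> 'w measure" where
  "N X = sigma (space M) (A ` {l\<in>I. tp l \<in> X})"

section \<open>Measurability and independence by tops\<close>

lemma A_event: "l \<in> I \<Longrightarrow> A l \<in> events"
  using indep_A by (auto simp: indep_events_def)

lemma A_space: "A ` {l\<in>I. P l} \<subseteq> Pow (space M)"
  using A_event sets.sets_into_space by blast

lemma space_N [simp]: "space (N X) = space M"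
  unfolding N_def using A_space by (rule space_measure_of)

lemma sets_N: "sets (N X) = sigma_sets (space M) (A ` {l\<in>I. tp l \<in> X})"
  unfolding N_def using A_space by (rule sets_measure_of)

lemma N_mono: "X \<subseteq> Y \<Longrightarrow> sets (N X) \<subseteq> sets (N Y)"
  unfolding sets_N by (intro sigma_sets_mono') auto

lemma N_event: "E \<in> sets (N X) \<Longrightarrow> E \<in> events"
  using sets.sigma_sets_subset[of "A ` {l\<in>I. tp l \<in> X}" M] A_event unfolding sets_N by auto

lemma pred_A: "l \<in> I \<Longrightarrow> tp l \<in> X \<Longrightarrow> Measurable.pred (N X) (\<lambda>\<omega>. \<omega> \<in> A l)"
proof -
  assume l: "l \<in> I" "tp l \<in> X"
  then have "{\<omega>\<in>space M. \<omega> \<in> A l} = A l"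
    using sets.sets_into_space[OF A_event[OF l(1)]] by auto
  with l show ?thesis by (auto simp: pred_def sets_N intro: sigma_sets.Basic)
qed

lemma indep_N:
  assumes "E \<in> sets (N X)" "F \<in> sets (N Y)" "X \<inter> Y = {}"
  shows "prob (E \<inter> F) = prob E * prob F"
  using indep_events_sigma_sets[OF indep_A, of "{l\<in>I. tp l \<in> X}" "{l\<in>I. tp l \<in> Y}" E F] assms
  by (auto simp: sets_N)

lemma pred_Ex_A:
  assumes "J \<subseteq> I" "\<And>l. l \<in> J \<Longrightarrow> tp l \<in> X"
  shows "Measurable.pred (N X) (\<lambda>\<omega>. \<exists>l\<in>J. \<omega> \<in> A l)"
proof -
  have "{\<omega>\<in>space (N X). \<exists>l\<in>J. \<omega> \<in> A l} = (\<Union>l\<in>J. {\<omega>\<in>space (N X). \<omega> \<in> A l})" by auto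
  also have "\<dots> \<in> sets (N X)"
    using countable_subset[OF assms(1) countable_I] pred_A assms
    by (intro sets.countable_UN'') (auto simp: pred_def subset_iff simp del: space_N)
  finally show ?thesis by (simp add: pred_def)
qed

lemma pred_cov:
  assumes "(\<lambda>i. (par ^^ i) v) ` {1..k} \<inter> X \<subseteq> Y"
  shows "Measurable.pred (N Y) (cov X k v)"
proof -
  have "cov X k v = (\<lambda>\<omega>. \<exists>l\<in>{l\<in>L k v. tp l \<in> X}. \<omega> \<in> A l)"
    by (auto simp: cov_def fun_eq_iff)
  moreover have "Measurable.pred (N Y) \<dots>"
    by (rule pred_Ex_A) (use assms in \<open>auto simp: L_def\<close>)
  ultimately show ?thesis by simp
qed

lemma pred_conn_via:
  assumes "(\<lambda>i. (par ^^ i) v) ` {1..k} \<inter> X \<subseteq> Y"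
  shows "Measurable.pred (N Y) (conn_via X k v)"
proof -
  have "Measurable.pred (N Y) (cov X (k - j) ((par ^^ j) v))" if "j < k" for j
  proof (rule pred_cov, rule subset_trans[OF _ assms], rule Int_mono[OF _ subset_refl])
    show "(\<lambda>i. (par ^^ i) ((par ^^ j) v)) ` {1..k - j} \<subseteq> (\<lambda>i. (par ^^ i) v) ` {1..k}"
      using that by (auto simp: par_pow_add intro!: imageI)
  qed
  then have "Measurable.pred (N Y) (\<lambda>\<omega>. \<forall>j\<in>{..<k}. cov X (k - j) ((par ^^ j) v) \<omega>)"
    by (intro pred_intros_finite) auto
  moreover have "conn_via X k v = (\<lambda>\<omega>. \<forall>j\<in>{..<k}. cov X (k - j) ((par ^^ j) v) \<omega>)"
    unfolding conn_via_def fun_eq_iff by blast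
  ultimately show ?thesis by (simp only:)
qed

lemma sets_N_Collect: "Measurable.pred (N X) P \<Longrightarrow> {\<omega>\<in>space M. P \<omega>} \<in> sets (N X)"
  by (simp add: pred_def)

lemma event_Collect: "Measurable.pred (N X) P \<Longrightarrow> {\<omega>\<in>space M. P \<omega>} \<in> events"
  by (rule N_event[of _ X]) (simp add: pred_def)

lemma indep_pred:
  assumes "Measurable.pred (N X) P" "Measurable.pred (N Y) Q" "X \<inter> Y = {}"
  shows "prob {\<omega>\<in>space M. P \<omega> \<and> Q \<omega>} = prob {\<omega>\<in>space M. P \<omega>} * prob {\<omega>\<in>space M. Q \<omega>}"
proof -
  have "{\<omega>\<in>space M. P \<omega> \<and> Q \<omega>} = {\<omega>\<in>space M. P \<omega>} \<inter> {\<omega>\<in>space M. Q \<omega>}" by auto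
  with indep_N[OF sets_N_Collect[OF assms(1)] sets_N_Collect[OF assms(2)] assms(3)] show ?thesis by simp
qed

lemma prob_not_cov: "prob {\<omega>\<in>space M. \<not> cov UNIV k v \<omega>} = u k"
proof -
  have "{\<omega>\<in>space M. \<not> cov UNIV k v \<omega>} = {\<omega>\<in>space M. \<forall>l\<in>L k v. \<omega> \<notin> A l}"
    by (auto simp: cov_def)
  then show ?thesis using void_prob[of v k] by (simp only: L_def)
qed

lemma L_mono: "k \<le> k' \<Longrightarrow> L k v \<subseteq> L k' v"
  by (auto simp: L_def)

lemma cov_mono: "cov X k v \<omega> \<Longrightarrow> k \<le> k' \<Longrightarrow> X \<subseteq> X' \<Longrightarrow> cov X' k' v \<omega>"
  unfolding cov_def using L_mono[of k k' v] by blast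

lemma u_0: "u 0 = 1"
  using prob_not_cov[of 0 undefined] by (simp add: cov_def L_def prob_space)

lemma event_cov: "{\<omega>\<in>space M. cov X k v \<omega>} \<in> events" "{\<omega>\<in>space M. \<not> cov X k v \<omega>} \<in> events"
proof -
  have "Measurable.pred (N UNIV) (cov X k v)" by (rule pred_cov) simp
  then show "{\<omega>\<in>space M. cov X k v \<omega>} \<in> events" by (rule event_Collect)
  then show "{\<omega>\<in>space M. \<not> cov X k v \<omega>} \<in> events" by (rule sets.sets_Collect_neg)
qed

lemma event_conn: "{\<omega>\<in>space M. conn_via X k v \<omega>} \<in> events"
  by (rule event_Collect[OF pred_conn_via[OF subset_UNIV]])

lemma u_nonneg: "u k \<ge> 0"
  using prob_not_cov[of k undefined] measure_nonneg by metis

lemma u_decseq: "decseq u"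
proof (rule decseq_SucI)
  fix k
  have "prob {\<omega>\<in>space M. \<not> cov UNIV (Suc k) v \<omega>} \<le> prob {\<omega>\<in>space M. \<not> cov UNIV k v \<omega>}" for v
    by (intro finite_measure_mono event_cov) (use cov_mono[of UNIV k _ _ "Suc k" UNIV] in auto)
  then show "u (Suc k) \<le> u k" by (simp add: prob_not_cov)
qed

sublocale renewal u b
  by unfold_locales (use u_0 u_decseq b2 u_nonneg in auto)

text \<open>Decomposition according to the lowest uncovered edge \<open>(par ^^ j) v\<close>: given that it is
  uncovered, the edges below it can only be covered by loops below it.\<close>

lemma lowest_uncovered:
  assumes "j < n"
  shows "(\<not> cov UNIV (n + m - j) ((par ^^ j) v) \<omega> \<and> (\<forall>i<j. cov UNIV (n + m - i) ((par ^^ i) v) \<omega>)) \<longleftrightarrow>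
    (\<not> cov UNIV (n + m - j) ((par ^^ j) v) \<omega> \<and> conn j v \<omega>)"
proof (intro conj_cong refl iffI)
  assume un: "\<not> cov UNIV (n + m - j) ((par ^^ j) v) \<omega>"
  show "conn j v \<omega>" if "\<forall>i<j. cov UNIV (n + m - i) ((par ^^ i) v) \<omega>"
    unfolding conn_via_def
  proof (intro allI impI)
    fix i assume i: "i < j"
    with that obtain l a where l: "l \<in> I" "(par ^^ i) v \<in> V l" "\<omega> \<in> A l"
      "tp l = (par ^^ a) ((par ^^ i) v)" "1 \<le> a" "a \<le> n + m - i"
      by (auto simp: cov_def L_def)
    have "a \<le> j - i"
    proof (rule ccontr)
      assume a: "\<not> a \<le> j - i"
      from V_path[OF l(1,2)] obtain k where k: "(par ^^ k) ((par ^^ i) v) = tp l"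
        "\<And>i'. i' \<le> k \<Longrightarrow> (par ^^ i') ((par ^^ i) v) \<in> V l" by auto
      have "k = a" using k(1) l(4) par_pow_inj by metis
      then have "(par ^^ (j - i)) ((par ^^ i) v) \<in> V l" using k(2) a by simp
      then have "(par ^^ j) v \<in> V l" using i by (simp add: par_pow_add)
      moreover have "tp l = (par ^^ (a - (j - i))) ((par ^^ j) v)"
        using l(4) a i by (simp add: par_pow_add)
      moreover have "a - (j - i) \<in> {1..n + m - j}" using a l(6) i assms by auto
      ultimately have "l \<in> L (n + m - j) ((par ^^ j) v)" using l(1) by (auto simp: L_def)
      with un l(3) show False by (auto simp: cov_def)
    qed
    then have "l \<in> L (j - i) ((par ^^ i) v)" using l by (auto simp: L_def)
    with l(3) show "cov UNIV (j - i) ((par ^^ i) v) \<omega>" by (auto simp: cov_def)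
  qed
  show "\<forall>i<j. cov UNIV (n + m - i) ((par ^^ i) v) \<omega>" if "conn j v \<omega>"
    using that assms by (auto simp: conn_via_def intro: cov_mono)
qed

text \<open>The parameter \<open>m\<close> admits tops up to \<open>m\<close> levels above the path:
  \<open>m = 0\<close> reproduces the recursion of \<open>conn_prob\<close>, and letting
  \<open>m\<close> grow admits all loops. The assumption is the induction hypothesis of
  \<open>prob_conn\<close>.\<close>

lemma prob_covered_path:
  assumes "\<And>j. j < n \<Longrightarrow> prob {\<omega>\<in>space M. conn j v \<omega>} = conn_prob u j"
  shows "prob {\<omega>\<in>space M. \<forall>i<n. cov UNIV (n + m - i) ((par ^^ i) v) \<omega>} =
    1 - (\<Sum>j<n. u (n + m - j) * conn_prob u j)"
proof -
  define B where "B i = cov UNIV (n + m - i) ((par ^^ i) v)" for i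
  define E where "E j = {\<omega>\<in>space M. \<not> B j \<omega> \<and> (\<forall>i<j. B i \<omega>)}" for j
  let ?C = "{\<omega>\<in>space M. \<forall>i<n. B i \<omega>}"
  have B: "{\<omega>\<in>space M. B i \<omega>} \<in> events" "{\<omega>\<in>space M. \<not> B i \<omega>} \<in> events" for i
    unfolding B_def by (rule event_cov)+
  have E_event: "E j \<in> events" for j
    unfolding E_def by (intro sets.sets_Collect_conj sets.sets_Collect_countable_All sets.sets_Collect_imp B) auto
  have C: "?C \<in> events"
    by (intro sets.sets_Collect_countable_All sets.sets_Collect_imp B) auto
  have disj: "disjoint_family_on E {..<n}"
    unfolding disjoint_family_on_def
  proof (intro ballI impI)
    fix i j :: nat assume "i \<noteq> j"
    then show "E i \<inter> E j = {}" by (cases i j rule: linorder_cases) (auto simp: E_def)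
  qed
  have "1 = prob (?C \<union> (\<Union>j<n. E j))"
  proof -
    have "?C \<union> (\<Union>j<n. E j) = space M"
    proof -
      have "\<omega> \<in> ?C \<union> (\<Union>j<n. E j)" if "\<omega> \<in> space M" for \<omega>
      proof (cases "\<exists>i<n. \<not> B i \<omega>")
        case True
        then obtain j where "j < n" "\<not> B j \<omega>" "\<forall>i<j. \<not> (i < n \<and> \<not> B i \<omega>)"
          using exists_least_iff[of "\<lambda>i. i < n \<and> \<not> B i \<omega>"] by blast
        with that have "\<omega> \<in> E j" by (auto simp: E_def)
        with \<open>j < n\<close> show ?thesis by blast
      qed (use that in auto)
      then show ?thesis by (auto simp: E_def)
    qed
    then show ?thesis by (simp add: prob_space)
  qed
  also have "\<dots> = prob ?C + prob (\<Union>j<n. E j)"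
  proof (rule finite_measure_Union)
    show "?C \<inter> (\<Union>j<n. E j) = {}" by (auto simp: E_def)
    show "(\<Union>j<n. E j) \<in> events" by (rule sets.finite_UN) (simp_all add: E_event)
  qed (rule C)
  also have "prob (\<Union>j<n. E j) = (\<Sum>j<n. prob (E j))"
  proof (rule finite_measure_finite_Union)
    show "E ` {..<n} \<subseteq> events" using E_event by blast
  qed (use disj in simp_all)
  also have "\<dots> = (\<Sum>j<n. u (n + m - j) * conn_prob u j)"
  proof (rule sum.cong[OF refl])
    fix j assume j: "j \<in> {..<n}"
    then have "E j = {\<omega>\<in>space M. \<not> B j \<omega> \<and> conn j v \<omega>}"
      using lowest_uncovered[of j n m v] unfolding B_def E_def by blast
    \<comment> \<open>Loops across the edge above the \<open>j\<close>-th ancestor have tops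
      strictly above this ancestor, while \<open>conn j v\<close> uses tops up to it.\<close>
    also have "prob \<dots> = prob {\<omega>\<in>space M. \<not> B j \<omega>} * prob {\<omega>\<in>space M. conn j v \<omega>}"
    proof (rule indep_pred)
      show "Measurable.pred (N ((\<lambda>i. (par ^^ i) v) ` {j<..})) (\<lambda>\<omega>. \<not> B j \<omega>)"
        unfolding B_def by (intro pred_intros_logic pred_cov) (auto simp: par_pow_add)
      show "Measurable.pred (N ((\<lambda>i. (par ^^ i) v) ` {..j})) (conn j v)"
        by (intro pred_conn_via) auto
      show "(\<lambda>i. (par ^^ i) v) ` {j<..} \<inter> (\<lambda>i. (par ^^ i) v) ` {..j} = {}"
        using par_pow_inj by fastforce
    qed
    finally show "prob (E j) = u (n + m - j) * conn_prob u j"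
      using assms j by (simp add: prob_not_cov B_def)
  qed
  finally show ?thesis by (simp add: B_def)
qed

lemma prob_conn: "prob {\<omega>\<in>space M. conn n v \<omega>} = conn_prob u n"
proof (induction n arbitrary: v rule: less_induct)
  case (less n)
  have "{\<omega>\<in>space M. conn n v \<omega>} = {\<omega>\<in>space M. \<forall>i<n. cov UNIV (n + 0 - i) ((par ^^ i) v) \<omega>}"
    by (simp add: conn_via_def)
  with prob_covered_path[of n v 0] less show ?case by (simp add: conn_prob.simps[of u n])
qed

lemma conn_trans:
  assumes "conn i v \<omega>" "conn j ((par ^^ i) v) \<omega>"
  shows "conn (i + j) v \<omega>"
  unfolding conn_via_def
proof (intro allI impI)
  fix a assume "a < i + j"
  show "cov UNIV (i + j - a) ((par ^^ a) v) \<omega>"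
  proof (cases "a < i")
    case True
    then show ?thesis using assms(1) by (auto simp: conn_via_def intro: cov_mono)
  next
    case False
    then have "cov UNIV (j - (a - i)) ((par ^^ (a - i)) ((par ^^ i) v)) \<omega>"
      using assms(2) \<open>a < i + j\<close> unfolding conn_via_def by (metis add.commute less_diff_conv2 not_less)
    then have "cov UNIV (j - (a - i)) ((par ^^ a) v) \<omega>" using False by (simp add: par_pow_add)
    then show ?thesis by (rule cov_mono) (use False in auto)
  qed
qed

lemma conn_upper:
  assumes "conn_via X (i + k) v \<omega>"
  shows "conn_via X i ((par ^^ k) v) \<omega>"
  unfolding conn_via_def
proof (intro allI impI)
  fix a assume "a < i"
  then have "cov X (i + k - (a + k)) ((par ^^ (a + k)) v) \<omega>"
    using assms unfolding conn_via_def by (metis add_less_cancel_right)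
  then show "cov X (i - a) ((par ^^ a) ((par ^^ k) v)) \<omega>"
    by (simp add: par_pow_add)
qed

end

section \<open>Disjoint subtrees and levels of a cluster\<close>

context end_tree
begin

definition below :: "'v \<Rightarrow> 'v set" where "below w = (\<Union>k. desc k w)"
definition upper :: "nat \<Rightarrow> 'v \<Rightarrow> 'v set" where "upper n w = (\<Union>k<n. desc k w)"

lemma desc_trans: "v \<in> desc i y \<Longrightarrow> y \<in> desc j w \<Longrightarrow> v \<in> desc (j + i) w"
  by (auto simp: desc_def funpow_add)

lemma below_disjoint:
  assumes "v \<in> desc n w" "v' \<in> desc n w" "v \<noteq> v'"
  shows "below v \<inter> below v' = {}"
proof (rule ccontr)
  assume "below v \<inter> below v' \<noteq> {}"
  then obtain z i j where z: "z \<in> desc i v" "z \<in> desc j v'" by (auto simp: below_def)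
  have "n + i = n + j"
    by (rule desc_disjoint[OF desc_trans[OF z(1) assms(1)] desc_trans[OF z(2) assms(2)]])
  with z assms(3) show False by (auto simp: desc_def)
qed

lemma upper_below_disjoint: "v \<in> desc n w \<Longrightarrow> upper n w \<inter> below v = {}"
  unfolding upper_def below_def by (auto dest: desc_disjoint[OF desc_trans])

lemma countable_below: "countable (below w)"
  by (auto simp: below_def intro: countable_finite)

end

context loop_cover
begin

text \<open>A connection to \<open>w\<close> restricts to every ancestor on the way
  (\<open>conn_upper\<close>), so one empty level confines the subcluster to finitely many levels,
  all finite. Conversely, vertices on different levels are distinct.\<close>

lemma infinite_subcluster_iff:
  "infinite (subcluster w \<omega>) \<longleftrightarrow> (\<forall>k. \<exists>v\<in>desc k w. conn k v \<omega>)"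
proof
  assume inf: "infinite (subcluster w \<omega>)"
  show "\<forall>k. \<exists>v\<in>desc k w. conn k v \<omega>"
  proof (rule ccontr)
    assume "\<not> ?thesis"
    then obtain k where k: "\<And>v. v \<in> desc k w \<Longrightarrow> \<not> conn k v \<omega>" by auto
    have "subcluster w \<omega> \<subseteq> upper k w"
    proof
      fix v assume "v \<in> subcluster w \<omega>"
      then obtain j where j: "v \<in> desc j w" "conn j v \<omega>" by (auto simp: subcluster_def)
      have "j < k"
      proof (rule ccontr)
        assume "\<not> j < k"
        then have eq: "j = k + (j - k)" by simp
        have "(par ^^ (j - k)) v \<in> desc k w" using j(1) eq desc_par_pow by metis
        moreover have "conn k ((par ^^ (j - k)) v) \<omega>" using j(2) eq conn_upper by metis
        ultimately show False using k by blast
      qed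
      with j show "v \<in> upper k w" by (auto simp: upper_def)
    qed
    with inf show False by (metis finite_UN_I finite_desc finite_lessThan infinite_super upper_def)
  qed
next
  assume "\<forall>k. \<exists>v\<in>desc k w. conn k v \<omega>"
  then obtain f where f: "\<And>k. f k \<in> desc k w" "\<And>k. conn k (f k) \<omega>" by metis
  have "inj f" using f(1) by (intro injI) (metis desc_disjoint)
  then have "infinite (range f)" by (rule range_inj_infinite)
  moreover have "range f \<subseteq> subcluster w \<omega>" using f by (auto simp: subcluster_def)
  ultimately show "infinite (subcluster w \<omega>)" by (rule infinite_super[rotated])
qed

lemma event_level: "{\<omega>\<in>space M. \<exists>v\<in>desc k w. conn k v \<omega>} \<in> events"
  by (intro sets.sets_Collect_finite_Ex event_conn finite_desc)

lemma event_infinite: "{\<omega>\<in>space M. infinite (subcluster w \<omega>)} \<in> events"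
  unfolding infinite_subcluster_iff by (intro sets.sets_Collect_countable_All event_level)

subsection \<open>The supercritical case\<close>

text \<open>Survival for \<open>k\<close> generations of the embedded branching process, in which a
  generation spans \<open>n\<close> levels and the offspring of \<open>w\<close> are the vertices
  \<open>n\<close> levels below connected to it. Siblings may be dependent, but what happens below
  them is independent, also of the offspring set itself.\<close>

primrec surv :: "nat \<Rightarrow> nat \<Rightarrow> 'v \<Rightarrow> 'w \<Rightarrow> bool" where
  "surv n 0 w \<omega> = True"
| "surv n (Suc k) w \<omega> = (\<exists>v\<in>desc n w. conn n v \<omega> \<and> surv n k v \<omega>)"

lemma pred_conn_upper: "v \<in> desc n w \<Longrightarrow> Measurable.pred (N (upper n w)) (conn n v)"
proof (rule pred_conn_via)
  assume v: "v \<in> desc n w"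
  have "(par ^^ i) v \<in> upper n w" if "i \<in> {1..n}" for i
  proof -
    have "(par ^^ i) v \<in> desc (n - i) w" using v that by (intro desc_par_pow) auto
    then show ?thesis using that by (auto simp: upper_def intro!: bexI[of _ "n - i"])
  qed
  then show "(\<lambda>i. (par ^^ i) v) ` {1..n} \<inter> UNIV \<subseteq> upper n w" by blast
qed

lemma pred_N_mono: "Measurable.pred (N X) P \<Longrightarrow> X \<subseteq> Y \<Longrightarrow> Measurable.pred (N Y) P"
  using N_mono[of X Y] by (auto simp: pred_def)

lemma pred_surv: "Measurable.pred (N (below w)) (surv n k w)"
proof (induction k arbitrary: w)
  case (Suc k)
  have "Measurable.pred (N (below w)) (\<lambda>\<omega>. conn n v \<omega> \<and> surv n k v \<omega>)" if v: "v \<in> desc n w" for v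
  proof (rule pred_intros_logic)
    show "Measurable.pred (N (below w)) (conn n v)"
      by (rule pred_N_mono[OF pred_conn_upper[OF v]]) (auto simp: upper_def below_def)
    show "Measurable.pred (N (below w)) (surv n k v)"
      by (rule pred_N_mono[OF Suc]) (use desc_trans[OF _ v] in \<open>auto simp: below_def\<close>)
  qed
  then have "Measurable.pred (N (below w)) (\<lambda>\<omega>. \<exists>v\<in>desc n w. conn n v \<omega> \<and> surv n k v \<omega>)"
    by (intro pred_intros_finite) auto
  then show ?case by (simp only: surv.simps(2)[abs_def])
qed (simp add: surv.simps(1)[abs_def])

lemma event_surv: "{\<omega>\<in>space M. surv n k w \<omega>} \<in> events"
  by (rule event_Collect[OF pred_surv])

lemma surv_antimono: "surv n (Suc k) w \<omega> \<Longrightarrow> surv n k w \<omega>"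
  by (induction k arbitrary: w) auto

lemma surv_imp_conn: "surv n k w \<omega> \<Longrightarrow> \<exists>v\<in>desc (n * k) w. conn (n * k) v \<omega>"
proof (induction k arbitrary: w)
  case (Suc k)
  from Suc.prems obtain v where v: "v \<in> desc n w" "conn n v \<omega>" "surv n k v \<omega>" by auto
  from Suc.IH[OF v(3)] obtain v' where v': "v' \<in> desc (n * k) v" "conn (n * k) v' \<omega>" by blast
  with v have "(par ^^ (n * k)) v' = v" by (simp add: desc_def)
  with v v' have "conn (n * k + n) v' \<omega>" by (intro conn_trans) simp_all
  moreover have "v' \<in> desc (n + n * k) w" using v(1) v'(1) desc_trans by blast
  ultimately show ?case by (auto simp: add.commute)
qed (auto simp: conn_via_def)

lemma prob_none_le:
  assumes "finite Y" "\<And>v. v \<in> Y \<Longrightarrow> Measurable.pred (N (below v)) (Q v)"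
    and "\<And>v. v \<in> Y \<Longrightarrow> \<epsilon> \<le> prob {\<omega>\<in>space M. Q v \<omega>}" "0 \<le> \<epsilon>"
    and "\<And>v v'. v \<in> Y \<Longrightarrow> v' \<in> Y \<Longrightarrow> v \<noteq> v' \<Longrightarrow> below v \<inter> below v' = {}"
  shows "prob {\<omega>\<in>space M. \<forall>v\<in>Y. \<not> Q v \<omega>} \<le> (1 - \<epsilon>) ^ card Y"
  using assms
proof (induction Y rule: finite_induct)
  case (insert y Y)
  have Qy: "Measurable.pred (N (below y)) (Q y)" using insert by simp
  have "Measurable.pred (N (\<Union>v\<in>Y. below v)) (Q v)" if "v \<in> Y" for v
    by (rule pred_N_mono[where X = "below v"]) (use that insert in auto)
  then have QY: "Measurable.pred (N (\<Union>v\<in>Y. below v)) (\<lambda>\<omega>. \<forall>v\<in>Y. \<not> Q v \<omega>)"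
    by (intro pred_intros_finite pred_intros_logic insert) auto
  have "{\<omega>\<in>space M. \<forall>v\<in>insert y Y. \<not> Q v \<omega>} = {\<omega>\<in>space M. \<not> Q y \<omega> \<and> (\<forall>v\<in>Y. \<not> Q v \<omega>)}" by auto
  also have "prob \<dots> = prob {\<omega>\<in>space M. \<not> Q y \<omega>} * prob {\<omega>\<in>space M. \<forall>v\<in>Y. \<not> Q v \<omega>}"
    by (rule indep_pred[OF pred_intros_logic(2)[OF Qy] QY]) (use insert in fastforce)
  also have "prob {\<omega>\<in>space M. \<not> Q y \<omega>} = 1 - prob {\<omega>\<in>space M. Q y \<omega>}"
    by (rule prob_neg[OF event_Collect[OF Qy]])
  also have "\<dots> * prob {\<omega>\<in>space M. \<forall>v\<in>Y. \<not> Q v \<omega>} \<le> (1 - \<epsilon>) * (1 - \<epsilon>) ^ card Y"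
  proof (rule mult_mono)
    show "0 \<le> 1 - \<epsilon>" using insert.prems(2)[of y] order_trans[OF _ prob_le_1] by fastforce
  qed (use insert in auto)
  finally show ?case using insert by simp
qed (simp add: prob_space)

text \<open>The constant is tuned to be a fixed point. If \<epsilon> bounds the survival of each
  line of descent, then offspring \<open>Y\<close> gives survival with probability at least
  \<open>1 - (1 - \<epsilon>) ^ card Y\<close>, hence at least
  \<open>card Y * \<epsilon> / (1 + card Y * \<epsilon>)\<close>. As
  \<open>card Y \<le> b ^ n\<close>, the denominator is at most
  \<open>1 + b ^ n * \<epsilon> = level_mean n\<close>. Averaging over \<open>Y\<close>, whose mean
  size is \<open>level_mean n\<close>, returns \<epsilon>.\<close>

lemma prob_surv_ge:
  assumes "level_mean n > 1"
  defines "\<epsilon> \<equiv> (level_mean n - 1) / real b ^ n"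
  shows "\<epsilon> \<le> prob {\<omega>\<in>space M. surv n k w \<omega>}"
proof -
  define B where "B = real b ^ n"
  have B: "B > 0" using b2 by (simp add: B_def)
  have "conn_prob u n \<le> 1" using prob_conn[of n undefined] prob_le_1 by metis
  then have "level_mean n \<le> B" using B by (simp add: level_mean_def B_def)
  then have eps: "0 < \<epsilon>" "\<epsilon> \<le> 1" using assms B by (auto simp: \<epsilon>_def B_def field_simps)
  show ?thesis
  proof (induction k arbitrary: w)
    case 0 then show ?case using eps by (simp add: prob_space)
  next
    case (Suc k)
    let ?F = "desc n w"
    define E where "E Y = {\<omega>\<in>space M. \<forall>v\<in>?F. conn n v \<omega> = (v \<in> Y)}" for Y
    define S where "S = {\<omega>\<in>space M. surv n (Suc k) w \<omega>}"
    have predE: "Measurable.pred (N (upper n w)) (\<lambda>\<omega>. \<forall>v\<in>?F. conn n v \<omega> = (v \<in> Y))" for Y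
      by (intro pred_intros_finite pred_intros_logic pred_conn_upper) auto
    have E: "E Y \<in> events" for Y unfolding E_def by (rule event_Collect[OF predE])
    have disj: "disjoint_family_on E (Pow ?F)"
      unfolding disjoint_family_on_def
    proof (intro ballI impI)
      fix Y Y' assume "Y \<in> Pow ?F" "Y' \<in> Pow ?F" "Y \<noteq> Y'"
      then obtain v where "v \<in> ?F" "(v \<in> Y) \<noteq> (v \<in> Y')" by blast
      then show "E Y \<inter> E Y' = {}" by (auto simp: E_def)
    qed
    have cover: "space M \<subseteq> (\<Union>Y\<in>Pow ?F. E Y)"
    proof
      fix \<omega> assume "\<omega> \<in> space M"
      then have "\<omega> \<in> E {v\<in>?F. conn n v \<omega>}" by (auto simp: E_def)
      then show "\<omega> \<in> (\<Union>Y\<in>Pow ?F. E Y)" by (rule UN_I[rotated]) auto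
    qed
    have S: "S \<in> events" unfolding S_def by (rule event_surv)
    have ge: "prob (S \<inter> E Y) \<ge> prob (E Y) * (real (card Y) * (\<epsilon> / level_mean n))" if Y: "Y \<subseteq> ?F" for Y
    proof -
      have finY: "finite Y" using Y finite_desc finite_subset by blast
      have SE: "S \<inter> E Y = {\<omega>\<in>space M. (\<forall>v\<in>?F. conn n v \<omega> = (v \<in> Y)) \<and> (\<exists>v\<in>Y. surv n k v \<omega>)}"
        using Y by (auto simp: S_def E_def)
      have predv: "Measurable.pred (N (\<Union>v\<in>Y. below v)) (surv n k v)" if "v \<in> Y" for v
        by (rule pred_N_mono[OF pred_surv]) (use that in auto)
      have predS: "Measurable.pred (N (\<Union>v\<in>Y. below v)) (\<lambda>\<omega>. \<exists>v\<in>Y. surv n k v \<omega>)"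
        by (intro pred_intros_finite predv finY)
      have prod: "prob (S \<inter> E Y) = prob (E Y) * prob {\<omega>\<in>space M. \<exists>v\<in>Y. surv n k v \<omega>}"
        unfolding SE unfolding E_def
        by (rule indep_pred[OF predE predS]) (use Y upper_below_disjoint in blast)
      have "prob {\<omega>\<in>space M. \<not> (\<exists>v\<in>Y. surv n k v \<omega>)} =
          1 - prob {\<omega>\<in>space M. \<exists>v\<in>Y. surv n k v \<omega>}"
        by (rule prob_neg[OF event_Collect[OF predS]])
      moreover have "prob {\<omega>\<in>space M. \<forall>v\<in>Y. \<not> surv n k v \<omega>} \<le> (1 - \<epsilon>) ^ card Y"
      proof (rule prob_none_le[OF finY])
        show "below v \<inter> below v' = {}" if "v \<in> Y" "v' \<in> Y" "v \<noteq> v'" for v v'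
          using below_disjoint that Y by blast
      qed (use pred_surv Suc eps in auto)
      moreover have "real (card Y) * (\<epsilon> / level_mean n) \<le> real (card Y) * \<epsilon> / (1 + real (card Y) * \<epsilon>)"
      proof -
        have "card Y \<le> b ^ n" using card_mono[OF finite_desc Y] by (simp add: card_desc)
        then have "real (card Y) \<le> B" unfolding B_def by (metis of_nat_le_iff of_nat_power)
        then have "1 + real (card Y) * \<epsilon> \<le> 1 + B * \<epsilon>" using eps by (simp add: mult_right_mono)
        also have "\<dots> = level_mean n" using B by (simp add: \<epsilon>_def B_def)
        finally have "real (card Y) * \<epsilon> / level_mean n \<le> real (card Y) * \<epsilon> / (1 + real (card Y) * \<epsilon>)"
          using eps assms(1) by (intro divide_left_mono mult_pos_pos) (auto simp: add_pos_nonneg)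
        then show ?thesis by simp
      qed
      ultimately have "real (card Y) * (\<epsilon> / level_mean n) \<le> prob {\<omega>\<in>space M. \<exists>v\<in>Y. surv n k v \<omega>}"
        using one_minus_power_le[of \<epsilon> "card Y"] eps by simp
      then show ?thesis unfolding prod by (rule mult_left_mono) simp
    qed
    \<comment> \<open>The mean size of the offspring set, by counting the pairs of a vertex
      \<open>v\<close> and a value \<open>Y\<close> containing it in two ways.\<close>
    have "level_mean n = (\<Sum>v\<in>?F. prob {\<omega>\<in>space M. conn n v \<omega>})"
      by (simp add: prob_conn card_desc level_mean_def)
    also have "\<dots> = (\<Sum>v\<in>?F. \<Sum>Y\<in>Pow ?F. if v \<in> Y then prob (E Y) else 0)"
    proof (rule sum.cong[OF refl])
      fix v assume v: "v \<in> ?F"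
      let ?C = "{\<omega>\<in>space M. conn n v \<omega>}"
      have "prob ?C = (\<Sum>Y\<in>Pow ?F. prob (?C \<inter> E Y))"
        by (rule prob_partition[OF _ E disj event_conn subset_trans[OF _ cover]]) auto
      also have "\<dots> = (\<Sum>Y\<in>Pow ?F. if v \<in> Y then prob (E Y) else 0)"
      proof (rule sum.cong[OF refl])
        fix Y
        show "prob (?C \<inter> E Y) = (if v \<in> Y then prob (E Y) else 0)"
        proof (cases "v \<in> Y")
          case True
          then have "?C \<inter> E Y = E Y" using v unfolding E_def by blast
          with True show ?thesis by (simp only: if_True)
        next
          case False
          then have "?C \<inter> E Y = {}" using v unfolding E_def by blast
          with False show ?thesis by (simp only: if_False measure_empty)
        qed
      qed
      finally show "prob ?C = (\<Sum>Y\<in>Pow ?F. if v \<in> Y then prob (E Y) else 0)" .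
    qed
    also have "\<dots> = (\<Sum>Y\<in>Pow ?F. \<Sum>v\<in>?F. if v \<in> Y then prob (E Y) else 0)" by (rule sum.swap)
    also have "\<dots> = (\<Sum>Y\<in>Pow ?F. real (card Y) * prob (E Y))"
    proof (rule sum.cong[OF refl])
      fix Y assume "Y \<in> Pow ?F"
      then have "?F \<inter> Y = Y" by auto
      then show "(\<Sum>v\<in>?F. if v \<in> Y then prob (E Y) else 0) = real (card Y) * prob (E Y)"
        by (simp flip: sum.inter_restrict)
    qed
    finally have mean: "level_mean n = (\<Sum>Y\<in>Pow ?F. real (card Y) * prob (E Y))" .
    have "\<epsilon> = \<epsilon> / level_mean n * (\<Sum>Y\<in>Pow ?F. real (card Y) * prob (E Y))"
      using assms(1) unfolding mean[symmetric] by simp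
    also have "\<dots> = (\<Sum>Y\<in>Pow ?F. prob (E Y) * (real (card Y) * (\<epsilon> / level_mean n)))"
      unfolding sum_distrib_left by (simp add: mult_ac)
    also have "\<dots> \<le> (\<Sum>Y\<in>Pow ?F. prob (S \<inter> E Y))" using ge by (intro sum_mono) auto
    also have "\<dots> = prob S"
      by (rule prob_partition[OF _ E disj S subset_trans[OF sets.sets_into_space[OF S] cover], symmetric]) auto
    finally show ?case unfolding S_def .
  qed
qed

theorem prob_infinite_pos:
  assumes "supercritical b u"
  shows "prob {\<omega>\<in>space M. infinite (subcluster w \<omega>)} > 0"
proof -
  from supercritical_imp_level_mean_gt_1[OF assms] obtain n where n: "level_mean n > 1" by auto
  then have n0: "n > 0" by (cases n) auto
  define \<epsilon> where "\<epsilon> = (level_mean n - 1) / real b ^ n"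
  define S where "S k = {\<omega>\<in>space M. surv n k w \<omega>}" for k
  have S: "S k \<in> events" for k unfolding S_def by (rule event_surv)
  have dec: "decseq S"
    by (intro decseq_SucI) (unfold S_def, use surv_antimono in blast)
  have lim: "(\<lambda>k. prob (S k)) \<longlonglongrightarrow> prob (\<Inter>k. S k)"
    by (rule finite_Lim_measure_decseq[OF _ dec]) (use S in auto)
  have "\<epsilon> \<le> prob (\<Inter>k. S k)"
    by (rule LIMSEQ_le_const[OF lim]) (use prob_surv_ge[OF n] in \<open>auto simp: S_def \<epsilon>_def\<close>)
  also have "\<dots> \<le> prob {\<omega>\<in>space M. infinite (subcluster w \<omega>)}"
  proof (rule finite_measure_mono[OF _ event_infinite], rule subsetI)
    fix \<omega> assume \<omega>: "\<omega> \<in> (\<Inter>k. S k)"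
    have "\<exists>v\<in>desc k w. conn k v \<omega>" for k
    proof -
      obtain v where v: "v \<in> desc (n * k) w" "conn (n * k) v \<omega>"
        using \<omega> surv_imp_conn[of n k w \<omega>] by (auto simp: S_def)
      have eq: "n * k = k + (n * k - k)" using n0 by simp
      have "(par ^^ (n * k - k)) v \<in> desc k w" using v(1) eq desc_par_pow by metis
      moreover have "conn k ((par ^^ (n * k - k)) v) \<omega>" using v(2) eq conn_upper by metis
      ultimately show ?thesis by blast
    qed
    then show "\<omega> \<in> {\<omega>\<in>space M. infinite (subcluster w \<omega>)}"
      using \<omega> by (auto simp: infinite_subcluster_iff S_def)
  qed
  finally show ?thesis using n b2 by (auto simp: \<epsilon>_def intro: order_less_le_trans[rotated])
qed

subsection \<open>The subcritical and critical cases\<close>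

lemma covI:
  assumes "l \<in> I" "v \<in> V l" "1 \<le> i" "i \<le> k" "tp l = (par ^^ i) v" "tp l \<in> X" "\<omega> \<in> A l"
  shows "cov X k v \<omega>"
proof -
  have "\<exists>i\<in>{1..k}. tp l = (par ^^ i) v" using assms by (intro bexI[of _ i]) auto
  with assms have "l \<in> L k v" unfolding L_def by blast
  with assms show ?thesis unfolding cov_def by blast
qed

lemma covE:
  assumes "cov X k v \<omega>"
  obtains l i where "l \<in> I" "v \<in> V l" "1 \<le> i" "i \<le> k" "tp l = (par ^^ i) v" "tp l \<in> X" "\<omega> \<in> A l"
  using assms unfolding cov_def L_def by (auto simp del: funpow.simps)

text \<open>Loops over \<open>v\<close> with top exactly at the ancestor of order
  \<open>Suc k\<close> are independent of those with lower tops, so \<open>u (Suc k)\<close> is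
  \<open>u k\<close> times the probability that no such loop occurs.\<close>

lemma prob_top_cov:
  assumes "u k > 0"
  shows "prob {\<omega>\<in>space M. cov {(par ^^ Suc k) v} (Suc k) v \<omega>} = (u k - u (Suc k)) / u k"
proof -
  let ?y = "(par ^^ Suc k) v"
  have split: "cov UNIV (Suc k) v \<omega> \<longleftrightarrow> cov UNIV k v \<omega> \<or> cov {?y} (Suc k) v \<omega>" for \<omega>
  proof
    assume "cov UNIV (Suc k) v \<omega>"
    then obtain l i where l: "l \<in> I" "v \<in> V l" "1 \<le> i" "i \<le> Suc k" "tp l = (par ^^ i) v" "\<omega> \<in> A l"
      by (rule covE)
    show "cov UNIV k v \<omega> \<or> cov {?y} (Suc k) v \<omega>"
    proof (cases "i = Suc k")
      case True
      with l have "cov {?y} (Suc k) v \<omega>" by (intro covI[of l v i]) simp_all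
      then show ?thesis ..
    next
      case False
      with l have "cov UNIV k v \<omega>" by (intro covI[of l v i]) simp_all
      then show ?thesis ..
    qed
  next
    assume "cov UNIV k v \<omega> \<or> cov {?y} (Suc k) v \<omega>"
    then show "cov UNIV (Suc k) v \<omega>"
      using cov_mono[of UNIV k v \<omega> "Suc k" UNIV] cov_mono[of "{?y}" "Suc k" v \<omega> "Suc k" UNIV] by auto
  qed
  have p1: "Measurable.pred (N ((\<lambda>i. (par ^^ i) v) ` {1..k})) (\<lambda>\<omega>. \<not> cov UNIV k v \<omega>)"
    by (intro pred_intros_logic pred_cov) auto
  have p2: "Measurable.pred (N {?y}) (cov {?y} (Suc k) v)"
    by (rule pred_cov) auto
  have "u (Suc k) = prob {\<omega>\<in>space M. \<not> cov UNIV k v \<omega> \<and> \<not> cov {?y} (Suc k) v \<omega>}"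
    using prob_not_cov[of "Suc k" v] by (simp only: split de_Morgan_disj)
  also have "\<dots> = prob {\<omega>\<in>space M. \<not> cov UNIV k v \<omega>} * prob {\<omega>\<in>space M. \<not> cov {?y} (Suc k) v \<omega>}"
  proof (rule indep_pred[OF p1 pred_intros_logic(2)[OF p2]])
    show "(\<lambda>i. (par ^^ i) v) ` {1..k} \<inter> {?y} = {}"
    proof -
      have "(par ^^ i) v \<noteq> ?y" if "i \<in> {1..k}" for i
        using par_pow_inj[of i v "Suc k"] that by (auto simp del: funpow.simps)
      then show ?thesis by blast
    qed
  qed
  also have "prob {\<omega>\<in>space M. \<not> cov {?y} (Suc k) v \<omega>} = 1 - prob {\<omega>\<in>space M. cov {?y} (Suc k) v \<omega>}"
    by (rule prob_neg[OF event_Collect[OF p2]])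
  finally have "u (Suc k) = u k * (1 - prob {\<omega>\<in>space M. cov {?y} (Suc k) v \<omega>})"
    by (simp only: prob_not_cov)
  then show ?thesis using assms by (simp add: field_simps)
qed

text \<open>The front at level \<open>n\<close> is determined by the loops with top above level \<open>n\<close>, so it is independent
  of the event \<open>closed_tops R\<close> for every set \<open>R\<close> of possible front vertices; if it is finite and all
  loops with top in it are absent, the cluster stops growing.\<close>

definition front :: "nat \<Rightarrow> 'v \<Rightarrow> 'w \<Rightarrow> 'v set" where
  "front n w \<omega> = {v. \<exists>e\<ge>n. v \<in> desc e w \<and> conn_via (upper n w) e v \<omega>}"

definition closed_tops :: "'v set \<Rightarrow> 'w \<Rightarrow> bool" where
  "closed_tops R \<omega> \<longleftrightarrow> (\<forall>l\<in>I. tp l \<in> R \<longrightarrow> \<omega> \<notin> A l)"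

text \<open>One loop bridges level \<open>n\<close>: it contains the front vertex at depth
  \<open>n + j\<close> and has its top at some depth \<open>n - Suc i\<close>, from where the
  connection continues up to \<open>w\<close>. In renewal terms \<open>i\<close> is the age and
  \<open>j\<close> the excess at level \<open>n\<close>.\<close>

lemma front_split:
  assumes "n > 0" "v \<in> desc (n + j) w" "conn_via (upper n w) (n + j) v \<omega>"
  shows "\<exists>i<n. conn (n - Suc i) ((par ^^ Suc (i + j)) v) \<omega> \<and>
    cov {(par ^^ Suc (i + j)) v} (Suc (i + j)) v \<omega>"
proof -
  have "cov (upper n w) (n + j) v \<omega>"
    using assms(1,3) unfolding conn_via_def by (metis add_gr_0 diff_zero funpow_0)
  then obtain l m where l: "l \<in> I" "v \<in> V l" "m \<in> {1..n + j}" "tp l = (par ^^ m) v" "\<omega> \<in> A l"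
    "tp l \<in> upper n w"
    by (rule covE) auto
  have "(par ^^ m) v \<in> desc (n + j - m) w" using assms(2) l(3) by (intro desc_par_pow) auto
  then have "n + j - m < n" using l(4,6) desc_disjoint unfolding upper_def by auto
  define i where "i = m - Suc j"
  have m: "m = Suc (i + j)" and i: "i < n" using \<open>n + j - m < n\<close> l(3) by (auto simp: i_def)
  have "n + j = (n - Suc i) + Suc (i + j)" using i by simp
  then have "conn_via (upper n w) (n - Suc i) ((par ^^ Suc (i + j)) v) \<omega>"
    using assms(3) conn_upper by metis
  then have "conn (n - Suc i) ((par ^^ Suc (i + j)) v) \<omega>"
    unfolding conn_via_def using cov_mono by blast
  moreover have "cov {(par ^^ Suc (i + j)) v} (Suc (i + j)) v \<omega>"
    by (rule covI[of l v m]) (use l m in auto)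
  ultimately show ?thesis using i by blast
qed

text \<open>Union bound over the age \<open>i\<close>. The bridging loops have their top at one
  given vertex, and the connection above uses only tops strictly higher, so the two are independent.
  The factor 2 bounds the \<open>1 / u\<close> from \<open>prob_top_cov\<close>.\<close>

lemma prob_front_le:
  assumes "n > 0" "v \<in> desc (n + j) w" and half: "\<And>k. u k \<ge> 1 / 2"
  shows "real b ^ (n + j) * prob {\<omega>\<in>space M. conn_via (upper n w) (n + j) v \<omega>} \<le>
    2 * (\<Sum>i<n. weight (i + j) * level_mean (n - Suc i))"
proof -
  define E where "E i = {\<omega>\<in>space M. conn (n - Suc i) ((par ^^ Suc (i + j)) v) \<omega> \<and>
    cov {(par ^^ Suc (i + j)) v} (Suc (i + j)) v \<omega>}" for i
  have E: "E i \<in> events" for i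
    unfolding E_def by (intro sets.sets_Collect_conj event_conn event_cov)
  have PE: "real b ^ (n + j) * prob (E i) \<le> 2 * (weight (i + j) * level_mean (n - Suc i))" if i: "i < n" for i
  proof -
    let ?y = "(par ^^ Suc (i + j)) v"
    have pos: "u (i + j) > 0" using half[of "i + j"] by simp
    have "prob (E i) = prob {\<omega>\<in>space M. conn (n - Suc i) ?y \<omega>} *
        prob {\<omega>\<in>space M. cov {?y} (Suc (i + j)) v \<omega>}"
      unfolding E_def
    proof (rule indep_pred)
      show "Measurable.pred (N ((\<lambda>a. (par ^^ a) ?y) ` {1..n - Suc i})) (conn (n - Suc i) ?y)"
        by (rule pred_conn_via) auto
      show "Measurable.pred (N {?y}) (cov {?y} (Suc (i + j)) v)"
        by (rule pred_cov) auto
      show "(\<lambda>a. (par ^^ a) ?y) ` {1..n - Suc i} \<inter> {?y} = {}"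
      proof -
        have "(par ^^ a) ?y \<noteq> ?y" if "a \<in> {1..n - Suc i}" for a
          using par_acyclic[of a ?y] that by (auto simp del: funpow.simps)
        then show ?thesis by blast
      qed
    qed
    also have "\<dots> = conn_prob u (n - Suc i) * ((u (i + j) - u (Suc (i + j))) / u (i + j))"
      by (simp only: prob_conn prob_top_cov[OF pos])
    also have "\<dots> \<le> conn_prob u (n - Suc i) * (2 * (u (i + j) - u (Suc (i + j))))"
    proof (rule mult_left_mono[OF _ conn_prob_nonneg])
      define d where "d = u (i + j) - u (Suc (i + j))"
      have "d \<ge> 0" using u_decseq by (simp add: d_def decseq_SucD)
      then have "d * 1 \<le> d * (2 * u (i + j))" using half[of "i + j"] by (intro mult_left_mono) auto
      then have "d / u (i + j) \<le> 2 * d" using pos by (simp add: pos_divide_le_eq mult_ac)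
      then show "(u (i + j) - u (Suc (i + j))) / u (i + j) \<le> 2 * (u (i + j) - u (Suc (i + j)))"
        by (simp only: d_def)
    qed
    finally have "real b ^ (n + j) * prob (E i) \<le>
        real b ^ (n + j) * (conn_prob u (n - Suc i) * (2 * (u (i + j) - u (Suc (i + j)))))"
      by (rule mult_left_mono) simp
    moreover have "real b ^ (n + j) = real b ^ (n - Suc i) * real b ^ Suc (i + j)"
    proof -
      have "n + j = (n - Suc i) + Suc (i + j)" using i by simp
      then show ?thesis by (simp only: power_add[symmetric])
    qed
    ultimately show ?thesis
      unfolding weight_def level_mean_def by (simp only: mult_ac)
  qed
  have "prob {\<omega>\<in>space M. conn_via (upper n w) (n + j) v \<omega>} \<le> prob (\<Union>i<n. E i)"
  proof (rule finite_measure_mono)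
    show "{\<omega>\<in>space M. conn_via (upper n w) (n + j) v \<omega>} \<subseteq> (\<Union>i<n. E i)"
      using front_split[OF assms(1,2)] unfolding E_def by blast
    show "(\<Union>i<n. E i) \<in> events" by (rule sets.finite_UN) (simp_all add: E)
  qed
  also have "\<dots> \<le> (\<Sum>i<n. prob (E i))"
    by (rule finite_measure_subadditive_finite) (use E in blast)+
  finally have "real b ^ (n + j) * prob {\<omega>\<in>space M. conn_via (upper n w) (n + j) v \<omega>} \<le>
      real b ^ (n + j) * (\<Sum>i<n. prob (E i))"
    by (rule mult_left_mono) simp
  also have "\<dots> \<le> (\<Sum>i<n. 2 * (weight (i + j) * level_mean (n - Suc i)))"
    unfolding sum_distrib_left by (rule sum_mono) (use PE in blast)
  finally show ?thesis by (simp only: sum_distrib_left)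
qed

text \<open>By \<open>prob_front_le\<close> and \<open>age_bound\<close> the front has mean size at
  most 2, and Markov's inequality applies. The exceptional event is a monotone union over
  truncations \<open>F J\<close> to finitely many levels, so that it also contains all outcomes with
  an infinite front.\<close>

lemma prob_front_large:
  assumes sub: "\<not> supercritical b u" and "n > 0"
  shows "\<exists>B\<in>events. prob B \<le> 2 / (real K + 1) \<and>
    (\<forall>\<omega>\<in>space M - B. finite (front n w \<omega>) \<and> card (front n w \<omega>) \<le> K)"
proof -
  let ?Q = "\<lambda>e v \<omega>. conn_via (upper n w) e v \<omega>"
  define F where "F J = (\<Union>j<J. desc (n + j) w)" for J
  define G where "G v \<omega> \<longleftrightarrow> v \<in> front n w \<omega>" for v \<omega>
  have GF: "G v \<omega> \<longleftrightarrow> ?Q (n + j) v \<omega>" if "v \<in> desc (n + j) w" for v j \<omega>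
    unfolding G_def front_def mem_Collect_eq
    by (rule iffI) (use that desc_disjoint[OF that] le_add1 in blast)+
  have finF: "finite (F J)" for J by (simp add: F_def)
  have evG: "{\<omega>\<in>space M. G v \<omega>} \<in> events" if "v \<in> F J" for v J
    using that event_conn by (auto simp: F_def GF)
  have sumG: "(\<Sum>v\<in>F J. prob {\<omega>\<in>space M. G v \<omega>}) \<le> 2" for J
  proof -
    have "(\<Sum>v\<in>F J. prob {\<omega>\<in>space M. G v \<omega>}) = (\<Sum>j<J. \<Sum>v\<in>desc (n + j) w. prob {\<omega>\<in>space M. G v \<omega>})"
      unfolding F_def
      by (rule sum.UNION_disjoint) (use desc_disjoint in fastforce)+
    also have "\<dots> \<le> (\<Sum>j<J. 2 * (\<Sum>i<n. weight (i + j) * level_mean (n - Suc i)))"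
    proof (rule sum_mono)
      fix j
      let ?c = "2 * (\<Sum>i<n. weight (i + j) * level_mean (n - Suc i))"
      have bpos: "real b ^ (n + j) > 0" using b2 by simp
      have "prob {\<omega>\<in>space M. G v \<omega>} \<le> ?c / real b ^ (n + j)" if "v \<in> desc (n + j) w" for v
        using prob_front_le[OF \<open>n > 0\<close> that u_ge_half[OF sub]] bpos
        unfolding GF[OF that] by (simp only: pos_le_divide_eq mult.commute)
      then have "(\<Sum>v\<in>desc (n + j) w. prob {\<omega>\<in>space M. G v \<omega>}) \<le>
          real (card (desc (n + j) w)) * (?c / real b ^ (n + j))"
        by (rule sum_bounded_above)
      also have "\<dots> = ?c" using bpos by (simp add: card_desc)
      finally show "(\<Sum>v\<in>desc (n + j) w. prob {\<omega>\<in>space M. G v \<omega>}) \<le> ?c" .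
    qed
    also have "\<dots> \<le> 2 * 1" unfolding sum_distrib_left[symmetric]
      by (rule mult_left_mono[OF age_bound[OF sub]]) simp
    finally show ?thesis by simp
  qed
  define B where "B J = {\<omega>\<in>space M. K < card {v\<in>F J. G v \<omega>}}" for J
  have B: "B J \<in> events" "prob (B J) \<le> 2 / (real K + 1)" for J
    unfolding B_def by (rule prob_many_le[OF finF _ sumG], erule evG)+
  have Fmono: "F i \<subseteq> F j" if "i \<le> j" for i j unfolding F_def using that by (intro UN_mono) auto
  have inc: "incseq B"
  proof (rule incseq_SucI, rule subsetI)
    fix J \<omega> assume "\<omega> \<in> B J"
    moreover have "card {v\<in>F J. G v \<omega>} \<le> card {v\<in>F (Suc J). G v \<omega>}"
      using finF Fmono[of J "Suc J"] by (intro card_mono) auto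
    ultimately show "\<omega> \<in> B (Suc J)" by (simp add: B_def)
  qed
  have "(\<lambda>J. prob (B J)) \<longlonglongrightarrow> prob (\<Union>J. B J)"
    by (rule finite_Lim_measure_incseq[OF _ inc]) (use B(1) in blast)
  then have "prob (\<Union>J. B J) \<le> 2 / (real K + 1)"
    by (rule LIMSEQ_le_const2) (use B(2) in blast)
  moreover have "finite (front n w \<omega>) \<and> card (front n w \<omega>) \<le> K" if \<omega>: "\<omega> \<in> space M - (\<Union>J. B J)" for \<omega>
  proof -
    \<comment> \<open>A finite part of the front reaches only finitely many levels, hence lies in
      some \<open>F J\<close>.\<close>
    have small: "card S \<le> K" if S: "finite S" "S \<subseteq> front n w \<omega>" for S
    proof -
      have "\<exists>j. v \<in> desc (n + j) w" if "v \<in> S" for v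
        using that S(2) unfolding front_def by (auto simp: le_iff_add)
      then obtain f where f: "\<And>v. v \<in> S \<Longrightarrow> v \<in> desc (n + f v) w" by metis
      obtain J where J: "\<And>v. v \<in> S \<Longrightarrow> f v < J"
        using S(1) finite_nat_bounded[of "f ` S"] by auto
      have "S \<subseteq> {v\<in>F J. G v \<omega>}" using f J S(2) by (auto simp: F_def G_def)
      then have "card S \<le> card {v\<in>F J. G v \<omega>}" by (intro card_mono) (simp_all add: finF)
      also have "\<dots> \<le> K" using \<omega> by (auto simp: B_def not_less)
      finally show ?thesis .
    qed
    have "finite (front n w \<omega>)"
    proof (rule ccontr)
      assume "infinite (front n w \<omega>)"
      then obtain S where "finite S" "S \<subseteq> front n w \<omega>" "card S = Suc K"
        using infinite_arbitrarily_large by blast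
      with small show False by fastforce
    qed
    with small show ?thesis by blast
  qed
  moreover have "(\<Union>J. B J) \<in> events" using B(1) by (intro sets.countable_UN) blast
  ultimately show ?thesis by blast
qed

text \<open>The sets \<open>L 1 c\<close> may share loops, so the events are not independent; the
  positive correlation in \<open>void_Un_ge\<close> suffices for the lower bound.\<close>

lemma void_L_ge:
  assumes "finite F"
  shows "u 1 ^ card F \<le> prob {\<omega>\<in>space M. \<forall>l\<in>(\<Union>c\<in>F. L 1 c). \<omega> \<notin> A l}"
  using assms
proof (induction F rule: finite_induct)
  case (insert c F)
  have sub: "L 1 c \<subseteq> I" for c by (auto simp: L_def)
  have L1: "prob {\<omega>\<in>space M. \<forall>l\<in>L 1 c. \<omega> \<notin> A l} = u 1"
    using void_prob[of c 1] by (simp only: L_def)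
  have "u 1 ^ card (insert c F) = u 1 * u 1 ^ card F" using insert by simp
  also have "\<dots> \<le> u 1 * prob {\<omega>\<in>space M. \<forall>l\<in>(\<Union>c\<in>F. L 1 c). \<omega> \<notin> A l}"
    by (rule mult_left_mono[OF insert.IH u_nonneg])
  also have "\<dots> \<le> prob {\<omega>\<in>space M. \<forall>l\<in>L 1 c \<union> (\<Union>c\<in>F. L 1 c). \<omega> \<notin> A l}"
    unfolding L1[symmetric]
    by (rule void_Un_ge[OF indep_A countable_I]) (use sub in blast)+
  finally show ?case by (simp only: UN_insert)
qed (simp add: prob_space)

lemma pred_closed_tops: "Measurable.pred (N R) (closed_tops R)"
proof -
  have "closed_tops R = (\<lambda>\<omega>. \<not> (\<exists>l\<in>{l\<in>I. tp l \<in> R}. \<omega> \<in> A l))"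
    unfolding closed_tops_def by blast
  moreover have "Measurable.pred (N R) \<dots>"
    by (intro pred_intros_logic pred_Ex_A) blast+
  ultimately show ?thesis by (simp only:)
qed

text \<open>A loop with top in \<open>R\<close> visits a child of its top, so it is absent once no
  loop of \<open>L 1 c\<close> occurs for any of the at most \<open>b * card R\<close> children
  \<open>c\<close>.\<close>

lemma prob_closed_tops_ge:
  assumes "finite R"
  shows "u 1 ^ (b * card R) \<le> prob {\<omega>\<in>space M. closed_tops R \<omega>}"
proof -
  define F where "F = (\<Union>y\<in>R. {c. par c = y})"
  have finF: "finite F" using assms finite_children by (simp add: F_def)
  have "card F \<le> (\<Sum>y\<in>R. card {c. par c = y})"
    unfolding F_def by (rule card_UN_le[OF assms])
  also have "\<dots> = b * card R" by (simp add: card_children)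
  finally have "u 1 ^ (b * card R) \<le> u 1 ^ card F"
  proof (rule power_decreasing)
    show "0 \<le> u 1" by (rule u_nonneg)
    show "u 1 \<le> 1" using u_decseq u_0 by (metis decseqD le0)
  qed
  also have "\<dots> \<le> prob {\<omega>\<in>space M. \<forall>l\<in>(\<Union>c\<in>F. L 1 c). \<omega> \<notin> A l}"
    by (rule void_L_ge[OF finF])
  also have "\<dots> \<le> prob {\<omega>\<in>space M. closed_tops R \<omega>}"
  proof (rule finite_measure_mono[OF _ event_Collect[OF pred_closed_tops]], rule Collect_mono, rule impI)
    fix \<omega> assume \<omega>: "\<omega> \<in> space M \<and> (\<forall>l\<in>(\<Union>c\<in>F. L 1 c). \<omega> \<notin> A l)"
    have "\<omega> \<notin> A l" if l: "l \<in> I" "tp l \<in> R" for l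
    proof -
      obtain c where c: "c \<in> V l" "par c = tp l" using V_child l by blast
      then have "l \<in> L 1 c" "c \<in> F" using l by (auto simp: L_def F_def)
      with \<omega> show ?thesis by blast
    qed
    with \<omega> show "\<omega> \<in> space M \<and> closed_tops R \<omega>" by (auto simp: closed_tops_def)
  qed
  finally show ?thesis .
qed

lemma pred_conn_via_upper:
  "Measurable.pred (N (upper n w)) (conn_via (upper n w) e v)"
  by (rule pred_conn_via) (rule Int_lower2)

lemma pred_front:
  assumes "R \<subseteq> below w"
  shows "Measurable.pred (N (upper n w)) (\<lambda>\<omega>. front n w \<omega> = R)"
proof -
  have eq: "front n w \<omega> = R \<longleftrightarrow>
      (\<forall>v\<in>below w. (\<exists>e. e \<ge> n \<and> v \<in> desc e w \<and> conn_via (upper n w) e v \<omega>) = (v \<in> R))" for \<omega>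
    using assms unfolding front_def below_def by blast
  have conn: "Measurable.pred (N (upper n w)) (\<lambda>\<omega>. e \<ge> n \<and> v \<in> desc e w \<and> conn_via (upper n w) e v \<omega>)"
    for e v
    by (intro pred_intros_logic pred_conn_via_upper) simp_all
  have "Measurable.pred (N (upper n w))
      (\<lambda>\<omega>. (\<exists>e. e \<ge> n \<and> v \<in> desc e w \<and> conn_via (upper n w) e v \<omega>) = (v \<in> R))" for v
    using pred_intros_countable(2)[OF conn] pred_intros_logic(2)[OF pred_intros_countable(2)[OF conn]]
    by (cases "v \<in> R") (simp_all only: simp_thms)
  then show ?thesis
    unfolding eq by (rule measurable_pred_countable(1)[OF countable_below])
qed

lemma conn_via_upper:
  assumes "v \<in> desc n w" "conn n v \<omega>"
  shows "conn_via (upper n w) n v \<omega>"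
  unfolding conn_via_def
proof (intro allI impI)
  fix a assume a: "a < n"
  with assms(2) have "cov UNIV (n - a) ((par ^^ a) v) \<omega>" unfolding conn_via_def by blast
  then obtain l i where l: "l \<in> I" "(par ^^ a) v \<in> V l" "1 \<le> i" "i \<le> n - a"
    "tp l = (par ^^ i) ((par ^^ a) v)" "\<omega> \<in> A l"
    by (rule covE)
  have "(par ^^ (i + a)) v \<in> desc (n - (i + a)) w"
    by (rule desc_par_pow) (use assms(1) l(4) a in simp)
  moreover have "n - (i + a) < n" using l(3) a by simp
  ultimately have "tp l \<in> upper n w" unfolding l(5) par_pow_add upper_def by blast
  with l show "cov (upper n w) (n - a) ((par ^^ a) v) \<omega>" by (intro covI[of l _ i])
qed

text \<open>Every vertex reached at depth at least \<open>n\<close> lies in the front, by induction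
  on its depth. The loop covering the edge above it has its top either above level \<open>n\<close>,
  as wanted, or at an ancestor that is a front vertex by induction; loops of the second kind are
  absent.\<close>

lemma finite_subcluster_if_closed:
  assumes "finite (front n w \<omega>)" "closed_tops (front n w \<omega>) \<omega>"
  shows "finite (subcluster w \<omega>)"
proof -
  have "conn_via (upper n w) (n + j) v \<omega>" if "v \<in> desc (n + j) w" "conn (n + j) v \<omega>" for j v
    using that
  proof (induction j arbitrary: v)
    case 0
    then show ?case by (simp add: conn_via_upper)
  next
    case (Suc j)
    have IH: "conn_via (upper n w) (n + j) (par v) \<omega>"
    proof (rule Suc.IH)
      show "par v \<in> desc (n + j) w" using desc_par_pow[of v "n + j" 1 w] Suc.prems(1) by simp
      show "conn (n + j) (par v) \<omega>" using conn_upper[of UNIV "n + j" 1 v \<omega>] Suc.prems(2) by simp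
    qed
    show ?case
      unfolding conn_via_def
    proof (intro allI impI)
      fix a assume a: "a < n + Suc j"
      show "cov (upper n w) (n + Suc j - a) ((par ^^ a) v) \<omega>"
      proof (cases a)
        case (Suc a')
        then have "cov (upper n w) (n + j - a') ((par ^^ a') (par v)) \<omega>"
          using IH a unfolding conn_via_def by simp
        then show ?thesis using Suc by (simp add: funpow_swap1)
      next
        case 0
        have "cov UNIV (n + Suc j) v \<omega>"
          using Suc.prems(2) unfolding conn_via_def by (metis a 0 diff_zero funpow_0)
        then obtain l i where l: "l \<in> I" "v \<in> V l" "1 \<le> i" "i \<le> n + Suc j"
          "tp l = (par ^^ i) v" "\<omega> \<in> A l"
          by (rule covE)
        have d: "(par ^^ i) v \<in> desc (n + Suc j - i) w"
          by (rule desc_par_pow) (use Suc.prems(1) l(4) in simp)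
        have "n + Suc j - i < n"
        proof (rule ccontr)
          assume n: "\<not> n + Suc j - i < n"
          have eq: "(par ^^ i) v = (par ^^ (i - 1)) (par v)"
            using l(3) by (cases i) (simp_all add: funpow_swap1)
          have "conn_via (upper n w) (n + j - (i - 1)) ((par ^^ (i - 1)) (par v)) \<omega>"
            by (rule conn_upper) (use IH l(4) in simp)
          then have "conn_via (upper n w) (n + Suc j - i) ((par ^^ i) v) \<omega>"
            using eq l(3) by (metis Suc_diff_1 add_Suc_right diff_Suc_eq_diff_pred less_eq_Suc_le One_nat_def diff_diff_left diff_Suc_Suc)
          then have "(par ^^ i) v \<in> front n w \<omega>"
            using d n unfolding front_def by (auto simp: not_less)
          with assms(2) l show False unfolding closed_tops_def by simp
        qed
        with d have "tp l \<in> upper n w" unfolding l(5) upper_def by blast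
        with l 0 show ?thesis by (intro covI[of l _ i]) simp_all
      qed
    qed
  qed
  then have "subcluster w \<omega> \<subseteq> upper n w \<union> front n w \<omega>"
    unfolding subcluster_def front_def upper_def
    by (smt (verit) UN_I UnCI le_add1 le_add_diff_inverse lessThan_iff mem_Collect_eq not_less subsetI)
  moreover have "finite (upper n w)" by (simp add: upper_def)
  ultimately show ?thesis using assms(1) by (meson finite_UnI finite_subset)
qed

text \<open>If survival had probability \<open>p > 0\<close>, then with probability at least
  \<open>p / 2\<close> level \<open>n\<close> is reached and the front has between 1 and
  \<open>K\<close> vertices. Independently of it, all loops with top in the front are absent with
  probability at least \<open>c\<close>. So the cluster reaches level \<open>n\<close> and dies with
  probability at least \<open>c * (p / 2)\<close>, for every \<open>n > 0\<close>, although the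
  probability of reaching level \<open>n\<close> tends to \<open>p\<close>.\<close>

theorem prob_infinite_zero:
  assumes sub: "\<not> supercritical b u"
  shows "prob {\<omega>\<in>space M. infinite (subcluster w \<omega>)} = 0"
proof (rule ccontr)
  define S where "S n = {\<omega>\<in>space M. \<exists>v\<in>desc n w. conn n v \<omega>}" for n
  define Inf where "Inf = {\<omega>\<in>space M. infinite (subcluster w \<omega>)}"
  define p where "p = prob Inf"
  assume "prob {\<omega>\<in>space M. infinite (subcluster w \<omega>)} \<noteq> 0"
  then have p: "p > 0" unfolding p_def Inf_def using measure_nonneg by (metis less_eq_real_def)
  have Inf_ev: "Inf \<in> events" unfolding Inf_def by (rule event_infinite)
  have S: "S n \<in> events" for n unfolding S_def by (rule event_level)
  have Inf_S: "Inf = (\<Inter>n. S n)" unfolding Inf_def S_def infinite_subcluster_iff by blast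
  have dec: "decseq S"
  proof (rule decseq_SucI, rule subsetI)
    fix n \<omega> assume "\<omega> \<in> S (Suc n)"
    then obtain v where v: "v \<in> desc (n + 1) w" "conn (n + 1) v \<omega>" "\<omega> \<in> space M" by (auto simp: S_def)
    from desc_par_pow[OF v(1)] conn_upper[OF v(2)] v(3) show "\<omega> \<in> S n" unfolding S_def by blast
  qed
  have lim: "(\<lambda>n. prob (S n)) \<longlonglongrightarrow> p"
    unfolding p_def Inf_S by (rule finite_Lim_measure_decseq[OF _ dec]) (use S in blast)
  \<comment> \<open>Large enough that a front with more than \<open>K\<close> vertices costs at most
    half of \<open>p\<close>.\<close>
  obtain K :: nat where K: "4 / p < real K" using reals_Archimedean2 by blast
  have K': "2 / (real K + 1) \<le> p / 2"
  proof -
    have "4 \<le> p * (real K + 1)" using K p by (simp add: pos_divide_less_eq mult.commute distrib_left)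
    then show ?thesis by (simp add: pos_divide_le_eq)
  qed
  define c where "c = u 1 ^ (b * K)"
  have c: "c > 0" unfolding c_def using u_ge_half[OF sub, of 1] by simp
  have gap: "c * (p / 2) \<le> prob (S n) - p" if n: "n > 0" for n
  proof -
    \<comment> \<open>The possible values of the front, a countable family. The event
      \<open>front n w \<omega> = R\<close> depends on tops above level \<open>n\<close>, the event
      \<open>closed_tops R\<close> on tops in \<open>R\<close>, which lie at level \<open>n\<close>
      or below.\<close>
    define \<R> where "\<R> = {R. R \<subseteq> (\<Union>e\<in>{n..}. desc e w) \<and> finite R \<and> R \<noteq> {} \<and> card R \<le> K}"
    define E where "E R = {\<omega>\<in>space M. front n w \<omega> = R}" for R
    define F where "F R = {\<omega>\<in>space M. front n w \<omega> = R \<and> closed_tops R \<omega>}" for R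
    obtain B where B: "B \<in> events" "prob B \<le> 2 / (real K + 1)"
      "\<And>\<omega>. \<omega> \<in> space M - B \<Longrightarrow> finite (front n w \<omega>) \<and> card (front n w \<omega>) \<le> K"
      using prob_front_large[OF sub n, of K w] by blast
    have R_below: "R \<subseteq> below w" if "R \<in> \<R>" for R
      using that unfolding \<R>_def below_def by blast
    have cR: "countable \<R>"
    proof (rule countable_subset)
      show "\<R> \<subseteq> {R. R \<subseteq> below w \<and> finite R}" using R_below unfolding \<R>_def by blast
      show "countable {R. R \<subseteq> below w \<and> finite R}"
        using countable_Collect_finite_subset[OF countable_below] by (simp add: conj_commute)
    qed
    have evE: "E R \<in> events" if "R \<in> \<R>" for R
      unfolding E_def by (rule event_Collect[OF pred_front[OF R_below[OF that]]])
    have evF: "F R \<in> events" if "R \<in> \<R>" for R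
      using event_Collect[OF pred_closed_tops[of R]] evE[OF that]
      unfolding E_def F_def by (rule sets.sets_Collect_conj)
    have EF: "c * prob (E R) \<le> prob (F R)" if R: "R \<in> \<R>" for R
    proof -
      have disj: "upper n w \<inter> R = {}"
      proof -
        have False if v: "v \<in> upper n w" "v \<in> R" for v
        proof -
          obtain i e where "i < n" "v \<in> desc i w" "e \<ge> n" "v \<in> desc e w"
            using v R unfolding upper_def \<R>_def by blast
          with desc_disjoint[of v i w e] show False by simp
        qed
        then show ?thesis by blast
      qed
      have "c \<le> u 1 ^ (b * card R)" unfolding c_def
      proof (rule power_decreasing)
        show "b * card R \<le> b * K" using R by (simp add: \<R>_def)
        show "0 \<le> u 1" by (rule u_nonneg)
        show "u 1 \<le> 1" using u_decseq u_0 by (metis decseqD le0)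
      qed
      also have "\<dots> \<le> prob {\<omega>\<in>space M. closed_tops R \<omega>}"
        by (rule prob_closed_tops_ge) (use R in \<open>simp add: \<R>_def\<close>)
      finally have "c * prob (E R) \<le> prob {\<omega>\<in>space M. closed_tops R \<omega>} * prob (E R)"
        by (rule mult_right_mono) simp
      also have "\<dots> = prob (F R)"
        unfolding E_def F_def
        by (subst indep_pred[OF pred_front[OF R_below[OF R]] pred_closed_tops disj]) (rule mult.commute)
      finally show ?thesis .
    qed
    have "c * (p / 2) \<le> c * (prob (S n) - prob B)"
    proof (rule mult_left_mono)
      have "p \<le> prob (S n)" unfolding p_def Inf_S by (rule finite_measure_mono[OF _ S]) blast
      then show "p / 2 \<le> prob (S n) - prob B" using B(2) K' by simp
    qed (use c in simp)
    also have "\<dots> \<le> c * prob (\<Union>R\<in>\<R>. E R)"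
    proof (rule mult_left_mono)
      have "S n \<subseteq> (\<Union>R\<in>\<R>. E R) \<union> B"
      proof
        fix \<omega> assume \<omega>: "\<omega> \<in> S n"
        show "\<omega> \<in> (\<Union>R\<in>\<R>. E R) \<union> B"
        proof (cases "\<omega> \<in> B")
          case False
          with \<omega> B(3)[of \<omega>] have fin: "finite (front n w \<omega>)" "card (front n w \<omega>) \<le> K"
            by (auto simp: S_def)
          obtain v where v: "v \<in> desc n w" "conn n v \<omega>" using \<omega> by (auto simp: S_def)
          have "conn_via (upper n w) n v \<omega>" by (rule conn_via_upper[OF v])
          with v(1) have "v \<in> front n w \<omega>" unfolding front_def by blast
          moreover have "front n w \<omega> \<subseteq> (\<Union>e\<in>{n..}. desc e w)" unfolding front_def by blast
          ultimately have "front n w \<omega> \<in> \<R>" using fin unfolding \<R>_def by blast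
          moreover have "\<omega> \<in> E (front n w \<omega>)" using \<omega> by (simp add: E_def S_def)
          ultimately show ?thesis by blast
        qed blast
      qed
      moreover have UE: "(\<Union>R\<in>\<R>. E R) \<in> events" by (rule sets.countable_UN''[OF cR evE])
      ultimately have "prob (S n) \<le> prob ((\<Union>R\<in>\<R>. E R) \<union> B)"
        by (intro finite_measure_mono sets.Un B(1))
      also have "\<dots> \<le> prob (\<Union>R\<in>\<R>. E R) + prob B" by (rule measure_Un_le[OF UE B(1)])
      finally show "prob (S n) - prob B \<le> prob (\<Union>R\<in>\<R>. E R)" by simp
    qed (use c in simp)
    also have "\<dots> \<le> prob (\<Union>R\<in>\<R>. F R)"
    proof (rule prob_UN_ge[OF cR _ evE evF _ EF])
      show "disjoint_family_on E \<R>" unfolding disjoint_family_on_def E_def by blast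
      show "F R \<subseteq> E R" for R unfolding E_def F_def by blast
    qed (use c in simp_all)
    also have "\<dots> \<le> prob (S n - Inf)"
    proof (rule finite_measure_mono[OF _ sets.Diff[OF S Inf_ev]], rule subsetI)
      fix \<omega> assume "\<omega> \<in> (\<Union>R\<in>\<R>. F R)"
      then obtain R where R: "R \<in> \<R>" "\<omega> \<in> space M" "front n w \<omega> = R" "closed_tops R \<omega>"
        unfolding F_def by blast
      have fin: "finite (subcluster w \<omega>)"
        by (rule finite_subcluster_if_closed[of n]) (use R in \<open>simp_all add: \<R>_def\<close>)
      obtain v where "v \<in> front n w \<omega>" using R unfolding \<R>_def by blast
      then obtain e where e: "e \<ge> n" "v \<in> desc e w" "conn_via (upper n w) e v \<omega>"
        unfolding front_def by blast
      from e(3) have "conn e v \<omega>" unfolding conn_via_def using cov_mono by blast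
      moreover have "e = n + (e - n)" using e(1) by simp
      ultimately have "(par ^^ (e - n)) v \<in> desc n w" "conn n ((par ^^ (e - n)) v) \<omega>"
        using e(2) desc_par_pow conn_upper by metis+
      with R(2) fin show "\<omega> \<in> S n - Inf" unfolding S_def Inf_def by blast
    qed
    also have "\<dots> = prob (S n) - p"
      unfolding p_def by (rule finite_measure_Diff[OF S Inf_ev]) (unfold Inf_S, blast)
    finally show ?thesis .
  qed
  have "c * (p / 2) \<le> p - p"
    by (rule tendsto_lowerbound[OF tendsto_diff[OF lim tendsto_const]])
      (use gap in \<open>auto intro: eventually_mono[OF eventually_gt_at_top[of 0]]\<close>)
  with c p show False by (simp add: mult_le_0_iff)
qed

section \<open>Cutting the ancestral line and enclosing the cluster\<close>

theorem prob_all_covered_above: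
  assumes sub: "\<not> supercritical b u"
  shows "prob {\<omega>\<in>space M. \<forall>i. \<exists>k. cov UNIV k ((par ^^ i) v) \<omega>} = 0"
proof -
  define Up where "Up n = {\<omega>\<in>space M. \<forall>i<n. \<exists>k. cov UNIV k ((par ^^ i) v) \<omega>}" for n
  define W where "W n m = {\<omega>\<in>space M. \<forall>i<n. cov UNIV (n + m - i) ((par ^^ i) v) \<omega>}" for n m
  obtain c where c: "u \<longlonglongrightarrow> c" using decseq_convergent[OF u_decseq, of 0] u_nonneg by blast
  have W: "W n m \<in> events" for n m
    unfolding W_def by (intro sets.sets_Collect_countable_All sets.sets_Collect_imp event_cov) simp
  have Upe: "Up n \<in> events" for n
    unfolding Up_def by (intro sets.sets_Collect_countable_All sets.sets_Collect_imp sets.sets_Collect_countable_Ex event_cov) simp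
  \<comment> \<open>\<open>W n m\<close> increases to \<open>Up n\<close> with \<open>m\<close>, and
    in \<open>prob_covered_path\<close> each \<open>u (n + m - j)\<close> tends to the limit
    \<open>c\<close>.\<close>
  have Up: "prob (Up n) = 1 - c * (\<Sum>j<n. conn_prob u j)" for n
  proof -
    have inc: "incseq (W n)"
    proof (rule incseq_SucI)
      show "W n m \<subseteq> W n (Suc m)" for m
        unfolding W_def using cov_mono[OF _ _ subset_refl] by (smt (verit) Collect_mono_iff add_Suc_right diff_le_mono lessI less_imp_le_nat)
    qed
    have "(\<Union>m. W n m) = Up n"
    proof (intro equalityI subsetI)
      fix \<omega> assume "\<omega> \<in> Up n"
      then obtain k where k: "\<And>i. i < n \<Longrightarrow> cov UNIV (k i) ((par ^^ i) v) \<omega>" "\<omega> \<in> space M"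
        unfolding Up_def by (simp, metis)
      obtain m where m: "\<And>i. i < n \<Longrightarrow> k i \<le> m"
        using finite_nat_set_iff_bounded_le[of "k ` {..<n}"] by auto
      have "cov UNIV (n + m - i) ((par ^^ i) v) \<omega>" if "i < n" for i
        by (rule cov_mono[OF k(1)[OF that] _ subset_refl]) (use m[OF that] that in simp)
      with k(2) show "\<omega> \<in> (\<Union>m. W n m)" unfolding W_def by blast
    qed (unfold W_def Up_def, blast)
    then have "(\<lambda>m. prob (W n m)) \<longlonglongrightarrow> prob (Up n)"
      using finite_Lim_measure_incseq[OF _ inc] W by (metis image_subset_iff)
    moreover have "(\<lambda>m. prob (W n m)) \<longlonglongrightarrow> 1 - c * (\<Sum>j<n. conn_prob u j)"
    proof -
      have "(\<lambda>m. 1 - (\<Sum>j<n. u (n + m - j) * conn_prob u j)) \<longlonglongrightarrow> 1 - (\<Sum>j<n. c * conn_prob u j)"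
      proof (intro tendsto_diff tendsto_const tendsto_sum tendsto_mult)
        fix j assume "j \<in> {..<n}"
        then have "(\<lambda>m. u (n + m - j)) = (\<lambda>m. u (m + (n - j)))" by (auto simp: add.commute)
        then show "(\<lambda>m. u (n + m - j)) \<longlonglongrightarrow> c" using LIMSEQ_ignore_initial_segment[OF c, of "n - j"] by simp
      qed
      then show ?thesis unfolding W_def by (simp only: prob_covered_path[OF prob_conn] sum_distrib_left)
    qed
    ultimately show ?thesis by (rule LIMSEQ_unique)
  qed
  \<comment> \<open>The terms \<open>c * conn_prob u j\<close> are the probabilities that the lowest
    edge covered by no loop of any height is the \<open>j\<close>-th one; their sum is 1.\<close>
  have lim0: "(\<lambda>n. prob (Up n)) \<longlonglongrightarrow> 1 - 1"
    unfolding Up by (intro tendsto_diff tendsto_const conn_prob_sum_tendsto[OF sub c])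
  have "decseq Up"
    by (rule decseq_SucI) (unfold Up_def, use less_SucI in blast)
  then have lim: "(\<lambda>n. prob (Up n)) \<longlonglongrightarrow> prob (\<Inter>n. Up n)"
    by (rule finite_Lim_measure_decseq[rotated]) (use Upe in blast)
  have "(\<Inter>n. Up n) = {\<omega>\<in>space M. \<forall>i. \<exists>k. cov UNIV k ((par ^^ i) v) \<omega>}"
    unfolding Up_def by blast
  with LIMSEQ_unique[OF lim lim0] show ?thesis by simp
qed

text \<open>By \<open>V_path\<close>, a loop covering a lower edge with top above the
  \<open>n\<close>-th ancestor would pass through that ancestor and cover its edge as well.\<close>

lemma covered_below_uncovered:
  assumes "\<And>i. i < n \<Longrightarrow> \<exists>k. cov UNIV k ((par ^^ i) v) \<omega>" "\<not> (\<exists>k. cov UNIV k ((par ^^ n) v) \<omega>)"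
  shows "conn n v \<omega>"
  unfolding conn_via_def
proof (intro allI impI)
  fix i assume i: "i < n"
  with assms(1) obtain k where "cov UNIV k ((par ^^ i) v) \<omega>" by blast
  then obtain l a where l: "l \<in> I" "(par ^^ i) v \<in> V l" "1 \<le> a" "a \<le> k"
    "tp l = (par ^^ a) ((par ^^ i) v)" "\<omega> \<in> A l"
    by (rule covE)
  have "a \<le> n - i"
  proof (rule ccontr)
    assume a: "\<not> a \<le> n - i"
    obtain k where k: "(par ^^ k) ((par ^^ i) v) = tp l" "\<And>j. j \<le> k \<Longrightarrow> (par ^^ j) ((par ^^ i) v) \<in> V l"
      using V_path[OF l(1,2)] by blast
    have "k = a" using k(1) l(5) par_pow_inj by metis
    with k(2)[of "n - i"] a i have "(par ^^ n) v \<in> V l" by (simp add: par_pow_add)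
    moreover have "tp l = (par ^^ (a - (n - i))) ((par ^^ n) v)"
      using l(5) a i by (simp add: par_pow_add)
    ultimately have "cov UNIV (a - (n - i)) ((par ^^ n) v) \<omega>"
      using l(1,6) a by (intro covI[of l _ "a - (n - i)"]) auto
    with assms(2) show False by blast
  qed
  with l show "cov UNIV (n - i) ((par ^^ i) v) \<omega>" by (intro covI[of l _ a]) auto
qed

text \<open>As the edge above \<open>w\<close> is uncovered, the loop through \<open>y\<close> has
  its top at or below \<open>w\<close>. The loop itself joins \<open>z\<close> to this top, and the
  connection of \<open>y\<close> joins the top to \<open>w\<close>. So the subcluster absorbs every
  open loop it meets.\<close>

lemma subcluster_closed:
  assumes un: "\<not> (\<exists>k. cov UNIV k w \<omega>)" and y: "y \<in> subcluster w \<omega>"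
    and l: "l \<in> I" "\<omega> \<in> A l" "y \<in> V l" and z: "z \<in> V l"
  shows "z \<in> subcluster w \<omega>"
proof -
  obtain n where n: "(par ^^ n) y = w" "conn n y \<omega>" using y by (auto simp: subcluster_def desc_def)
  obtain m where m: "(par ^^ m) y = tp l" "\<And>j. j \<le> m \<Longrightarrow> (par ^^ j) y \<in> V l"
    using V_path[OF l(1,3)] by blast
  obtain k where k: "(par ^^ k) z = tp l" "\<And>j. j \<le> k \<Longrightarrow> (par ^^ j) z \<in> V l"
    using V_path[OF l(1) z] by blast
  have mn: "m \<le> n"
  proof (rule ccontr)
    assume "\<not> m \<le> n"
    then have "w \<in> V l" "tp l = (par ^^ (m - n)) w" "1 \<le> m - n"
      using m n(1) by (auto simp: par_pow_add)
    then have "cov UNIV (m - n) w \<omega>" using l by (intro covI[of l _ "m - n"]) auto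
    with un show False by blast
  qed
  have "conn k z \<omega>"
    unfolding conn_via_def
  proof (intro allI impI)
    fix j assume "j < k"
    then show "cov UNIV (k - j) ((par ^^ j) z) \<omega>"
      using l k by (intro covI[of l _ "k - j"]) (auto simp: par_pow_add)
  qed
  moreover have "conn (n - m) ((par ^^ k) z) \<omega>"
    using conn_upper[of UNIV "n - m" m y \<omega>] n(2) mn k(1) m(1) by simp
  ultimately have "conn (k + (n - m)) z \<omega>" by (rule conn_trans)
  moreover have "z \<in> desc (k + (n - m)) w"
  proof -
    have "(par ^^ (n - m)) ((par ^^ m) y) = w" using n(1) mn by (simp add: par_pow_add)
    then have "(par ^^ (n - m)) ((par ^^ k) z) = w" by (simp add: k(1) m(1))
    then show ?thesis by (simp add: desc_def par_pow_add add.commute)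
  qed
  ultimately show ?thesis by (auto simp: subcluster_def)
qed

lemma conn_Suc:
  assumes "conn (Suc k) v \<omega>"
  shows "conn k (par v) \<omega>" "\<exists>l\<in>I. \<omega> \<in> A l \<and> v \<in> V l \<and> par v \<in> V l"
proof -
  show "conn k (par v) \<omega>" using conn_upper[of UNIV k 1 v \<omega>] assms by simp
  have "cov UNIV (Suc k) v \<omega>" using assms unfolding conn_via_def by (metis diff_zero funpow_0 zero_less_Suc)
  then obtain l i where l: "l \<in> I" "v \<in> V l" "1 \<le> i" "tp l = (par ^^ i) v" "\<omega> \<in> A l"
    by (rule covE)
  obtain m where m: "(par ^^ m) v = tp l" "\<And>j. j \<le> m \<Longrightarrow> (par ^^ j) v \<in> V l"
    using V_path[OF l(1,2)] by blast
  have "m = i" using m(1) l(4) par_pow_inj by metis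
  with m(2)[of 1] l(3) have "par v \<in> V l" by simp
  with l show "\<exists>l\<in>I. \<omega> \<in> A l \<and> v \<in> V l \<and> par v \<in> V l" by blast
qed

end

context end_tree
begin

section \<open>Isomorphisms between subtrees\<close>

definition subtree_iso :: "('v \<Rightarrow> 'v) \<Rightarrow> 'v \<Rightarrow> 'v \<Rightarrow> bool" where
  "subtree_iso f w w' \<longleftrightarrow> bij_betw f (below w) (below w') \<and> f w = w' \<and>
     (\<forall>y\<in>below w. y \<noteq> w \<longrightarrow> par (f y) = f (par y))"

lemma root_below: "w \<in> below w"
  by (auto simp: below_def intro: exI[of _ 0])

lemma par_below: "y \<in> below w \<Longrightarrow> y \<noteq> w \<Longrightarrow> par y \<in> below w"
proof -
  assume "y \<in> below w" "y \<noteq> w"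
  then obtain k where k: "(par ^^ k) y = w" by (auto simp: below_def desc_def)
  with \<open>y \<noteq> w\<close> obtain k' where "k = Suc k'" by (cases k) auto
  with k show "par y \<in> below w" by (auto simp: below_def desc_def funpow_swap1)
qed

lemma par_root_not_below: "par w \<notin> below w"
proof
  assume "par w \<in> below w"
  then obtain k where "(par ^^ k) (par w) = w" by (auto simp: below_def desc_def)
  then have "(par ^^ Suc k) w = w" by (simp add: funpow_swap1)
  from par_acyclic[OF this] show False by simp
qed

lemma below_trans: "y \<in> below v \<Longrightarrow> v \<in> below w \<Longrightarrow> y \<in> below w"
  unfolding below_def using desc_trans by blast

lemma subtree_iso_inv:
  assumes "subtree_iso f w w'"
  shows "subtree_iso (inv_into (below w) f) w' w"
proof -
  let ?g = "inv_into (below w) f"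
  have bij: "bij_betw f (below w) (below w')" and fw: "f w = w'"
    and fpar: "\<And>y. y \<in> below w \<Longrightarrow> y \<noteq> w \<Longrightarrow> par (f y) = f (par y)"
    using assms by (auto simp: subtree_iso_def)
  have inj: "inj_on f (below w)" using bij by (rule bij_betw_imp_inj_on)
  have gw: "?g w' = w" using inv_into_f_f[OF inj root_below] fw by simp
  have "par (?g y) = ?g (par y)" if y: "y \<in> below w'" "y \<noteq> w'" for y
  proof -
    have g: "?g y \<in> below w" "f (?g y) = y"
      using y(1) bij by (auto simp: bij_betw_def inv_into_into f_inv_into_f)
    have "?g y \<noteq> w" using g(2) y(2) fw by auto
    then have "par y = f (par (?g y))" "par (?g y) \<in> below w"
      using fpar g par_below by metis+
    then show ?thesis using inv_into_f_f[OF inj] by simp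
  qed
  with bij_betw_inv_into[OF bij] gw show ?thesis by (simp add: subtree_iso_def)
qed

lemma subtree_iso_par_pow:
  assumes "subtree_iso f w w'" "(par ^^ k) y = w" "i \<le> k"
  shows "(par ^^ i) (f y) = f ((par ^^ i) y)"
  using assms(3)
proof (induction i)
  case (Suc i)
  have "(par ^^ i) y \<in> below w"
    using assms(2) Suc.prems by (auto simp: below_def desc_def par_pow_add intro!: exI[of _ "k - i"])
  moreover have "(par ^^ i) y \<noteq> w" using assms(2) Suc.prems par_pow_inj by (metis Suc_n_not_le_n)
  ultimately show ?case using Suc assms(1) by (simp add: subtree_iso_def)
qed simp

lemma child_enumeration:
  assumes "par z = y"
  shows "\<exists>h. bij_betw h {..<b} {c. par c = y} \<and> h 0 = z"
proof -
  obtain h where h: "bij_betw h {..<b} {c. par c = y}"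
    using ex_bij_betw_nat_finite[OF finite_children[of y]] by (auto simp: card_children atLeast0LessThan)
  then obtain j where j: "j < b" "h j = z"
    using assms unfolding bij_betw_def by (metis (mono_tags, lifting) imageE lessThan_iff mem_Collect_eq)
  have "bij_betw (Transposition.transpose 0 j) {..<b} {..<b}"
    using j b2 by (simp add: bij_betw_def transpose_image_eq inj_on_subset[OF inj_transpose])
  from bij_betw_trans[OF this h] j show ?thesis
    by (intro exI[of _ "h \<circ> Transposition.transpose 0 j"]) auto
qed

text \<open>Children are numbered so that the given path always follows number 0. Its vertices then
  have the words \<open>0...0\<close> as codes in both subtrees, and matching codes matches the
  paths.\<close>

lemma path_enumeration:
  "\<exists>c. (\<forall>y. bij_betw (c y) {..<b} {z. par z = y}) \<and> (\<forall>i<k. c ((par ^^ Suc i) v) 0 = (par ^^ i) v)"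
proof -
  have "\<exists>z. par z = y \<and> (\<forall>i<k. y = (par ^^ Suc i) v \<longrightarrow> z = (par ^^ i) v)" for y
  proof (cases "\<exists>i. y = (par ^^ Suc i) v")
    case True
    then obtain i where i: "y = (par ^^ Suc i) v" by blast
    then show ?thesis
      by (intro exI[of _ "(par ^^ i) v"]) (metis funpow.simps(2) comp_apply old.nat.inject par_pow_inj)
  next
    case False
    have "{z. par z = y} \<noteq> {}" using card_children[of y] b2 by (metis card.empty not_numeral_le_zero)
    with False show ?thesis by blast
  qed
  then obtain z where z: "\<And>y. par (z y) = y" "\<And>y i. i < k \<Longrightarrow> y = (par ^^ Suc i) v \<Longrightarrow> z y = (par ^^ i) v"
    by metis
  obtain c where "\<And>y. bij_betw (c y) {..<b} {x. par x = y} \<and> c y 0 = z y"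
    using child_enumeration[OF z(1)] by metis
  with z(2) show ?thesis by (intro exI[of _ c]) simp
qed

lemma word_coding:
  assumes c: "\<And>y. bij_betw (c y) {..<b} {z. par z = y}"
  shows "bij_betw (foldl c w) {s. set s \<subseteq> {..<b}} (below w)"
    and "a < b \<Longrightarrow> par (foldl c w (s @ [a])) = foldl c w s"
proof -
  have par_c: "a < b \<Longrightarrow> par (c y a) = y" for y a
    using c[of y] by (auto simp: bij_betw_def)
  then show "a < b \<Longrightarrow> par (foldl c w (s @ [a])) = foldl c w s" by simp
  have desc: "foldl c w s \<in> desc (length s) w" if "set s \<subseteq> {..<b}" for s
    using that by (induction s rule: rev_induct) (auto simp: desc_def par_c funpow_swap1)
  have inj: "s = s'" if "set s \<subseteq> {..<b}" "set s' \<subseteq> {..<b}" "foldl c w s = foldl c w s'" for s s'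
    using that
  proof (induction s arbitrary: s' rule: rev_induct)
    case Nil
    then have "length s' = 0" using desc[of "[]"] desc[of s'] desc_disjoint by fastforce
    then show ?case by simp
  next
    case (snoc a s)
    have "length s' = length (s @ [a])" using desc[OF snoc.prems(1)] desc[OF snoc.prems(2)] snoc.prems(3) desc_disjoint by metis
    then obtain s1 a1 where s': "s' = s1 @ [a1]" by (metis length_append_singleton length_Suc_conv_rev)
    with snoc.prems have a: "a < b" "a1 < b" and eq: "c (foldl c w s) a = c (foldl c w s1) a1" by auto
    then have "foldl c w s = foldl c w s1" using par_c by metis
    with snoc s' have "s = s1" by auto
    moreover have "a = a1"
      using eq a c[of "foldl c w s"] \<open>s = s1\<close> unfolding bij_betw_def inj_on_def by auto
    ultimately show ?case using s' by simp
  qed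
  have surj: "y \<in> foldl c w ` {s. set s \<subseteq> {..<b}}" if "y \<in> desc k w" for k y
    using that
  proof (induction k arbitrary: y)
    case 0
    then show ?case by (intro image_eqI[of _ _ "[]"]) auto
  next
    case (Suc k)
    then have "par y \<in> desc k w" by (simp add: desc_def funpow_swap1)
    from Suc.IH[OF this] obtain s where s: "set s \<subseteq> {..<b}" "par y = foldl c w s" by auto
    obtain a where "a < b" "y = c (par y) a" using c[of "par y"] unfolding bij_betw_def by auto
    with s show ?case by (intro image_eqI[of _ _ "s @ [a]"]) auto
  qed
  show "bij_betw (foldl c w) {s. set s \<subseteq> {..<b}} (below w)"
    unfolding bij_betw_def
  proof
    show "inj_on (foldl c w) {s. set s \<subseteq> {..<b}}" using inj by (intro inj_onI) auto
    show "foldl c w ` {s. set s \<subseteq> {..<b}} = below w" using desc surj by (fastforce simp: below_def)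
  qed
qed

lemma subtree_iso_path:
  "\<exists>f. subtree_iso f ((par ^^ k) v) ((par ^^ k) v') \<and> (\<forall>i\<le>k. f ((par ^^ i) v) = (par ^^ i) v')"
proof -
  obtain c where c: "\<And>y. bij_betw (c y) {..<b} {z. par z = y}"
    "\<And>i. i < k \<Longrightarrow> c ((par ^^ Suc i) v) 0 = (par ^^ i) v"
    using path_enumeration[of k v] by blast
  obtain c' where c': "\<And>y. bij_betw (c' y) {..<b} {z. par z = y}"
    "\<And>i. i < k \<Longrightarrow> c' ((par ^^ Suc i) v') 0 = (par ^^ i) v'"
    using path_enumeration[of k v'] by blast
  define w w' where "w = (par ^^ k) v" and "w' = (par ^^ k) v'"
  define W where "W = {s. set s \<subseteq> {..<b}}"
  define e e' where "e = foldl c w" and "e' = foldl c' w'"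
  have e: "bij_betw e W (below w)" "bij_betw e' W (below w')"
    unfolding e_def e'_def W_def by (rule word_coding c c')+
  have par_e: "par (e (s @ [a])) = e s" "par (e' (s @ [a])) = e' s" if "a < b" for s a
    unfolding e_def e'_def by (rule word_coding[OF c(1)] word_coding[OF c'(1)], rule that)+
  define f where "f = e' \<circ> inv_into W e"
  have fe: "f (e s) = e' s" if "s \<in> W" for s
    using that e(1) unfolding f_def by (simp add: bij_betw_def inv_into_f_f)
  have "subtree_iso f w w'"
    unfolding subtree_iso_def
  proof (intro conjI ballI impI)
    show "bij_betw f (below w) (below w')"
      unfolding f_def by (rule bij_betw_trans[OF bij_betw_inv_into[OF e(1)] e(2)])
    have "e [] = w" "e' [] = w'" "[] \<in> W" by (auto simp: e_def e'_def W_def)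
    with fe[of "[]"] show fw: "f w = w'" by simp
    fix y assume y: "y \<in> below w" "y \<noteq> w"
    then obtain s where s: "s \<in> W" "y = e s" using e(1) unfolding bij_betw_def by auto
    with y(2) \<open>e [] = w\<close> obtain s1 a where sa: "s = s1 @ [a]" by (metis rev_exhaust)
    with s have "a < b" "s1 \<in> W" by (auto simp: W_def)
    with s sa par_e fe show "par (f y) = f (par y)" by metis
  qed
  moreover have "f ((par ^^ i) v) = (par ^^ i) v'" if "i \<le> k" for i
  proof -
    have ee: "e (replicate j 0) = (par ^^ (k - j)) v \<and> e' (replicate j 0) = (par ^^ (k - j)) v'" if "j \<le> k" for j
      using that
    proof (induction j)
      case 0 then show ?case by (simp add: e_def e'_def w_def w'_def)
    next
      case (Suc j)
      have r: "replicate (Suc j) (0::nat) = replicate j 0 @ [0]" by (simp add: replicate_append_same)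
      have "k - j = Suc (k - Suc j)" using Suc.prems by simp
      with Suc c(2)[of "k - Suc j"] c'(2)[of "k - Suc j"] show ?case
        unfolding r e_def e'_def by (simp del: funpow.simps)
    qed
    have "replicate (k - i) 0 \<in> W" using b2 by (auto simp: W_def)
    from fe[OF this] ee[of "k - i"] that show ?thesis by simp
  qed
  ultimately show ?thesis unfolding w_def w'_def by blast
qed

end

section \<open>Void probabilities of Poisson point processes\<close>

lemma pmf_poisson_law_0: "r \<ge> 0 \<Longrightarrow> pmf (poisson_law r) 0 = exp (- r)"
  by (cases "r = 0") (auto simp: poisson_law_def)

definition void :: "real \<Rightarrow> 'a measure \<Rightarrow> 'a set \<Rightarrow> real" where
  "void \<alpha> \<nu> J = measure (poisson_point_process \<alpha> \<nu>)
     {\<omega>\<in>space (poisson_point_process \<alpha> \<nu>). \<forall>x\<in>J. \<omega> x = 0}"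

lemma prob_space_ppp: "prob_space (poisson_point_process \<alpha> \<nu>)"
  unfolding poisson_point_process_def by (rule prob_space_PiM) (rule prob_space_measure_pmf)

lemma space_ppp: "space (poisson_point_process \<alpha> \<nu>) = (\<Pi>\<^sub>E x\<in>space \<nu>. UNIV)"
  by (simp add: poisson_point_process_def space_PiM)

lemma measure_ppp_cylinder:
  assumes "finite J" "J \<subseteq> space \<nu>"
  shows "measure (poisson_point_process \<alpha> \<nu>)
      {\<omega>\<in>space (poisson_point_process \<alpha> \<nu>). \<forall>x\<in>J. \<omega> x \<in> X x} =
    (\<Prod>x\<in>J. measure (measure_pmf (poisson_law (\<alpha> * measure \<nu> {x}))) (X x))"
proof -
  interpret product_prob_space "\<lambda>x. measure_pmf (poisson_law (\<alpha> * measure \<nu> {x}))" "space \<nu>"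
    by unfold_locales
  have "emeasure (Pi\<^sub>M (space \<nu>) (\<lambda>x. measure_pmf (poisson_law (\<alpha> * measure \<nu> {x}))))
      {\<omega>\<in>space (Pi\<^sub>M (space \<nu>) (\<lambda>x. measure_pmf (poisson_law (\<alpha> * measure \<nu> {x})))). \<forall>x\<in>J. \<omega> x \<in> X x} =
      (\<Prod>x\<in>J. emeasure (measure_pmf (poisson_law (\<alpha> * measure \<nu> {x}))) (X x))"
    by (rule emeasure_PiM_Collect) (use assms in auto)
  then show ?thesis
    unfolding poisson_point_process_def measure_def
    by (simp add: measure_pmf.emeasure_eq_measure prod_ennreal prod_nonneg)
qed

lemma sets_ppp_component: "{\<omega>\<in>space (poisson_point_process \<alpha> \<nu>). \<omega> x \<in> X} \<in> sets (poisson_point_process \<alpha> \<nu>)"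
proof (cases "x \<in> space \<nu>")
  case True
  then show ?thesis unfolding poisson_point_process_def by (intro sets_Collect_single') auto
next
  case False
  let ?S = "space (poisson_point_process \<alpha> \<nu>)"
  have und: "\<omega> x = undefined" if "\<omega> \<in> ?S" for \<omega>
    using PiE_arb[OF _ False] that unfolding space_ppp by blast
  have "{\<omega>\<in>?S. \<omega> x \<in> X} = {\<omega>\<in>?S. undefined \<in> X}"
    by (rule Collect_cong, rule conj_cong[OF refl]) (simp only: und)
  then show ?thesis by (simp only: sets.sets_Collect_const)
qed

lemma void_finite:
  assumes "finite J" "J \<subseteq> space \<nu>" "\<alpha> \<ge> 0"
  shows "void \<alpha> \<nu> J = exp (- (\<alpha> * (\<Sum>x\<in>J. measure \<nu> {x})))"
proof -
  have "void \<alpha> \<nu> J = (\<Prod>x\<in>J. measure (measure_pmf (poisson_law (\<alpha> * measure \<nu> {x}))) {0})"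
    using measure_ppp_cylinder[OF assms(1,2), of \<alpha> "\<lambda>_. {0}"] by (simp add: void_def)
  also have "\<dots> = (\<Prod>x\<in>J. exp (- (\<alpha> * measure \<nu> {x})))"
    using assms(3) by (simp add: measure_pmf_single pmf_poisson_law_0)
  also have "\<dots> = exp (\<Sum>x\<in>J. - (\<alpha> * measure \<nu> {x}))" by (rule exp_sum[OF assms(1), symmetric])
  finally show ?thesis by (simp only: sum_negf sum_distrib_left)
qed

text \<open>The right-hand side is a limit because the total mass may be infinite. Identities for
  finite sets pass through this limit without a case distinction.\<close>

lemma void_limit:
  assumes "\<And>n. finite (J n)" "incseq J" "(\<Union>n. J n) \<subseteq> space \<nu>" "\<alpha> \<ge> 0"
  shows "(\<lambda>n. exp (- (\<alpha> * (\<Sum>x\<in>J n. measure \<nu> {x})))) \<longlonglongrightarrow> void \<alpha> \<nu> (\<Union>n. J n)"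
proof -
  interpret prob_space "poisson_point_process \<alpha> \<nu>" by (rule prob_space_ppp)
  define E where "E K = {\<omega>\<in>space (poisson_point_process \<alpha> \<nu>). \<forall>x\<in>K. \<omega> x = 0}" for K
  have "E (J n) \<in> events" for n
    unfolding E_def using sets_ppp_component[of \<alpha> \<nu> _ "{0}"]
    by (intro sets.sets_Collect_finite_All assms(1)) simp
  moreover have "decseq (\<lambda>n. E (J n))"
    using assms(2) unfolding decseq_def incseq_def E_def by blast
  ultimately have "(\<lambda>n. prob (E (J n))) \<longlonglongrightarrow> prob (\<Inter>n. E (J n))"
    by (intro finite_Lim_measure_decseq) auto
  moreover have "(\<Inter>n. E (J n)) = E (\<Union>n. J n)" unfolding E_def by blast
  moreover have "prob (E (J n)) = exp (- (\<alpha> * (\<Sum>x\<in>J n. measure \<nu> {x})))" for n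
    using void_finite[of "J n" \<nu> \<alpha>] assms unfolding void_def E_def by blast
  ultimately show ?thesis by (simp add: void_def E_def)
qed

lemma countable_exhaustion:
  assumes "countable J"
  shows "\<exists>K :: nat \<Rightarrow> _. (\<forall>n. finite (K n)) \<and> incseq K \<and> (\<Union>n. K n) = J"
proof (intro exI conjI allI)
  let ?K = "\<lambda>n. {x\<in>J. to_nat_on J x < n}"
  show "finite (?K n)" for n
    by (rule inj_on_finite[of "to_nat_on J" _ "{..<n}"])
      (use inj_on_subset[OF inj_on_to_nat_on[OF assms]] in auto)
  show "incseq ?K" by (auto simp: incseq_def)
  show "(\<Union>n. ?K n) = J" by auto
qed

text \<open>On finite sets this is a property of \<open>exp\<close>. It passes to the limit even if
  the void probability at intensity 1 is 0, as \<open>powr\<close> with a positive exponent is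
  continuous at base 0.\<close>

lemma void_powr:
  assumes "countable J" "J \<subseteq> space \<nu>" "\<alpha> > 0"
  shows "void \<alpha> \<nu> J = void 1 \<nu> J powr \<alpha>"
proof -
  obtain K where K: "\<And>n. finite (K n)" "incseq K" "(\<Union>n. K n) = J"
    using countable_exhaustion[OF assms(1)] by blast
  let ?s = "\<lambda>n. \<Sum>x\<in>K n. measure \<nu> {x}"
  have "(\<lambda>n. exp (- (1 * ?s n)) powr \<alpha>) \<longlonglongrightarrow> void 1 \<nu> J powr \<alpha>"
    using void_limit[OF K(1,2), of \<nu> 1] K(3) assms by (intro tendsto_powr') auto
  moreover have "exp (- (1 * ?s n)) powr \<alpha> = exp (- (\<alpha> * ?s n))" for n
    by (simp add: powr_def mult.commute)
  moreover have "(\<lambda>n. exp (- (\<alpha> * ?s n))) \<longlonglongrightarrow> void \<alpha> \<nu> J"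
    using void_limit[OF K(1,2), of \<nu> \<alpha>] K(3) assms by auto
  ultimately show ?thesis using LIMSEQ_unique by fastforce
qed

lemma void_bij:
  assumes "countable J" "J \<subseteq> space \<nu>" "J' \<subseteq> space \<nu>" "\<alpha> \<ge> 0" "bij_betw F J J'"
    and "\<And>x. x \<in> J \<Longrightarrow> measure \<nu> {F x} = measure \<nu> {x}"
  shows "void \<alpha> \<nu> J' = void \<alpha> \<nu> J"
proof -
  obtain K where K: "\<And>n. finite (K n)" "incseq K" "(\<Union>n. K n) = J"
    using countable_exhaustion[OF assms(1)] by blast
  have "(\<lambda>n. exp (- (\<alpha> * (\<Sum>x\<in>F ` K n. measure \<nu> {x})))) \<longlonglongrightarrow> void \<alpha> \<nu> (\<Union>n. F ` K n)"
  proof (rule void_limit)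
    show "incseq (\<lambda>n. F ` K n)" using K(2) by (auto simp: incseq_def)
    show "(\<Union>n. F ` K n) \<subseteq> space \<nu>" using assms K(3) by (auto simp: bij_betw_def)
  qed (use K assms in auto)
  moreover have "(\<Union>n. F ` K n) = J'" using assms(5) K(3) by (auto simp: bij_betw_def)
  moreover have "(\<Sum>x\<in>F ` K n. measure \<nu> {x}) = (\<Sum>x\<in>K n. measure \<nu> {x})" for n
  proof -
    have sub: "K n \<subseteq> J" using K(3) by blast
    then have "inj_on F (K n)" using assms(5) inj_on_subset unfolding bij_betw_def by blast
    then have "(\<Sum>x\<in>F ` K n. measure \<nu> {x}) = (\<Sum>x\<in>K n. measure \<nu> {F x})" by (simp add: sum.reindex)
    also have "\<dots> = (\<Sum>x\<in>K n. measure \<nu> {x})" using assms(6) sub by (intro sum.cong) auto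
    finally show ?thesis .
  qed
  moreover have "(\<lambda>n. exp (- (\<alpha> * (\<Sum>x\<in>K n. measure \<nu> {x})))) \<longlonglongrightarrow> void \<alpha> \<nu> J"
    using void_limit[OF K(1,2), of \<nu> \<alpha>] K(3) assms by auto
  ultimately show ?thesis using LIMSEQ_unique by fastforce
qed

text \<open>Not the case \<alpha> = 0 of \<open>void_powr\<close>: for infinite mass the base there
  is 0, and \<open>0 powr 0 = 0\<close>.\<close>

lemma void_0:
  assumes "countable J" "J \<subseteq> space \<nu>"
  shows "void 0 \<nu> J = 1"
proof -
  obtain K where K: "\<And>n. finite (K n)" "incseq K" "(\<Union>n. K n) = J"
    using countable_exhaustion[OF assms(1)] by blast
  have "(\<lambda>n. 1) \<longlonglongrightarrow> void 0 \<nu> J"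
    using void_limit[OF K(1,2), of \<nu> 0] K(3) assms by simp
  then show ?thesis by (simp add: LIMSEQ_const_iff)
qed

lemma void_le:
  assumes "x \<in> J" "x \<in> space \<nu>" "\<alpha> \<ge> 0"
  shows "void \<alpha> \<nu> J \<le> exp (- (\<alpha> * measure \<nu> {x}))"
proof -
  interpret prob_space "poisson_point_process \<alpha> \<nu>" by (rule prob_space_ppp)
  have "void \<alpha> \<nu> J \<le> void \<alpha> \<nu> {x}"
    unfolding void_def
    by (rule finite_measure_mono) (use assms sets_ppp_component[of \<alpha> \<nu> x "{0}"] in auto)
  also have "\<dots> = exp (- (\<alpha> * measure \<nu> {x}))" using void_finite[of "{x}" \<nu> \<alpha>] assms by simp
  finally show ?thesis .
qed

lemma indep_occurrence:
  "prob_space.indep_events (poisson_point_process \<alpha> \<nu>)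
    (\<lambda>x. {\<omega>\<in>space (poisson_point_process \<alpha> \<nu>). \<omega> x \<ge> 1}) (space \<nu>)"
proof -
  interpret prob_space "poisson_point_process \<alpha> \<nu>" by (rule prob_space_ppp)
  define A where "A x = {\<omega>\<in>space (poisson_point_process \<alpha> \<nu>). \<omega> x \<in> {1..}}" for x
  have "indep_events A (space \<nu>)"
    unfolding indep_events_def
  proof (intro conjI allI impI)
    show "A ` space \<nu> \<subseteq> events" unfolding A_def by (rule image_subsetI) (rule sets_ppp_component)
    fix J assume J: "J \<subseteq> space \<nu>" "J \<noteq> {}" "finite J"
    have "(\<Inter>j\<in>J. A j) = {\<omega>\<in>space (poisson_point_process \<alpha> \<nu>). \<forall>x\<in>J. \<omega> x \<in> {1..}}"
      using J(2) unfolding A_def by blast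
    moreover have "A j = {\<omega>\<in>space (poisson_point_process \<alpha> \<nu>). \<forall>x\<in>{j}. \<omega> x \<in> {1..}}" for j
      unfolding A_def by blast
    then have "prob (A j) = measure (measure_pmf (poisson_law (\<alpha> * measure \<nu> {j}))) {1..}" if "j \<in> J" for j
      using measure_ppp_cylinder[of "{j}" \<nu> \<alpha> "\<lambda>_. {1..}"] J that by (auto simp: subset_iff)
    ultimately show "prob (\<Inter>j\<in>J. A j) = (\<Prod>j\<in>J. prob (A j))"
      using measure_ppp_cylinder[OF J(3,1), of \<alpha> "\<lambda>_. {1..}"] by simp
  qed
  then show ?thesis by (simp add: A_def[abs_def])
qed

section \<open>Loops\<close>

lemma based_loop_rotate1: "based_loop adj vs \<Longrightarrow> based_loop adj (rotate1 vs)"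
proof (cases vs)
  case (Cons x xs)
  assume "based_loop adj vs"
  with Cons show ?thesis
    by (cases xs rule: rev_cases)
      (auto simp: based_loop_def successively_append_iff successively_Cons hd_append split: if_splits)
qed simp

lemma based_loop_rotate: "based_loop adj vs \<Longrightarrow> based_loop adj (rotate k vs)"
  by (induction k) (auto simp: based_loop_rotate1)

definition rotations :: "'v list \<Rightarrow> 'v list set" where
  "rotations vs = range (\<lambda>k. rotate k vs)"

lemma self_rotations: "vs \<in> rotations vs"
  unfolding rotations_def by (rule range_eqI[of _ _ 0]) simp

lemma rotations_eq:
  assumes "ws \<in> rotations vs"
  shows "rotations ws = rotations vs"
proof -
  obtain k where k: "ws = rotate k vs" using assms by (auto simp: rotations_def)
  have "rotate j vs \<in> rotations ws" for j
  proof (cases "vs = []")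
    case False
    obtain i where "(i + k) mod length vs = j mod length vs"
    proof
      \<comment> \<open>Stands for \<open>j - k\<close> modulo the length; adding a multiple of the
        length keeps the subtraction on naturals exact.\<close>
      show "(j + length vs * k - k + k) mod length vs = j mod length vs"
      proof -
        have "k \<le> length vs * k" using False by (cases vs) auto
        then have "j + length vs * k - k + k = j + length vs * k" by linarith
        then show ?thesis by (simp only: mod_mult_self2)
      qed
    qed
    then have "rotate j vs = rotate i ws"
      unfolding k rotate_rotate by (metis rotate_conv_mod)
    then show ?thesis by (auto simp: rotations_def)
  qed (use k in \<open>auto simp: rotations_def\<close>)
  moreover have "rotate j ws \<in> rotations vs" for j by (auto simp: k rotate_rotate rotations_def)
  ultimately show ?thesis by (fastforce simp: rotations_def)
qed

lemma finite_rotations: "finite (rotations vs)"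
proof (cases "vs = []")
  case False
  have "rotations vs \<subseteq> (\<lambda>k. rotate k vs) ` {..<length vs}"
    unfolding rotations_def
    using rotate_conv_mod[of _ vs] False by (auto intro!: image_eqI[of _ _ "_ mod length vs"])
  then show ?thesis using finite_surj by blast
qed (simp add: rotations_def)

lemma set_rotations: "ws \<in> rotations vs \<Longrightarrow> set ws = set vs"
  and length_rotations: "ws \<in> rotations vs \<Longrightarrow> length ws = length vs"
  by (auto simp: rotations_def)

lemma based_loop_rotations: "based_loop adj vs \<Longrightarrow> ws \<in> rotations vs \<Longrightarrow> based_loop adj ws"
  by (auto simp: rotations_def based_loop_rotate)

lemma cyclic_class: "based_loop adj vs \<Longrightarrow> cyclic_shift_rel adj `` {vs} = rotations vs"
  by (auto simp: cyclic_shift_rel_def rotations_def based_loop_rotate)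

lemma loops_eq: "loops adj = rotations ` {vs. based_loop adj vs}"
  unfolding loops_def quotient_def using cyclic_class[of adj] by auto

lemma loop_vertices_rotations: "loop_vertices (rotations vs) = set vs"
  using set_rotations self_rotations by (fastforce simp: loop_vertices_def)

lemma rotations_map: "map f ` rotations vs = rotations (map f vs)"
  by (auto simp: rotations_def rotate_map)

lemma countable_loops:
  assumes "countable (UNIV :: 'v set)"
  shows "countable (loops (adj :: 'v \<Rightarrow> 'v \<Rightarrow> bool))"
  unfolding loops_eq using countable_lists[OF assms] by (auto intro: countable_subset)

lemma space_loop_measure: "space (loop_measure d adj \<kappa>) = loops adj"
  by (simp add: loop_measure_def)

definition loop_weight :: "nat \<Rightarrow> real \<Rightarrow> nat \<Rightarrow> real" where
  "loop_weight d \<kappa> n = 1 / real n * (1 / (1 + \<kappa>)) ^ n * (1 / real d) ^ n"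

text \<open>The sum runs over the actual class, which has fewer members than the length when the
  loop repeats a shorter one.\<close>

lemma measure_loop:
  assumes "l \<in> loops adj" "\<kappa> > -1"
  shows "measure (loop_measure d adj \<kappa>) {l} = (\<Sum>vs\<in>l. loop_weight d \<kappa> (length vs))"
proof -
  obtain vs where vs: "based_loop adj vs" "l = rotations vs" using assms(1) by (auto simp: loops_eq)
  let ?B = "{vs. based_loop adj vs}"
  let ?f = "\<lambda>vs. cyclic_shift_rel adj `` {vs}"
  have meas: "?f \<in> based_loop_measure d adj \<kappa> \<rightarrow>\<^sub>M count_space (loops adj)"
    unfolding based_loop_measure_def
    by (auto simp: measurable_point_measure_eq1 loops_eq cyclic_class)
  have pre: "?f -` {l} \<inter> space (based_loop_measure d adj \<kappa>) = l"
  proof -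
    have *: "based_loop adj ws \<and> rotations ws = l \<longleftrightarrow> ws \<in> l" for ws
      using vs based_loop_rotations rotations_eq self_rotations by metis
    have sp: "space (based_loop_measure d adj \<kappa>) = ?B"
      by (simp add: based_loop_measure_def space_point_measure)
    show ?thesis
    proof (rule set_eqI)
      fix ws
      show "ws \<in> ?f -` {l} \<inter> space (based_loop_measure d adj \<kappa>) \<longleftrightarrow> ws \<in> l"
        using *[of ws] cyclic_class[of adj ws] unfolding sp by (cases "based_loop adj ws") simp_all
    qed
  qed
  have "emeasure (loop_measure d adj \<kappa>) {l} = emeasure (based_loop_measure d adj \<kappa>) l"
    unfolding loop_measure_def using emeasure_distr[OF meas, of "{l}"] assms(1) by (simp only: pre) simp
  also have "\<dots> = (\<Sum>vs\<in>l. ennreal (loop_weight d \<kappa> (length vs)))"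
    unfolding based_loop_measure_def loop_weight_def
    by (rule emeasure_point_measure_finite2) (use vs based_loop_rotations finite_rotations in auto)
  also have "\<dots> = ennreal (\<Sum>vs\<in>l. loop_weight d \<kappa> (length vs))"
    by (rule sum_ennreal) (use assms(2) in \<open>simp add: loop_weight_def\<close>)
  finally show ?thesis
    using assms(2) by (simp add: measure_def sum_nonneg loop_weight_def)
qed

section \<open>Loop percolation on an oriented tree\<close>

locale oriented_tree = end_tree par b for par :: "'v \<Rightarrow> 'v" and b :: nat +
  fixes adj :: "'v \<Rightarrow> 'v \<Rightarrow> bool" and r0 :: 'v
  assumes adj_iff: "adj x y \<longleftrightarrow> par x = y \<or> par y = x"
    and common_ancestor: "\<exists>i j. (par ^^ i) y = (par ^^ j) r0"
begin

text \<open>More than a highest vertex: the path from each vertex up to \<open>t\<close> must stay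
  in \<open>S\<close>. This is why a loop covers every edge between its vertices and its
  top.\<close>

definition is_top :: "'v \<Rightarrow> 'v set \<Rightarrow> bool" where
  "is_top t S \<longleftrightarrow> t \<in> S \<and> (\<forall>v\<in>S. \<exists>k. (par ^^ k) v = t \<and> (\<forall>i\<le>k. (par ^^ i) v \<in> S))"

lemma is_top_unique:
  assumes "is_top t S" "is_top t' S"
  shows "t = t'"
proof -
  obtain k k' where k: "(par ^^ k) t' = t" "(par ^^ k') t = t'" using assms unfolding is_top_def by blast
  then have "(par ^^ (k' + k)) t' = t'" by (metis par_pow_add)
  from par_acyclic[OF this] k show ?thesis by simp
qed

lemma is_top_below: "is_top t S \<Longrightarrow> S \<subseteq> below t"
  unfolding is_top_def below_def desc_def by blast

text \<open>Induction on a new first vertex \<open>x\<close> next to \<open>y\<close>. A child of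
  \<open>y\<close> leaves the top unchanged, and a parent of the old top becomes the new one. If
  \<open>y\<close> is not the top, its parent lies on the path from \<open>y\<close> to the top and
  was already visited.\<close>

lemma walk_top:
  assumes "successively adj vs" "vs \<noteq> []"
  shows "\<exists>t. is_top t (set vs)"
  using assms
proof (induction vs rule: induct_list012)
  case (2 x)
  then show ?case by (intro exI[of _ x]) (auto simp: is_top_def intro: exI[of _ 0])
next
  case (3 x y zs)
  then obtain t where t: "is_top t (set (y # zs))" and xy: "adj x y" by auto
  let ?S = "set (y # zs)"
  obtain k where k: "(par ^^ k) y = t" "\<And>i. i \<le> k \<Longrightarrow> (par ^^ i) y \<in> ?S"
    using t unfolding is_top_def by (meson list.set_intros(1))
  have old: "\<exists>k. (par ^^ k) v = t \<and> (\<forall>i\<le>k. (par ^^ i) v \<in> set (x # y # zs))" if "v \<in> ?S" for v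
    using t that unfolding is_top_def by (metis list.set_intros(2))
  have set3: "set (x # y # zs) = insert x ?S" by simp
  consider "par x = y" | "par y = x" "k = 0" | "par y = x" "k \<noteq> 0"
    using xy unfolding adj_iff by blast
  then show ?case
  proof cases
    case 1
    have "\<exists>k. (par ^^ k) x = t \<and> (\<forall>i\<le>k. (par ^^ i) x \<in> set (x # y # zs))"
    proof (intro exI conjI allI impI)
      show "(par ^^ Suc k) x = t" using 1 k(1) by (simp add: funpow_swap1)
      show "(par ^^ i) x \<in> set (x # y # zs)" if "i \<le> Suc k" for i
        using that 1 k(2)[of "i - 1"] by (cases i) (auto simp: funpow_swap1)
    qed
    with old t have "is_top t (insert x ?S)" unfolding is_top_def set3 by blast
    then show ?thesis unfolding set3 by blast
  next
    case 2
    then have x: "x = par t" using k(1) by simp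
    have "\<exists>k. (par ^^ k) v = x \<and> (\<forall>i\<le>k. (par ^^ i) v \<in> insert x ?S)" if v: "v \<in> ?S" for v
    proof -
      obtain j where j: "(par ^^ j) v = t" "\<And>i. i \<le> j \<Longrightarrow> (par ^^ i) v \<in> ?S"
        using t v unfolding is_top_def by meson
      show ?thesis
      proof (intro exI conjI allI impI)
        show "(par ^^ Suc j) v = x" using j(1) x by simp
        show "(par ^^ i) v \<in> insert x ?S" if "i \<le> Suc j" for i
          using that j x by (cases "i = Suc j") auto
      qed
    qed
    moreover have "(par ^^ 0) x = x \<and> (\<forall>i\<le>0. (par ^^ i) x \<in> insert x ?S)" by simp
    ultimately have "is_top x (insert x ?S)" unfolding is_top_def by blast
    then show ?thesis unfolding set3 by blast
  next
    case 3
    then have "x \<in> ?S" using k(2)[of 1] by simp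
    with t show ?thesis unfolding set3 by (metis insert_absorb)
  qed
qed simp

definition top_of :: "'v list set \<Rightarrow> 'v" where
  "top_of l = (SOME t. is_top t (loop_vertices l))"

lemma loop_cases:
  assumes "l \<in> loops adj"
  obtains vs where "based_loop adj vs" "l = rotations vs" "loop_vertices l = set vs"
  using assms unfolding loops_eq by (auto simp: loop_vertices_rotations)

lemma is_top_top_of:
  assumes "l \<in> loops adj"
  shows "is_top (top_of l) (loop_vertices l)"
proof -
  obtain vs where vs: "based_loop adj vs" "loop_vertices l = set vs" using assms by (rule loop_cases)
  then have "successively adj vs" "vs \<noteq> []" by (auto simp: based_loop_def)
  then have "\<exists>t. is_top t (loop_vertices l)" unfolding vs(2) by (rule walk_top)
  then show ?thesis unfolding top_of_def by (rule someI_ex)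
qed

lemma top_of_eqI: "l \<in> loops adj \<Longrightarrow> is_top t (loop_vertices l) \<Longrightarrow> top_of l = t"
  using is_top_unique is_top_top_of by blast

lemma not_par_self: "par x \<noteq> x"
  using par_acyclic[of 1 x] by auto

lemma loop_child:
  assumes "l \<in> loops adj"
  shows "\<exists>c\<in>loop_vertices l. par c = top_of l"
proof -
  obtain vs where vs: "based_loop adj vs" "loop_vertices l = set vs" using assms by (rule loop_cases)
  then have "2 \<le> length vs" by (simp add: based_loop_def)
  then obtain x y zs where xy: "vs = x # y # zs"
    by (metis Suc_le_length_iff numeral_2_eq_2)
  with vs(1) have "adj x y" by (simp add: based_loop_def)
  then have "x \<noteq> y" using adj_iff not_par_self by metis
  then obtain v where v: "v \<in> loop_vertices l" "v \<noteq> top_of l" using vs xy by (metis list.set_intros)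
  obtain k where k: "(par ^^ k) v = top_of l" "\<And>i. i \<le> k \<Longrightarrow> (par ^^ i) v \<in> loop_vertices l"
    using is_top_top_of[OF assms] v(1) unfolding is_top_def by meson
  with v(2) obtain k' where "k = Suc k'" by (cases k) auto
  with k show ?thesis by (intro bexI[of _ "(par ^^ k') v"]) auto
qed

section \<open>Loops across an edge and their transport between subtrees\<close>

definition crossing :: "nat \<Rightarrow> 'v \<Rightarrow> 'v list set set" where
  "crossing k v = {l\<in>loops adj. v \<in> loop_vertices l \<and> (\<exists>i\<in>{1..k}. top_of l = (par ^^ i) v)}"

lemma adj_iso:
  assumes "subtree_iso f w w'" "x \<in> below w" "y \<in> below w" "adj x y"
  shows "adj (f x) (f y)"
proof -
  have "adj (f x) (f y)" if "x \<in> below w" "y \<in> below w" "par x = y" for x y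
  proof -
    have "x \<noteq> w" using that par_root_not_below by auto
    then show ?thesis using assms(1) that unfolding subtree_iso_def adj_iff by auto
  qed
  with assms(2-4) show ?thesis unfolding adj_iff[of x y] by (metis adj_iff)
qed

lemma map_loop:
  assumes iso: "subtree_iso f w w'" and l: "l \<in> loops adj" and sub: "loop_vertices l \<subseteq> below w"
  shows "map f ` l \<in> loops adj" "loop_vertices (map f ` l) = f ` loop_vertices l"
    "top_of (map f ` l) = f (top_of l)"
proof -
  obtain vs where vs: "based_loop adj vs" "l = rotations vs" "loop_vertices l = set vs"
    using l by (rule loop_cases)
  have fl: "map f ` l = rotations (map f vs)" by (simp add: vs(2) rotations_map)
  have sub': "set vs \<subseteq> below w" using sub vs(3) by simp
  have ne: "vs \<noteq> []" using vs(1) by (auto simp: based_loop_def)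
  have "successively adj (map f vs)"
    unfolding successively_map
    by (rule successively_mono[of adj]) (use vs(1) adj_iso[OF iso] sub' in \<open>auto simp: based_loop_def\<close>)
  moreover have "adj (last (map f vs)) (hd (map f vs))"
    using adj_iso[OF iso, of "last vs" "hd vs"] vs(1) sub' ne
    by (auto simp: based_loop_def last_map hd_map subset_iff)
  ultimately have bl: "based_loop adj (map f vs)" using vs(1) by (simp add: based_loop_def)
  then show fl_loop: "map f ` l \<in> loops adj" by (auto simp: fl loops_eq)
  show verts: "loop_vertices (map f ` l) = f ` loop_vertices l"
    by (simp add: fl loop_vertices_rotations vs(3))
  have top: "is_top (top_of l) (loop_vertices l)" using l by (rule is_top_top_of)
  have "is_top (f (top_of l)) (f ` loop_vertices l)"
    unfolding is_top_def
  proof (intro conjI ballI)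
    show "f (top_of l) \<in> f ` loop_vertices l" using top unfolding is_top_def by blast
    fix z assume "z \<in> f ` loop_vertices l"
    then obtain v where v: "v \<in> loop_vertices l" "z = f v" by blast
    then obtain k where k: "(par ^^ k) v = top_of l" "\<And>i. i \<le> k \<Longrightarrow> (par ^^ i) v \<in> loop_vertices l"
      using top unfolding is_top_def by meson
    have "v \<in> below w" using v sub by blast
    then obtain j where j: "(par ^^ j) v = w" by (auto simp: below_def desc_def)
    \<comment> \<open>Otherwise the path from \<open>v\<close> to the top of the loop passes through
      \<open>par w\<close>, which is outside \<open>below w\<close>.\<close>
    have kj: "k \<le> j"
    proof (rule ccontr)
      assume "\<not> k \<le> j"
      then have "(par ^^ Suc j) v \<in> below w" using k(2)[of "Suc j"] sub by auto
      then show False using j par_root_not_below by simp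
    qed
    have pf: "(par ^^ i) (f v) = f ((par ^^ i) v)" if "i \<le> k" for i
      by (rule subtree_iso_par_pow[OF iso j]) (use that kj in simp)
    show "\<exists>k. (par ^^ k) z = f (top_of l) \<and> (\<forall>i\<le>k. (par ^^ i) z \<in> f ` loop_vertices l)"
      using k pf v(2) by (intro exI[of _ k]) auto
  qed
  then show "top_of (map f ` l) = f (top_of l)"
    using top_of_eqI[OF fl_loop] verts by simp
qed

lemma crossing_below:
  assumes "l \<in> crossing k v"
  shows "loop_vertices l \<subseteq> below ((par ^^ k) v)"
proof -
  obtain i where i: "l \<in> loops adj" "i \<le> k" "top_of l = (par ^^ i) v"
    using assms by (auto simp: crossing_def)
  have "loop_vertices l \<subseteq> below (top_of l)" using is_top_below is_top_top_of i(1) by blast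
  moreover have "top_of l \<in> below ((par ^^ k) v)"
    unfolding i(3) below_def desc_def using i(2) by (auto simp: par_pow_add intro!: exI[of _ "k - i"])
  ultimately show ?thesis using below_trans by blast
qed

lemma map_crossing:
  assumes iso: "subtree_iso f ((par ^^ k) v) w'" and f: "\<And>i. i \<le> k \<Longrightarrow> f ((par ^^ i) v) = (par ^^ i) v'"
    and l: "l \<in> crossing k v"
  shows "map f ` l \<in> crossing k v'"
proof -
  obtain i where i: "l \<in> loops adj" "v \<in> loop_vertices l" "i \<in> {1..k}" "top_of l = (par ^^ i) v"
    using l by (auto simp: crossing_def)
  note ml = map_loop[OF iso i(1) crossing_below[OF l]]
  have "v' \<in> loop_vertices (map f ` l)" using ml(2) i(2) f[of 0] by auto
  moreover have "top_of (map f ` l) = (par ^^ i) v'" using ml(3) i(3,4) f[of i] by simp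
  ultimately show ?thesis using ml(1) i(3) unfolding crossing_def by blast
qed

lemma measure_map_loop:
  assumes iso: "subtree_iso f w w'" and l: "l \<in> loops adj" and sub: "loop_vertices l \<subseteq> below w"
    and "\<kappa> > -1"
  shows "measure (loop_measure d adj \<kappa>) {map f ` l} = measure (loop_measure d adj \<kappa>) {l}"
proof -
  have inj: "inj_on f (below w)" using iso by (auto simp: subtree_iso_def bij_betw_def)
  have "inj_on (map f) l"
  proof (rule inj_onI)
    fix xs ys assume "xs \<in> l" "ys \<in> l" "map f xs = map f ys"
    moreover then have "set xs \<union> set ys \<subseteq> below w" using sub by (auto simp: loop_vertices_def)
    ultimately show "xs = ys" using inj map_inj_on inj_on_subset by metis
  qed
  then have "(\<Sum>vs\<in>map f ` l. loop_weight d \<kappa> (length vs)) = (\<Sum>vs\<in>l. loop_weight d \<kappa> (length vs))"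
    by (simp add: sum.reindex)
  then show ?thesis using measure_loop[OF l assms(4)] measure_loop[OF map_loop(1)[OF iso l sub] assms(4)] by simp
qed

text \<open>All loops in \<open>crossing k v\<close> live below the \<open>k\<close>-th ancestor of
  \<open>v\<close>. An isomorphism of the two subtrees that matches the ancestral paths carries them
  over and preserves lengths and the number of representatives, hence the measure.\<close>

lemma crossing_bij:
  "\<exists>F. bij_betw F (crossing k v) (crossing k v') \<and>
    (\<forall>l\<in>crossing k v. \<forall>d \<kappa>. \<kappa> > -1 \<longrightarrow>
      measure (loop_measure d adj \<kappa>) {F l} = measure (loop_measure d adj \<kappa>) {l})"
proof -
  let ?w = "(par ^^ k) v" and ?w' = "(par ^^ k) v'"
  obtain f where iso: "subtree_iso f ?w ?w'" and f: "\<And>i. i \<le> k \<Longrightarrow> f ((par ^^ i) v) = (par ^^ i) v'"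
    using subtree_iso_path[of k v v'] by blast
  let ?g = "inv_into (below ?w) f"
  have iso': "subtree_iso ?g ?w' ?w" by (rule subtree_iso_inv[OF iso])
  have bij: "bij_betw f (below ?w) (below ?w')" using iso by (simp add: subtree_iso_def)
  have gf: "?g (f y) = y" if "y \<in> below ?w" for y
    using bij that by (simp add: bij_betw_def inv_into_f_f)
  have fg: "f (?g y) = y" if "y \<in> below ?w'" for y
    using bij that by (simp add: bij_betw_def f_inv_into_f)
  have g: "?g ((par ^^ i) v') = (par ^^ i) v" if "i \<le> k" for i
  proof -
    have "(par ^^ i) v \<in> below ?w"
      unfolding below_def desc_def using that by (auto simp: par_pow_add intro!: exI[of _ "k - i"])
    then show ?thesis using gf f[OF that] by metis
  qed
  have id: "map h2 ` map h1 ` l = l" if "\<And>y. y \<in> loop_vertices l \<Longrightarrow> h2 (h1 y) = y" for h1 h2 :: "'v \<Rightarrow> 'v" and l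
  proof -
    have "map h2 (map h1 vs) = vs" if vs: "vs \<in> l" for vs
    proof -
      have "h2 (h1 y) = y" if "y \<in> set vs" for y
        using \<open>\<And>y. y \<in> loop_vertices l \<Longrightarrow> h2 (h1 y) = y\<close>[of y] that vs by (auto simp: loop_vertices_def)
      then show ?thesis by (simp add: map_idI)
    qed
    then show ?thesis by (simp add: image_image cong: image_cong)
  qed
  have "bij_betw ((`) (map f)) (crossing k v) (crossing k v')"
  proof (rule bij_betw_byWitness[where f' = "(`) (map ?g)"])
    show "\<forall>l\<in>crossing k v. map ?g ` map f ` l = l"
      using id[of _ ?g f] gf crossing_below by blast
    show "\<forall>l\<in>crossing k v'. map f ` map ?g ` l = l"
      using id[of _ f ?g] fg crossing_below by blast
    show "(`) (map f) ` crossing k v \<subseteq> crossing k v'"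
      using map_crossing[OF iso f] by blast
    show "(`) (map ?g) ` crossing k v' \<subseteq> crossing k v"
      using map_crossing[OF iso' g] by blast
  qed
  moreover have "measure (loop_measure d adj \<kappa>) {map f ` l} = measure (loop_measure d adj \<kappa>) {l}"
    if "l \<in> crossing k v" "\<kappa> > -1" for l d \<kappa>
    using measure_map_loop[OF iso _ crossing_below[OF that(1)] that(2)] that(1) by (auto simp: crossing_def)
  ultimately show ?thesis by blast
qed

lemma countable_vertices: "countable (UNIV :: 'v set)"
proof -
  have "(UNIV :: 'v set) \<subseteq> (\<Union>j. below ((par ^^ j) r0))"
    using common_ancestor unfolding below_def desc_def by blast
  moreover have "countable (\<Union>j. below ((par ^^ j) r0))" by (intro countable_UN countable_below) simp
  ultimately show ?thesis using countable_subset by blast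
qed

lemma countable_crossing: "countable (crossing k v)"
  by (rule countable_subset[OF _ countable_loops[OF countable_vertices]]) (auto simp: crossing_def)

lemma crossing_loops: "crossing k v \<subseteq> space (loop_measure d adj \<kappa>)"
  by (auto simp: crossing_def space_loop_measure)

definition uncovered :: "nat \<Rightarrow> real \<Rightarrow> real \<Rightarrow> nat \<Rightarrow> real" where
  "uncovered d \<kappa> \<alpha> k = void \<alpha> (loop_measure d adj \<kappa>) (crossing k r0)"

lemma loop_cover_soup:
  assumes "\<alpha> \<ge> 0" "\<kappa> > -1"
  shows "loop_cover par b (loop_soup d adj \<alpha> \<kappa>) (loops adj)
    (\<lambda>l. {\<omega>\<in>space (loop_soup d adj \<alpha> \<kappa>). \<omega> l \<ge> 1}) top_of loop_vertices (uncovered d \<kappa> \<alpha>)"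
proof -
  interpret prob_space "loop_soup d adj \<alpha> \<kappa>" unfolding loop_soup_def by (rule prob_space_ppp)
  show ?thesis
  proof
    show "countable (loops adj)" by (rule countable_loops[OF countable_vertices])
    show "indep_events (\<lambda>l. {\<omega>\<in>space (loop_soup d adj \<alpha> \<kappa>). \<omega> l \<ge> 1}) (loops adj)"
      using indep_occurrence[of \<alpha> "loop_measure d adj \<kappa>"] unfolding loop_soup_def space_loop_measure .
    show "\<exists>k. (par ^^ k) v = top_of l \<and> (\<forall>i\<le>k. (par ^^ i) v \<in> loop_vertices l)"
      if "l \<in> loops adj" "v \<in> loop_vertices l" for l v
      using is_top_top_of[OF that(1)] that(2) unfolding is_top_def by blast
    show "\<exists>c\<in>loop_vertices l. par c = top_of l" if "l \<in> loops adj" for l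
      by (rule loop_child[OF that])
    fix v k
    obtain F where "bij_betw F (crossing k r0) (crossing k v)"
      "\<And>l. l \<in> crossing k r0 \<Longrightarrow> measure (loop_measure d adj \<kappa>) {F l} = measure (loop_measure d adj \<kappa>) {l}"
      using crossing_bij[of k r0 v] assms(2) by blast
    then have "void \<alpha> (loop_measure d adj \<kappa>) (crossing k v) = uncovered d \<kappa> \<alpha> k"
      unfolding uncovered_def
      by (intro void_bij countable_crossing crossing_loops assms(1))
    moreover have "{\<omega>\<in>space (loop_soup d adj \<alpha> \<kappa>). \<forall>l\<in>crossing k v. \<omega> \<notin> {\<omega>\<in>space (loop_soup d adj \<alpha> \<kappa>). \<omega> l \<ge> 1}} =
        {\<omega>\<in>space (loop_soup d adj \<alpha> \<kappa>). \<forall>l\<in>crossing k v. \<omega> l = 0}"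
      by (rule Collect_cong) (auto simp: not_le)
    ultimately show "prob {\<omega>\<in>space (loop_soup d adj \<alpha> \<kappa>).
        \<forall>l\<in>{l\<in>loops adj. v \<in> loop_vertices l \<and> (\<exists>i\<in>{1..k}. top_of l = (par ^^ i) v)}.
          \<omega> \<notin> {\<omega>\<in>space (loop_soup d adj \<alpha> \<kappa>). \<omega> l \<ge> 1}} = uncovered d \<kappa> \<alpha> k"
      unfolding crossing_def[symmetric] void_def loop_soup_def by (simp only:)
  qed
qed

end

section \<open>Clusters: measurability and comparison with subclusters\<close>

lemma loop_connected_step:
  assumes "loop_connected adj \<omega> x y" "l \<in> open_loops adj \<omega>" "y \<in> loop_vertices l" "z \<in> loop_vertices l"
  shows "loop_connected adj \<omega> x z"
proof (cases "x = y")
  case True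
  with assms show ?thesis unfolding loop_connected_def by (intro disjI2 exI[of _ "[l]"]) auto
next
  case False
  then obtain ls where ls: "ls \<noteq> []" "set ls \<subseteq> open_loops adj \<omega>" "x \<in> loop_vertices (hd ls)"
    "y \<in> loop_vertices (last ls)" "successively (\<lambda>l l'. loop_vertices l \<inter> loop_vertices l' \<noteq> {}) ls"
    using assms(1) unfolding loop_connected_def by blast
  with assms(2-4) show ?thesis
    unfolding loop_connected_def
    by (intro disjI2 exI[of _ "ls @ [l]"]) (auto simp: successively_append_iff)
qed

lemma cluster_subset:
  assumes "x \<in> Z" and closed: "\<And>l. l \<in> open_loops adj \<omega> \<Longrightarrow> loop_vertices l \<inter> Z \<noteq> {} \<Longrightarrow> loop_vertices l \<subseteq> Z"
  shows "cluster adj \<omega> x \<subseteq> Z"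
proof -
  have chain: "loop_vertices (last ls) \<subseteq> Z"
    if "ls \<noteq> []" "set ls \<subseteq> open_loops adj \<omega>" "loop_vertices (hd ls) \<inter> Z \<noteq> {}"
      "successively (\<lambda>l l'. loop_vertices l \<inter> loop_vertices l' \<noteq> {}) ls" for ls
    using that
  proof (induction ls)
    case (Cons l ls)
    have l: "loop_vertices l \<subseteq> Z" using closed[of l] Cons.prems by auto
    show ?case
    proof (cases "ls = []")
      case False
      then have "loop_vertices l \<inter> loop_vertices (hd ls) \<noteq> {}"
        using Cons.prems(4) by (auto simp: successively_Cons)
      with l have "loop_vertices (hd ls) \<inter> Z \<noteq> {}" by blast
      with Cons False show ?thesis by (auto simp: successively_Cons)
    qed (use l in simp)
  qed simp
  show ?thesis
  proof
    fix y assume "y \<in> cluster adj \<omega> x"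
    then have "loop_connected adj \<omega> x y" by (simp add: cluster_def)
    then show "y \<in> Z"
      unfolding loop_connected_def
    proof
      assume "\<exists>ls. ls \<noteq> [] \<and> set ls \<subseteq> open_loops adj \<omega> \<and> x \<in> loop_vertices (hd ls) \<and>
        y \<in> loop_vertices (last ls) \<and> successively (\<lambda>l l'. loop_vertices l \<inter> loop_vertices l' \<noteq> {}) ls"
      then show "y \<in> Z" using chain assms(1) by blast
    qed (use assms(1) in simp)
  qed
qed

context oriented_tree
begin

text \<open>There are countably many chains of loops and countably many finite vertex sets, and a
  cluster is infinite iff it leaves every finite set.\<close>

lemma event_infinite_cluster:
  "{\<omega>\<in>space (loop_soup d adj \<alpha> \<kappa>). infinite (cluster adj \<omega> x)} \<in> sets (loop_soup d adj \<alpha> \<kappa>)"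
proof -
  let ?P = "loop_soup d adj \<alpha> \<kappa>"
  have open_ev: "{\<omega>\<in>space ?P. \<omega> l \<ge> 1} \<in> sets ?P" for l
    using sets_ppp_component[of \<alpha> "loop_measure d adj \<kappa>" l "{1..}"] by (simp add: loop_soup_def)
  have conn_ev: "{\<omega>\<in>space ?P. loop_connected adj \<omega> x y} \<in> sets ?P" for y
  proof -
    define LL where "LL = {ls \<in> lists (loops adj). ls \<noteq> [] \<and> x \<in> loop_vertices (hd ls) \<and>
        y \<in> loop_vertices (last ls) \<and> successively (\<lambda>l l'. loop_vertices l \<inter> loop_vertices l' \<noteq> {}) ls}"
    have cLL: "countable LL"
      by (rule countable_subset[OF _ countable_lists[OF countable_loops[OF countable_vertices]]]) (auto simp: LL_def)
    have eq: "loop_connected adj \<omega> x y \<longleftrightarrow> x = y \<or> (\<exists>ls\<in>LL. \<forall>l\<in>set ls. \<omega> l \<ge> 1)" for \<omega>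
      unfolding loop_connected_def LL_def open_loops_def by (auto simp: subset_iff in_lists_conv_set)
    show ?thesis
      unfolding eq
      by (intro sets.sets_Collect_disj sets.sets_Collect_const sets.sets_Collect_countable_Ex'[OF _ cLL]
        sets.sets_Collect_finite_All open_ev) simp
  qed
  have eq: "infinite (cluster adj \<omega> x) \<longleftrightarrow> (\<forall>F\<in>{F. finite F}. \<exists>y\<in>-F. loop_connected adj \<omega> x y)" for \<omega>
  proof
    assume inf: "infinite (cluster adj \<omega> x)"
    show "\<forall>F\<in>{F. finite F}. \<exists>y\<in>-F. loop_connected adj \<omega> x y"
    proof (rule ballI, rule ccontr)
      fix F assume F: "F \<in> {F. finite F}" and "\<not> (\<exists>y\<in>-F. loop_connected adj \<omega> x y)"
      then have "cluster adj \<omega> x \<subseteq> F" unfolding cluster_def by blast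
      with F inf show False using finite_subset by blast
    qed
  next
    assume *: "\<forall>F\<in>{F. finite F}. \<exists>y\<in>-F. loop_connected adj \<omega> x y"
    show "infinite (cluster adj \<omega> x)"
    proof
      assume "finite (cluster adj \<omega> x)"
      with * obtain y where "y \<notin> cluster adj \<omega> x" "loop_connected adj \<omega> x y" by blast
      then show False by (simp add: cluster_def)
    qed
  qed
  have cF: "countable {F :: 'v set. finite F}"
    using countable_Collect_finite_subset[OF countable_vertices] by simp
  show ?thesis
    unfolding eq
  proof (rule sets.sets_Collect_countable_All'[OF _ cF])
    fix F :: "'v set"
    show "{\<omega>\<in>space ?P. \<exists>y\<in>-F. loop_connected adj \<omega> x y} \<in> sets ?P"
      by (rule sets.sets_Collect_countable_Ex'[OF conn_ev countable_subset[OF subset_UNIV countable_vertices]])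
  qed
qed

context
  fixes d :: nat and \<alpha> \<kappa> :: real
  assumes \<alpha>: "\<alpha> \<ge> 0" and \<kappa>: "\<kappa> > -1"
begin

interpretation loop_cover par b "loop_soup d adj \<alpha> \<kappa>" "loops adj"
  "\<lambda>l. {\<omega>\<in>space (loop_soup d adj \<alpha> \<kappa>). \<omega> l \<ge> 1}" top_of loop_vertices "uncovered d \<kappa> \<alpha>"
  by (rule loop_cover_soup[OF \<alpha> \<kappa>])

lemma subcluster_subset_cluster:
  assumes \<omega>: "\<omega> \<in> space (loop_soup d adj \<alpha> \<kappa>)"
  shows "subcluster w \<omega> \<subseteq> cluster adj \<omega> w"
proof -
  have "loop_connected adj \<omega> w v" if "v \<in> desc k w" "conn k v \<omega>" for k v
    using that
  proof (induction k arbitrary: v)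
    case 0
    then show ?case by (simp add: loop_connected_def)
  next
    case (Suc k)
    obtain l where l: "l \<in> loops adj" "\<omega> l \<ge> 1" "v \<in> loop_vertices l" "par v \<in> loop_vertices l"
      using conn_Suc(2)[OF Suc.prems(2)] by blast
    have "par v \<in> desc k w" using Suc.prems(1) desc_par_pow[of v k 1 w] by simp
    from Suc.IH[OF this conn_Suc(1)[OF Suc.prems(2)]] have "loop_connected adj \<omega> w (par v)" .
    then show ?case by (rule loop_connected_step) (use l in \<open>auto simp: open_loops_def\<close>)
  qed
  then show ?thesis unfolding subcluster_def cluster_def by blast
qed

lemma percolation_prob_pos:
  assumes "supercritical b (uncovered d \<kappa> \<alpha>)"
  shows "percolation_prob d adj r0 \<alpha> \<kappa> > 0"
proof -
  have "0 < prob {\<omega>\<in>space (loop_soup d adj \<alpha> \<kappa>). infinite (subcluster r0 \<omega>)}"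
    by (rule prob_infinite_pos[OF assms])
  also have "\<dots> \<le> percolation_prob d adj r0 \<alpha> \<kappa>"
    unfolding percolation_prob_def
    by (rule finite_measure_mono[OF _ event_infinite_cluster])
      (use subcluster_subset_cluster finite_subset in blast)
  finally show ?thesis .
qed

text \<open>Almost surely some ancestor of the root has an uncovered edge above it. The first such
  ancestor is connected to the root, so its subcluster contains the cluster of the root, and the
  subclusters of all the countably many ancestors are almost surely finite.\<close>

lemma percolation_prob_zero:
  assumes "\<not> supercritical b (uncovered d \<kappa> \<alpha>)"
  shows "percolation_prob d adj r0 \<alpha> \<kappa> = 0"
proof -
  let ?P = "loop_soup d adj \<alpha> \<kappa>"
  define U where "U = {\<omega>\<in>space ?P. \<forall>i. \<exists>k. cov UNIV k ((par ^^ i) r0) \<omega>}"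
  define S where "S i = {\<omega>\<in>space ?P. infinite (subcluster ((par ^^ i) r0) \<omega>)}" for i
  have U: "U \<in> null_sets ?P"
  proof -
    have "U \<in> events"
      unfolding U_def by (intro sets.sets_Collect_countable_All sets.sets_Collect_countable_Ex event_cov)
    moreover have "prob U = 0" unfolding U_def by (rule prob_all_covered_above[OF assms])
    ultimately show ?thesis by (simp add: null_sets_def emeasure_eq_measure)
  qed
  have S: "S i \<in> null_sets ?P" for i
  proof -
    have "S i \<in> events" unfolding S_def by (rule event_infinite)
    moreover have "prob (S i) = 0" unfolding S_def by (rule prob_infinite_zero[OF assms])
    ultimately show ?thesis by (simp add: null_sets_def emeasure_eq_measure)
  qed
  have "{\<omega>\<in>space ?P. infinite (cluster adj \<omega> r0)} \<subseteq> U \<union> (\<Union>i. S i)"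
  proof (rule subsetI, rule ccontr)
    fix \<omega> assume "\<omega> \<in> {\<omega>\<in>space ?P. infinite (cluster adj \<omega> r0)}" and no: "\<omega> \<notin> U \<union> (\<Union>i. S i)"
    then have \<omega>: "\<omega> \<in> space ?P" "infinite (cluster adj \<omega> r0)" by auto
    then have ex: "\<exists>i. \<not> (\<exists>k. cov UNIV k ((par ^^ i) r0) \<omega>)" using no unfolding U_def by blast
    define n where "n = (LEAST i. \<not> (\<exists>k. cov UNIV k ((par ^^ i) r0) \<omega>))"
    have n: "\<not> (\<exists>k. cov UNIV k ((par ^^ n) r0) \<omega>)"
      unfolding n_def using ex by (rule LeastI_ex)
    have below: "\<exists>k. cov UNIV k ((par ^^ i) r0) \<omega>" if "i < n" for i
      using not_less_Least[OF that[unfolded n_def]] by blast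
    have "conn n r0 \<omega>" by (rule covered_below_uncovered[OF below n])
    then have "r0 \<in> subcluster ((par ^^ n) r0) \<omega>" unfolding subcluster_def desc_def by blast
    moreover have "loop_vertices l \<subseteq> subcluster ((par ^^ n) r0) \<omega>"
      if "l \<in> open_loops adj \<omega>" "loop_vertices l \<inter> subcluster ((par ^^ n) r0) \<omega> \<noteq> {}" for l
      using subcluster_closed[OF n, of _ l] that \<omega>(1) unfolding open_loops_def by blast
    ultimately have "cluster adj \<omega> r0 \<subseteq> subcluster ((par ^^ n) r0) \<omega>" by (rule cluster_subset)
    moreover have "finite (subcluster ((par ^^ n) r0) \<omega>)" using no \<omega>(1) unfolding S_def by blast
    ultimately show False using \<omega>(2) finite_subset by blast
  qed
  moreover have "U \<union> (\<Union>i. S i) \<in> null_sets ?P" using U S by (intro null_sets.Un null_sets_UN) auto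
  ultimately have "{\<omega>\<in>space ?P. infinite (cluster adj \<omega> r0)} \<in> null_sets ?P"
    using event_infinite_cluster null_sets_subset by blast
  then show ?thesis unfolding percolation_prob_def by (simp add: measure_eq_0_null_sets)
qed

lemma uncovered_0: "uncovered d \<kappa> \<alpha> 0 = 1"
  by (rule u_0)

end

section \<open>Dependence on the intensity\<close>

lemma uncovered_powr:
  assumes "\<alpha> > 0"
  shows "uncovered d \<kappa> \<alpha> k = uncovered d \<kappa> 1 k powr \<alpha>"
  unfolding uncovered_def by (rule void_powr[OF countable_crossing crossing_loops assms])

lemma supercritical_left_open:
  assumes "\<alpha> > 0" "supercritical b (uncovered d \<kappa> \<alpha>)"
  shows "\<exists>\<alpha>'. 0 < \<alpha>' \<and> \<alpha>' < \<alpha> \<and> supercritical b (uncovered d \<kappa> \<alpha>')"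
proof -
  let ?c = "uncovered d \<kappa> 1"
  let ?f = "\<lambda>K a. \<Sum>k<K. real b ^ Suc k * (?c k powr a - ?c (Suc k) powr a)"
  have f: "(\<Sum>k<K. real b ^ Suc k * (uncovered d \<kappa> a k - uncovered d \<kappa> a (Suc k))) = ?f K a" if "a > 0" for K a
    using uncovered_powr[OF that] by simp
  obtain K where K: "?f K \<alpha> > 1" using assms f[OF assms(1)] unfolding supercritical_def by auto
  \<comment> \<open>A base 0 is treated apart: there the function is constantly 0.\<close>
  have "((\<lambda>a. ?c k powr a) \<longlongrightarrow> ?c k powr \<alpha>) (at_left \<alpha>)" for k
    by (cases "?c k = 0") (auto intro!: tendsto_powr tendsto_ident_at)
  then have "(?f K \<longlongrightarrow> ?f K \<alpha>) (at_left \<alpha>)"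
    by (intro tendsto_sum tendsto_mult tendsto_const tendsto_diff)
  then have "eventually (\<lambda>a. ?f K a > 1) (at_left \<alpha>)" using K by (rule order_tendstoD)
  moreover have "eventually (\<lambda>a. a > 0 \<and> a < \<alpha>) (at_left \<alpha>)"
    using eventually_at_left_real[OF assms(1)] by simp
  ultimately have "eventually (\<lambda>a. ?f K a > 1 \<and> a > 0 \<and> a < \<alpha>) (at_left \<alpha>)" by (rule eventually_conj)
  then obtain a where a: "?f K a > 1" "a > 0" "a < \<alpha>"
    using eventually_happens[of _ "at_left \<alpha>"] trivial_limit_at_left_real by blast
  have "supercritical b (uncovered d \<kappa> a)"
    unfolding supercritical_def f[OF a(2)] using a(1) by (rule exI)
  with a(2,3) show ?thesis by blast
qed

lemma crossing_2_loop:
  "rotations [r0, par r0] \<in> crossing 1 r0"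
proof -
  have l: "rotations [r0, par r0] \<in> loops adj"
    unfolding loops_eq by (rule imageI) (simp add: based_loop_def adj_iff)
  have "is_top (par r0) {r0, par r0}"
    unfolding is_top_def
  proof (intro conjI ballI)
    fix v assume "v \<in> {r0, par r0}"
    then show "\<exists>k. (par ^^ k) v = par r0 \<and> (\<forall>i\<le>k. (par ^^ i) v \<in> {r0, par r0})"
    proof
      assume "v = r0"
      then show ?thesis by (intro exI[of _ 1]) (simp add: le_Suc_eq)
    next
      assume "v \<in> {par r0}"
      then show ?thesis by (intro exI[of _ 0]) simp
    qed
  qed simp
  then have "top_of (rotations [r0, par r0]) = par r0"
    by (intro top_of_eqI[OF l]) (simp add: loop_vertices_rotations)
  with l show ?thesis by (simp add: crossing_def loop_vertices_rotations)
qed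

lemma supercritical_large:
  assumes "d > 0" "\<kappa> > -1"
  shows "\<exists>\<alpha>\<ge>0. supercritical b (uncovered d \<kappa> \<alpha>)"
proof -
  let ?\<nu> = "loop_measure d adj \<kappa>"
  let ?l = "rotations [r0, par r0]"
  have l: "?l \<in> loops adj" using crossing_2_loop by (simp add: crossing_def)
  have pos: "loop_weight d \<kappa> 2 > 0" using assms by (simp add: loop_weight_def)
  have "measure ?\<nu> {?l} = (\<Sum>vs\<in>?l. loop_weight d \<kappa> (length vs))"
    by (rule measure_loop[OF l assms(2)])
  also have "\<dots> = (\<Sum>vs\<in>?l. loop_weight d \<kappa> 2)"
  proof (rule sum.cong[OF refl])
    fix vs assume "vs \<in> ?l"
    from length_rotations[OF this] have "length vs = 2" by simp
    then show "loop_weight d \<kappa> (length vs) = loop_weight d \<kappa> 2" by (simp only:)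
  qed
  also have "\<dots> > 0"
  proof -
    have "?l \<noteq> {}" using self_rotations by blast
    then show ?thesis using pos finite_rotations by (intro sum_pos) auto
  qed
  finally have m: "measure ?\<nu> {?l} > 0" .
  \<comment> \<open>The single loop of length 2 over the root edge then gives
    \<open>uncovered d \<kappa> \<alpha> 1 \<le> 1 / 4\<close>, and the first term of the sum alone
    is at least \<open>2 * (3 / 4) > 1\<close>.\<close>
  define \<alpha> where "\<alpha> = ln 4 / measure ?\<nu> {?l}"
  have \<alpha>: "\<alpha> \<ge> 0" using m by (simp add: \<alpha>_def)
  have "uncovered d \<kappa> \<alpha> 1 \<le> exp (- (\<alpha> * measure ?\<nu> {?l}))"
    unfolding uncovered_def
    by (rule void_le[OF crossing_2_loop _ \<alpha>]) (use l in \<open>simp add: space_loop_measure\<close>)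
  also have "\<dots> = 1 / 4" using m by (simp add: \<alpha>_def exp_minus)
  finally have u1: "uncovered d \<kappa> \<alpha> 1 \<le> 1 / 4" .
  have "1 < real 2 * (1 - 1 / 4)" by simp
  also have "\<dots> \<le> real b * (uncovered d \<kappa> \<alpha> 0 - uncovered d \<kappa> \<alpha> 1)"
    using b2 u1 uncovered_0[OF \<alpha> assms(2)] by (intro mult_mono) auto
  finally have "supercritical b (uncovered d \<kappa> \<alpha>)"
    unfolding supercritical_def by (intro exI[of _ 1]) simp
  with \<alpha> show ?thesis by blast
qed

theorem percolation_prob_critical:
  assumes "d > 0" "\<kappa> > -1"
  shows "percolation_prob d adj r0 (critical_value d adj r0 \<kappa>) \<kappa> = 0"
proof -
  let ?S = "{\<alpha>. \<alpha> \<ge> 0 \<and> percolation_prob d adj r0 \<alpha> \<kappa> > 0}"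
  let ?c = "critical_value d adj r0 \<kappa>"
  have bdd: "bdd_below ?S" by (rule bdd_belowI[of _ 0]) simp
  obtain \<alpha> where "\<alpha> \<ge> 0" "supercritical b (uncovered d \<kappa> \<alpha>)"
    using supercritical_large[OF assms] by blast
  then have ne: "?S \<noteq> {}" using percolation_prob_pos[OF _ assms(2)] by blast
  then have c0: "?c \<ge> 0" unfolding critical_value_def by (rule cInf_greatest) simp
  have "\<not> supercritical b (uncovered d \<kappa> ?c)"
  proof
    assume sup: "supercritical b (uncovered d \<kappa> ?c)"
    have "?c \<noteq> 0"
    proof
      assume "?c = 0"
      then have "uncovered d \<kappa> ?c k = 1" for k
        by (simp add: uncovered_def void_0[OF countable_crossing crossing_loops])
      with sup show False by (simp add: supercritical_def)
    qed
    with c0 have "?c > 0" by simp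
    then obtain a where a: "0 < a" "a < ?c" "supercritical b (uncovered d \<kappa> a)"
      using supercritical_left_open[OF _ sup] by blast
    then have "a \<in> ?S" using percolation_prob_pos[OF _ assms(2)] by simp
    then have "?c \<le> a" unfolding critical_value_def using bdd by (rule cInf_lower)
    with a(2) show False by simp
  qed
  then show ?thesis by (rule percolation_prob_zero[OF c0 assms(2)])
qed

end

section \<open>Orienting a regular tree towards an end\<close>

text \<open>Loop erasure: when a step returns to a visited vertex, the walk is cut back to that
  visit.\<close>

lemma rtranclp_imp_distinct_walk:
  assumes "r\<^sup>*\<^sup>* x y"
  shows "\<exists>vs. vs \<noteq> [] \<and> hd vs = x \<and> last vs = y \<and> successively r vs \<and> distinct vs"
  using assms
proof (induction rule: rtranclp_induct)
  case base
  show ?case by (intro exI[of _ "[x]"]) simp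
next
  case (step y z)
  then obtain vs where vs: "vs \<noteq> []" "hd vs = x" "last vs = y" "successively r vs" "distinct vs" by blast
  show ?case
  proof (cases "z \<in> set vs")
    case True
    then obtain as bs where "vs = as @ z # bs" by (meson split_list)
    with vs show ?thesis
      by (intro exI[of _ "as @ [z]"]) (auto simp: successively_append_iff hd_append successively_Cons)
  next
    case False
    with vs step(2) show ?thesis
      by (intro exI[of _ "vs @ [z]"]) (auto simp: successively_append_iff)
  qed
qed

locale acyclic_graph =
  fixes adj :: "'v \<Rightarrow> 'v \<Rightarrow> bool" and r0 :: 'v
  assumes sym: "adj x y \<Longrightarrow> adj y x" and irrefl: "\<not> adj x x"
    and connected: "adj\<^sup>*\<^sup>* r0 x"
    and no_cycle: "based_loop adj vs \<Longrightarrow> length vs \<ge> 3 \<Longrightarrow> \<not> distinct vs"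
begin

definition avoiding :: "'v \<Rightarrow> 'v \<Rightarrow> 'v \<Rightarrow> bool" where
  "avoiding v x y \<longleftrightarrow> adj x y \<and> x \<noteq> v \<and> y \<noteq> v"

text \<open>A self-avoiding walk between two distinct neighbours of \<open>v\<close> that misses
  \<open>v\<close> would close up through \<open>v\<close> to a cycle.\<close>

lemma neighbours_separated:
  assumes "adj v x" "adj v y" "(avoiding v)\<^sup>*\<^sup>* x y"
  shows "x = y"
proof (rule ccontr)
  assume "x \<noteq> y"
  obtain vs where vs: "vs \<noteq> []" "hd vs = x" "last vs = y" "successively (avoiding v) vs" "distinct vs"
    using rtranclp_imp_distinct_walk[OF assms(3)] by blast
  have "x \<noteq> v" using assms(1) irrefl by blast
  have notin: "v \<notin> set ws" if "successively (avoiding v) ws" "ws \<noteq> []" "hd ws \<noteq> v" for ws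
    using that
  proof (induction ws)
    case (Cons a ws)
    then show ?case by (cases "ws = []") (auto simp: successively_Cons avoiding_def)
  qed simp
  have "successively adj vs"
    by (rule successively_mono[OF vs(4)]) (simp add: avoiding_def)
  moreover have "length vs \<ge> 2"
    using vs(1-3) \<open>x \<noteq> y\<close> by (cases vs rule: remdups_adj.cases) auto
  ultimately have "based_loop adj (v # vs)" "length (v # vs) \<ge> 3"
    using vs assms(1,2) sym by (auto simp: based_loop_def successively_Cons)
  moreover have "distinct (v # vs)" using vs notin[of vs] \<open>x \<noteq> v\<close> by simp
  ultimately show False using no_cycle by blast
qed

definition depth :: "'v \<Rightarrow> nat" where
  "depth v = (LEAST n. (adj ^^ n) r0 v)"

lemma depth_walk: "(adj ^^ depth v) r0 v"
  unfolding depth_def using rtranclp_imp_relpowp[OF connected] by (rule LeastI_ex)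

lemma depth_le: "(adj ^^ n) r0 v \<Longrightarrow> depth v \<le> n"
  unfolding depth_def by (rule Least_le)

lemma depth_0_iff: "depth v = 0 \<longleftrightarrow> v = r0"
  using depth_walk[of v] depth_le[of 0 r0] by auto

lemma depth_adj: "adj x y \<Longrightarrow> depth y \<le> Suc (depth x)"
  by (rule depth_le) (use depth_walk[of x] in \<open>auto intro: relpowp_Suc_I\<close>)

lemma depth_pred:
  assumes "v \<noteq> r0"
  shows "\<exists>x. adj x v \<and> depth v = Suc (depth x)"
proof -
  obtain n where n: "depth v = Suc n" using assms depth_0_iff by (cases "depth v") auto
  with depth_walk[of v] obtain x where x: "(adj ^^ n) r0 x" "adj x v" by (auto elim: relpowp_Suc_E)
  have "depth x \<le> n" by (rule depth_le[OF x(1)])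
  with depth_adj[OF x(2)] n x(2) show ?thesis by (intro exI[of _ x]) auto
qed

text \<open>Along a shortest path from \<open>r0\<close> to \<open>x\<close>, every vertex before
  \<open>x\<close> has depth below \<open>depth v\<close>, so it is not \<open>v\<close>.\<close>

lemma reach_avoiding:
  assumes "r0 \<noteq> v" "x \<noteq> v" "depth x \<le> depth v"
  shows "(avoiding v)\<^sup>*\<^sup>* r0 x"
  using assms(2,3)
proof (induction "depth x" arbitrary: x)
  case 0
  then show ?case using depth_0_iff by simp
next
  case (Suc n)
  then obtain y where y: "adj y x" "depth x = Suc (depth y)"
    using depth_pred depth_0_iff by (metis nat.distinct(1))
  have "y \<noteq> v" using y(2) Suc.prems(2) by auto
  with Suc y have "(avoiding v)\<^sup>*\<^sup>* r0 y" by simp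
  moreover have "avoiding v y x" using y \<open>y \<noteq> v\<close> Suc.prems by (simp add: avoiding_def)
  ultimately show ?case by simp
qed

text \<open>Both neighbours reach the root without \<open>v\<close>, hence each other. The depths
  are compared by \<open>\<le>\<close>, so that neighbours on the same level are ruled out too, as
  \<open>depth_adj_cases\<close> requires.\<close>

lemma lower_neighbour_unique:
  assumes "adj v x" "adj v y" "depth x \<le> depth v" "depth y \<le> depth v"
  shows "x = y"
proof -
  have xy: "x \<noteq> v" "y \<noteq> v" using assms irrefl by auto
  have "r0 \<noteq> v"
  proof
    assume "r0 = v"
    then have "depth x = 0" using assms(3) depth_0_iff[of v] by simp
    with xy(1) \<open>r0 = v\<close> show False using depth_0_iff by simp
  qed
  have "symp (avoiding v)" using sym by (auto simp: symp_def avoiding_def)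
  then have "(avoiding v)\<^sup>*\<^sup>* x r0"
    using reach_avoiding[OF \<open>r0 \<noteq> v\<close> xy(1) assms(3)] symp_rtranclp by (metis sympD)
  then have "(avoiding v)\<^sup>*\<^sup>* x y"
    using reach_avoiding[OF \<open>r0 \<noteq> v\<close> xy(2) assms(4)] by (rule rtranclp_trans)
  then show ?thesis using neighbours_separated assms(1,2) by blast
qed

lemma depth_adj_cases:
  assumes "adj x y"
  shows "depth y = Suc (depth x) \<or> depth x = Suc (depth y)"
proof -
  have "depth y = Suc (depth x)" if "adj x y" "depth x \<le> depth y" for x y
  proof -
    have "y \<noteq> r0"
    proof
      assume "y = r0"
      then have "x = r0" using that(2) depth_0_iff[of x] depth_0_iff[of r0] by simp
      with that(1) irrefl \<open>y = r0\<close> show False by simp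
    qed
    then obtain z where z: "adj z y" "depth y = Suc (depth z)" using depth_pred by blast
    have "x = z" by (rule lower_neighbour_unique[of y]) (use that z sym in auto)
    with z show ?thesis by simp
  qed
  then show ?thesis using assms sym nat_le_linear by metis
qed

end

section \<open>A ray and the parent map it induces\<close>

locale branching_tree = acyclic_graph adj r0 for adj :: "'v \<Rightarrow> 'v \<Rightarrow> bool" and r0 :: 'v +
  fixes d :: nat
  assumes d3: "d \<ge> 3" and fin_nbs: "finite {w. adj v w}" and card_nbs: "card {w. adj v w} = d"
begin

lemma upper_neighbour: "\<exists>y. adj v y \<and> depth y = Suc (depth v)"
proof (rule ccontr)
  assume no: "\<not> ?thesis"
  have le: "depth y \<le> depth v" if "adj v y" for y
    using no that depth_adj_cases[OF that] by auto
  then have "y = z" if "adj v y" "adj v z" for y z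
    using that lower_neighbour_unique by blast
  then have "card {w. adj v w} \<le> 1"
    using card_le_Suc0_iff_eq[OF fin_nbs] by fastforce
  with card_nbs[of v] d3 show False by simp
qed

text \<open>A ray from the root represents the end; it is traversed upwards, all other edges point to the root.\<close>

definition ray :: "nat \<Rightarrow> 'v" where
  "ray n = ((\<lambda>v. SOME y. adj v y \<and> depth y = Suc (depth v)) ^^ n) r0"

lemma ray_Suc: "adj (ray n) (ray (Suc n))" "depth (ray (Suc n)) = Suc (depth (ray n))"
  using someI_ex[OF upper_neighbour[of "ray n"]] by (simp_all add: ray_def)

lemma ray_0: "ray 0 = r0"
  by (simp add: ray_def)

lemma depth_ray [simp]: "depth (ray n) = n"
  by (induction n) (simp_all add: ray_0 ray_Suc depth_0_iff)

definition parent :: "'v \<Rightarrow> 'v" where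
  "parent v = (if v = ray (depth v) then ray (Suc (depth v))
    else (THE x. adj v x \<and> depth v = Suc (depth x)))"

lemma parent_ray: "parent (ray n) = ray (Suc n)"
  by (simp add: parent_def)

lemma parent_eqI:
  assumes "v \<noteq> ray (depth v)" "adj v x" "depth v = Suc (depth x)"
  shows "parent v = x"
  unfolding parent_def using assms lower_neighbour_unique[of v]
  by (auto intro!: the_equality)

lemma parent_off_ray:
  assumes "v \<noteq> ray (depth v)"
  shows "adj v (parent v)" "depth v = Suc (depth (parent v))"
proof -
  have "v \<noteq> r0" using assms ray_0 depth_0_iff by metis
  then obtain x where "adj v x" "depth v = Suc (depth x)" using depth_pred sym by blast
  with parent_eqI[OF assms] show "adj v (parent v)" "depth v = Suc (depth (parent v))" by auto
qed

lemma adj_parent: "adj v (parent v)"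
  using parent_off_ray(1) parent_ray ray_Suc(1) by metis

text \<open>Let \<open>y\<close> be the deeper endpoint of an edge. If \<open>y\<close> is on the
  ray, uniqueness of its lower neighbour puts \<open>x\<close> on the ray, so \<open>y\<close> is
  the parent; otherwise \<open>x\<close> is the parent of \<open>y\<close>.\<close>

lemma adj_iff_parent: "adj x y \<longleftrightarrow> parent x = y \<or> parent y = x"
proof
  have "parent x = y \<or> parent y = x" if "adj x y" "depth y = Suc (depth x)" for x y
  proof (cases "y = ray (depth y)")
    case True
    then have y: "y = ray (Suc (depth x))" using that(2) by simp
    have "x = ray (depth x)"
      by (rule lower_neighbour_unique[of y]) (use that y ray_Suc(1) sym in auto)
    then show ?thesis using y parent_ray by metis
  next
    case False
    then show ?thesis using parent_eqI that sym by blast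
  qed
  then show "adj x y \<Longrightarrow> parent x = y \<or> parent y = x"
    using depth_adj_cases sym by metis
  show "parent x = y \<or> parent y = x \<Longrightarrow> adj x y" using adj_parent sym by blast
qed

lemma parent_pow_ray: "(parent ^^ k) (ray n) = ray (n + k)"
  by (induction k) (simp_all add: parent_ray)

lemma reaches_ray: "\<exists>i j. (parent ^^ i) v = ray j"
proof (induction "depth v" arbitrary: v rule: less_induct)
  case less
  show ?case
  proof (cases "v = ray (depth v)")
    case True
    then show ?thesis by (metis funpow_0)
  next
    case False
    then have "depth (parent v) < depth v" using parent_off_ray(2)[OF False] by linarith
    from less[OF this] obtain i j where "(parent ^^ i) (parent v) = ray j" by blast
    then have "(parent ^^ Suc i) v = ray j" by (simp add: funpow_swap1)
    then show ?thesis by blast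
  qed
qed

text \<open>Every orbit enters the ray and stays there. A periodic \<open>v\<close> returns after
  that, so it lies on the ray itself, where each step increases the depth.\<close>

lemma parent_acyclic:
  assumes "(parent ^^ k) v = v"
  shows "k = 0"
proof (rule ccontr)
  assume "k \<noteq> 0"
  obtain i j where ij: "(parent ^^ i) v = ray j" using reaches_ray by blast
  have "(parent ^^ (k * m)) v = v" for m
    by (induction m) (simp_all add: funpow_add assms)
  then have "v = (parent ^^ (k * i - i + i)) v" using \<open>k \<noteq> 0\<close> by simp
  also have "\<dots> = ray (j + (k * i - i))" by (simp only: funpow_add comp_apply ij parent_pow_ray)
  finally obtain p where p: "v = ray p" by blast
  then have "ray (p + k) = ray p" using assms parent_pow_ray by simp
  then have "p + k = p" using depth_ray by metis
  with \<open>k \<noteq> 0\<close> show False by simp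
qed

lemma oriented: "oriented_tree parent (d - 1) adj r0"
proof
  show "2 \<le> d - 1" using d3 by simp
  show "(parent ^^ k) v = v \<Longrightarrow> k = 0" for k v by (rule parent_acyclic)
  have nbs: "{w. adj v w} = insert (parent v) {y. parent y = v}" for v
    by (auto simp: adj_iff_parent)
  then show fin: "finite {y. parent y = v}" for v
    using fin_nbs[of v] by (metis finite_insert)
  \<comment> \<open>A parent that is also a child would give a period of length 2; hence the
    \<open>d\<close> neighbours are one parent and \<open>d - 1\<close> children.\<close>
  have "parent v \<notin> {y. parent y = v}" for v
    using parent_acyclic[of 2 v] by (auto simp: numeral_2_eq_2)
  then show "card {y. parent y = v} = d - 1" for v
    using card_nbs[of v] fin[of v] unfolding nbs by simp
  show "adj x y \<longleftrightarrow> parent x = y \<or> parent y = x" for x y by (rule adj_iff_parent)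
  show "\<exists>i j. (parent ^^ i) y = (parent ^^ j) r0" for y
    using reaches_ray[of y] parent_pow_ray[of _ 0] by (metis add_0 ray_0)
qed

end

lemma branching_tree_regular_tree:
  assumes "d \<ge> 3" "regular_tree d adj"
  shows "branching_tree adj r0 d"
  using assms unfolding regular_tree_def
  by unfold_locales (auto simp: symp_def irreflp_def)

theorem theorem1p6:
  fixes d :: nat and adj :: "'v \<Rightarrow> 'v \<Rightarrow> bool" and r0 :: 'v and \<kappa> :: real
  assumes "d \<ge> 3"
    and "regular_tree d adj"
    and "\<kappa> > -1"
  shows "percolation_prob d adj r0 (critical_value d adj r0 \<kappa>) \<kappa> = 0"
proof -
  interpret branching_tree adj r0 d
    using assms(1,2) by (rule branching_tree_regular_tree)
  interpret oriented_tree parent "d - 1" adj r0 by (rule oriented)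
  show ?thesis by (rule percolation_prob_critical) (use assms in auto)
qed

end
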